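(* Let $N\ge1$ and let $f:\mathbb{R}\times[0,1]\to\mathbb{R}$ satisfy the following hypotheses: $f(\cdot,u)\in L^\infty(\mathbb{R})$ for all $u\in[0,1]$; as a function of $u$, $f$ is Lipschitz continuous in $[0,1]$ and of class $C^1$ in a neighborhood of $0$, uniformly with respect to $t\in\mathbb{R}$; and, setting $\mu(t):=f_u'(t,0)$, (i) for a.e. $t\in\mathbb{R}$, $f(t,0)=f(t,1)=0$, and for all $u\in(0,1)$, $\operatorname{ess\,inf}_{t\in\mathbb{R}}f(t,u)>0$; (ii) $f(t,u)\le\mu(t)u$ for a.e. $(t,u)\in\mathbb{R}\times[0,1]$; (iii) there exist $C>0$ and $\nu,\delta\in(0,1]$ such that $f(t,u)\ge\mu(t)u-Cu^{1+\nu}$ for a.e. $(t,u)\in\mathbb{R}\times[0,\delta]$. Let $u_0\in C^0(\mathbb{R}^N)$ be such that $0\le u_0\le1$ and $u_0\not\equiv0$. Then the solution $u$ of the Cauchy problem $$\partial_tu-\Delta u=f(t,u),\quad x\in\mathbb{R}^N,\ t>0,\qquad u(x,0)=u_0(x),\quad x\in\mathbb{R}^N,$$ satisfies, for all $0\le\gamma<2\sqrt{\underline{\mu}_+}$, $$\lim_{t\to+\infty}\inf_{|x|\le\gamma t}u(x,t)=1.$$ If in addition $u_0$ is compactly supported, then for all $\sigma>0$, $$\lim_{t\to+\infty}\ \sup_{|x|\ge2\sqrt{t\int_0^t\mu(s)\,ds}+\sigma t}u(x,t)=0.$$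
   Context: Least mean over $\mathbb{R}_+$: for $g\in L^\infty((0,+\infty))$, $\underline{g}_+:=\sup_{T>0}\inf_{t>0}\frac1T\int_t^{t+T}g(s)\,ds$; $\underline{\mu}_+$ is this quantity for the restriction of $\mu$ to $(0,+\infty)$. Solutions are strong solutions: here $u$ is the function with values in $[0,1]$, in $W^{2,1}_{N+1,loc}(\mathbb{R}^N\times(0,+\infty))$ and continuous up to $t=0$, satisfying the equation for a.e. $x\in\mathbb{R}^N$, $t>0$ together with the initial condition, where $W^{2,1}_p(\mathcal{Q})$ is the space of functions $u$ with $u,\partial_{x_i}u,\partial_{x_ix_j}u,\partial_tu\in L^p(\mathcal{Q})$. *)

theory Defs
  imports "HOL-Analysis.Analysis" "HOL-Probability.Essential_Supremum"
begin

definition Linfty :: "(real \<Rightarrow> real) \<Rightarrow> bool" where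
  "Linfty g \<longleftrightarrow>
     g \<in> borel_measurable lebesgue \<and> esssup lebesgue (\<lambda>t. ereal \<bar>g t\<bar>) < \<infinity>"

(* Intended for measurable g: by convention esssup is \<infinity> on nonmeasurable functions. *)
definition ess_inf :: "(real \<Rightarrow> real) \<Rightarrow> ereal" where
  "ess_inf g = - esssup lebesgue (\<lambda>t. - ereal (g t))"

(* Intended for g in L^\<infinity>(0,\<infinity>), where all suprema and infima are over bounded sets of reals. *)
definition least_mean_plus :: "(real \<Rightarrow> real) \<Rightarrow> real" where
  "least_mean_plus g =
     (SUP T\<in>{0<..}. INF t\<in>{0<..}. (1 / T) * (LINT s:{t..t + T}|lebesgue. g s))"

(* The u-derivative of f on [0,1]; one-sided at the end points. *)
definition deriv_u :: "(real \<Rightarrow> real \<Rightarrow> real) \<Rightarrow> real \<Rightarrow> real \<Rightarrow> real" where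
  "deriv_u f t u = vector_derivative (f t) (at u within {0..1})"

(* There are a common neighbourhood [0,r] of 0 (relative to [0,1]) on which every f(t,.) is
   differentiable, and a common modulus of continuity for the derivatives. *)
definition C1_near_0_uniformly :: "(real \<Rightarrow> real \<Rightarrow> real) \<Rightarrow> bool" where
  "C1_near_0_uniformly f \<longleftrightarrow>
     (\<exists>r\<in>{0<..1}.
        (\<forall>t. \<forall>u\<in>{0..r}. f t differentiable (at u within {0..1})) \<and>
        (\<forall>\<epsilon>>0. \<exists>\<eta>>0. \<forall>t. \<forall>u\<in>{0..r}. \<forall>v\<in>{0..r}.
            \<bar>u - v\<bar> < \<eta> \<longrightarrow> \<bar>deriv_u f t u - deriv_u f t v\<bar> < \<epsilon>))"

definition partial_deriv ::
  "'a::euclidean_space \<Rightarrow> ('a \<Rightarrow> real) \<Rightarrow> 'a \<Rightarrow> real" where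
  "partial_deriv b \<phi> z = frechet_derivative \<phi> (at z) b"

primrec Ck :: "nat \<Rightarrow> ('a::euclidean_space \<Rightarrow> real) \<Rightarrow> bool" where
  "Ck 0 \<phi> \<longleftrightarrow> continuous_on UNIV \<phi>"
| "Ck (Suc k) \<phi> \<longleftrightarrow>
     \<phi> differentiable_on UNIV \<and> (\<forall>b\<in>Basis. Ck k (partial_deriv b \<phi>))"

definition test_function :: "'a::euclidean_space set \<Rightarrow> ('a \<Rightarrow> real) \<Rightarrow> bool" where
  "test_function Q \<phi> \<longleftrightarrow>
     (\<forall>k. Ck k \<phi>) \<and> compact (closure {z. \<phi> z \<noteq> 0}) \<and> closure {z. \<phi> z \<noteq> 0} \<subseteq> Q"

definition Lp_on :: "real \<Rightarrow> 'a::euclidean_space set \<Rightarrow> ('a \<Rightarrow> real) \<Rightarrow> bool" where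
  "Lp_on p Q v \<longleftrightarrow>
     set_borel_measurable lebesgue Q v \<and> set_integrable lebesgue Q (\<lambda>z. \<bar>v z\<bar> powr p)"

definition Lp_loc :: "real \<Rightarrow> 'a::euclidean_space set \<Rightarrow> ('a \<Rightarrow> real) \<Rightarrow> bool" where
  "Lp_loc p Q v \<longleftrightarrow> (\<forall>K. compact K \<and> K \<subseteq> Q \<longrightarrow> Lp_on p K v)"

(* v is the weak partial derivative of u in direction b on the open set Q. *)
definition weak_deriv ::
  "'a::euclidean_space set \<Rightarrow> 'a \<Rightarrow> ('a \<Rightarrow> real) \<Rightarrow> ('a \<Rightarrow> real) \<Rightarrow> bool" where
  "weak_deriv Q b u v \<longleftrightarrow>
     Lp_loc 1 Q u \<and> Lp_loc 1 Q v \<and>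
     (\<forall>\<phi>. test_function Q \<phi> \<longrightarrow>
        (LINT z:Q|lebesgue. u z * partial_deriv b \<phi> z) = - (LINT z:Q|lebesgue. v z * \<phi> z))"

(* u is in W^{2,1}_{p,loc}(Q), with Dx i, Dxx i j and Dt representing the weak derivatives
   of u in x_i, in x_i and x_j, and in t, respectively. *)
definition W21_loc_derivs ::
  "real \<Rightarrow> ((real^'n) \<times> real) set \<Rightarrow> ((real^'n) \<times> real \<Rightarrow> real) \<Rightarrow>
   ('n \<Rightarrow> (real^'n) \<times> real \<Rightarrow> real) \<Rightarrow> ('n \<Rightarrow> 'n \<Rightarrow> (real^'n) \<times> real \<Rightarrow> real) \<Rightarrow>
   ((real^'n) \<times> real \<Rightarrow> real) \<Rightarrow> bool" where
  "W21_loc_derivs p Q u Dx Dxx Dt \<longleftrightarrow>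
     (\<forall>i. weak_deriv Q (axis i 1, 0) u (Dx i)) \<and>
     (\<forall>i j. weak_deriv Q (axis j 1, 0) (Dx i) (Dxx i j)) \<and>
     weak_deriv Q (0, 1) u Dt \<and>
     Lp_loc p Q u \<and> (\<forall>i. Lp_loc p Q (Dx i)) \<and> (\<forall>i j. Lp_loc p Q (Dxx i j)) \<and> Lp_loc p Q Dt"

(* Strong [0,1]-valued solutions. The weak derivatives are unique up to null sets, so it does
   not matter which representatives enter the equation. Only values of u at times t \<ge> 0
   are constrained. *)
definition strong_solution ::
  "(real \<Rightarrow> real \<Rightarrow> real) \<Rightarrow> (real^'n \<Rightarrow> real) \<Rightarrow> ((real^'n) \<times> real \<Rightarrow> real) \<Rightarrow> bool" where
  "strong_solution f u0 u \<longleftrightarrow>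
     (\<forall>x. \<forall>t\<ge>0. u (x, t) \<in> {0..1}) \<and>
     continuous_on (UNIV \<times> {0..}) u \<and>
     (\<forall>x. u (x, 0) = u0 x) \<and>
     (\<exists>Dx Dxx Dt.
        W21_loc_derivs (real CARD('n) + 1) (UNIV \<times> {0<..}) u Dx Dxx Dt \<and>
        (AE z in lebesgue. snd z > 0 \<longrightarrow> Dt z - (\<Sum>i\<in>UNIV. Dxx i i z) = f (snd z) (u z)))"

end

theory Submission
  imports Defs
begin

text \<open>
  Comparison is proved by mollification: if \<open>u\<close> solves the equation weakly, then its convolution
  with a compactly supported smooth kernel is a classical solution of an approximate equation, to
  which the classical maximum principle on compact sets applies. Barriers have the form
  \<open>exp (\<integral>\<^sub>0\<^sup>t a) \<cdot> \<psi> x t\<close> with \<open>\<psi>\<close> smooth, so that a merely measurable coefficient \<open>a\<close> only enters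
  through its primitive, which is mollified along with \<open>u\<close>.

  Upper bound: exponential plane waves \<open>exp (\<integral>\<^sub>0\<^sup>t \<mu> + l\<^sup>2 t - l (e \<bullet> x))\<close> with \<open>l\<^sup>2 t = \<integral>\<^sub>0\<^sup>t \<mu>\<close>.

  Lower bound: a product of functions \<open>exp (- c\<^sub>i y\<^sub>i / 2) cos (\<beta> y\<^sub>i)\<close>, \<open>y = x - x0 - (t - t0) c\<close>, lives on a cube
  moving with velocity \<open>c\<close> and decays at rate \<open>\<bar>c\<bar>\<^sup>2 / 4 + N \<beta>\<^sup>2\<close>, which is below the least mean of \<open>\<mu>\<close>
  when \<open>\<bar>c\<bar> < 2 \<surd>m\<close> and \<open>\<beta>\<close> is small. Hence \<open>u\<close> stays above a positive constant on every subcritical cone;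
  since \<open>f\<close> is bounded below on compact subintervals of \<open>(0,1)\<close>, a growing concave paraboloid then
  pushes \<open>u\<close> up to \<open>1\<close> within bounded time.
\<close>

section \<open>Smooth bump functions\<close>

text \<open>Strong solutions have only weak derivatives and \<open>f\<close> is merely measurable in
  time, so no pointwise argument applies to \<open>u\<close> itself, and averaging does not commute
  with the nonlinearity. What can be averaged is a one-sided linear bound
  \<open>a(t) q \<le> h\<close>: near the maximum point \<open>q\<close> is within O(\<sigma>) of a
  constant, so averaging \<open>a q\<close> gives that constant times the average of
  \<open>a\<close>, with an error proportional to \<sigma>. The time derivative of the mollified
  primitive of \<open>a\<close> contains exactly the same average, because the same kernel profile
  is used for both. The rough terms therefore combine into a bounded multiple of the difference,
  which an exponential weight in time absorbs. Kernels need room in the past, so every comparison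
  starts at a positive time.

  The factors \<open>exp (- c\<^sub>i y\<^sub>i / 2)\<close> remove the drift of the moving frame by
  a gauge transformation; completing the square leaves \<open>\<bar>c\<bar>\<^sup>2 / 4\<close>, and
  this is the origin of the critical speed \<open>2 \<surd>m\<close>.\<close>

coinductive smooth1 :: "(real \<Rightarrow> real) \<Rightarrow> bool" where
  smooth1I: "(\<And>x. (g has_real_derivative g' x) (at x)) \<Longrightarrow> smooth1 g' \<Longrightarrow> smooth1 g"

lemma smooth1_deriv:
  assumes "smooth1 g"
  shows "(g has_real_derivative deriv g x) (at x)" "smooth1 (deriv g)"
proof -
  from assms obtain g' where g': "\<And>x. (g has_real_derivative g' x) (at x)" "smooth1 g'"
    by (cases rule: smooth1.cases) auto
  then have "deriv g = g'" by (auto intro: DERIV_imp_deriv)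
  with g' show "(g has_real_derivative deriv g x) (at x)" "smooth1 (deriv g)" by auto
qed

lemma smooth1_continuous: "smooth1 g \<Longrightarrow> continuous_on A g"
  by (meson DERIV_continuous continuous_at_imp_continuous_on smooth1_deriv(1))

text \<open>By coinduction: differentiation only changes \<open>c\<close> to
  \<open>c * \<alpha>\<close> and \<open>g\<close> to \<open>deriv g\<close>, so the family with
  \<open>g\<close> and \<open>c\<close> arbitrary and \<alpha>, \<beta> fixed is closed under
  it.\<close>

lemma smooth1_affine:
  assumes "smooth1 g"
  shows "smooth1 (\<lambda>s. c * g (\<alpha> * s + \<beta>))"
proof -
  define F where "F = (\<lambda>s. c * g (\<alpha> * s + \<beta>))"
  have "\<exists>g c. smooth1 g \<and> F = (\<lambda>s. c * g (\<alpha> * s + \<beta>))" using assms F_def by blast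
  then have "smooth1 F"
  proof (coinduction arbitrary: F)
    case smooth1
    then obtain g c where g: "smooth1 g" and F: "F = (\<lambda>s. c * g (\<alpha> * s + \<beta>))" by blast
    have "(F has_real_derivative (c * \<alpha>) * deriv g (\<alpha> * x + \<beta>)) (at x)" for x
      unfolding F
      by (rule derivative_eq_intros DERIV_chain2[OF smooth1_deriv(1)[OF g]] refl | simp)+
    then show ?case
      using smooth1_deriv(2)[OF g]
      by (intro exI[of _ F] exI[of _ "\<lambda>x. (c * \<alpha>) * deriv g (\<alpha> * x + \<beta>)"]) blast
  qed
  then show ?thesis by (simp add: F_def)
qed

text \<open>For \<open>p = 1\<close> this is the flat function exp(-1/x). The polynomial in
  \<open>1 / x\<close> is carried along because repeated differentiation produces such
  products.\<close>

definition hexp :: "real poly \<Rightarrow> real \<Rightarrow> real" where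
  "hexp p x = (if x > 0 then poly p (1 / x) * exp (- (1 / x)) else 0)"

text \<open>The factor \<open>y ^ k\<close> is there for the induction: splitting off the constant
  coefficient raises \<open>k\<close> by one. The case \<open>k = 1\<close> serves the difference
  quotient at 0, which contributes one power of \<open>y = 1 / x\<close>.\<close>

lemma poly_exp_tendsto_0: "((\<lambda>y::real. y ^ k * poly q y * exp (- y)) \<longlongrightarrow> 0) at_top"
proof (induction q arbitrary: k)
  case 0
  then show ?case by simp
next
  case (pCons a q)
  have "((\<lambda>y. a * (y ^ k / exp y) + y ^ Suc k * poly q y * exp (- y)) \<longlongrightarrow> a * 0 + 0) at_top"
    by (intro tendsto_intros tendsto_power_div_exp_0 pCons)
  then show ?case by (simp add: algebra_simps exp_minus divide_inverse)
qed

text \<open>With y = 1/x one has dy/dx = - \<open>y\<^sup>2\<close>, so p(y) exp(-y) becomes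
  \<open>y\<^sup>2\<close> (p - p')(y) exp(-y). At 0 the right-hand difference quotient is y p(y)
  exp(-y) with y tending to infinity, so both one-sided derivatives vanish.\<close>

lemma hexp_deriv: "(hexp p has_real_derivative hexp (monom 1 2 * (p - pderiv p)) x) (at x)"
proof (cases x "0::real" rule: linorder_cases)
  case less
  have "(hexp p has_real_derivative 0) (at x)"
    by (rule has_field_derivative_transform_within_open[of "\<lambda>_. 0" _ _ "{..<0}"])
       (use less in \<open>auto simp: hexp_def\<close>)
  then show ?thesis using less by (simp add: hexp_def)
next
  case equal
  have "((\<lambda>y. (hexp p y - hexp p 0) / (y - 0)) \<longlongrightarrow> 0) (at_right 0)"
  proof -
    have "((\<lambda>y. (y ^ 1 * poly p y * exp (- y))) \<longlongrightarrow> 0) at_top" by (rule poly_exp_tendsto_0)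
    then have "((\<lambda>y. (inverse y ^ 1 * poly p (inverse y) * exp (- inverse y))) \<longlongrightarrow> 0) (at_right 0)"
      using filterlim_compose[of "\<lambda>y. y ^ 1 * poly p y * exp (- y)", OF _ filterlim_inverse_at_top_right] by blast
    moreover have "eventually (\<lambda>y::real. inverse y ^ 1 * poly p (inverse y) * exp (- inverse y) =
        (hexp p y - hexp p 0) / (y - 0)) (at_right 0)"
      unfolding eventually_at_right_field
      by (rule exI[of _ 1]) (auto simp: hexp_def divide_inverse mult_ac)
    ultimately show ?thesis
      by (rule Lim_transform_eventually)
  qed
  moreover have "((\<lambda>y. (hexp p y - hexp p 0) / (y - 0)) \<longlongrightarrow> 0) (at_left 0)"
    unfolding hexp_def by (rule tendsto_eventually, unfold eventually_at_left_field, rule exI[of _ "-1"]) simp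
  ultimately have "((\<lambda>y. (hexp p y - hexp p 0) / (y - 0)) \<longlongrightarrow> 0) (at 0)"
    by (simp add: filterlim_split_at)
  then show ?thesis using equal by (simp add: has_field_derivative_iff hexp_def)
next
  case greater
  have "((\<lambda>x. poly p (1 / x) * exp (- (1 / x))) has_real_derivative hexp (monom 1 2 * (p - pderiv p)) x) (at x)"
  proof -
    have i: "((\<lambda>x. 1 / x) has_real_derivative - (1 / x ^ 2)) (at x)"
      using greater by (auto intro!: derivative_eq_intros simp: power2_eq_square)
    have 1: "((\<lambda>x. poly p (1 / x)) has_real_derivative poly (pderiv p) (1 / x) * - (1 / x ^ 2)) (at x)"
      by (rule DERIV_chain2[OF poly_DERIV i])
    have 2: "((\<lambda>x. exp (- (1 / x))) has_real_derivative exp (- (1 / x)) * - (- (1 / x ^ 2))) (at x)"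
      by (rule DERIV_chain2[OF DERIV_exp DERIV_minus[OF i]])
    show ?thesis
      by (rule DERIV_cong[OF DERIV_mult[OF 1 2]])
         (use greater in \<open>simp add: hexp_def poly_monom algebra_simps power_one_over\<close>)
  qed
  then show ?thesis
    by (rule has_field_derivative_transform_within_open[of _ _ _ "{0<..}"])
       (use greater in \<open>auto simp: hexp_def\<close>)
qed

text \<open>A class that contains the bump and is closed under differentiation: each factor stays of
  the form \<open>hexp\<close>, the product rule yields a sum, and the sign from differentiating
  \<open>1 - x\<close> is moved into the polynomial. Coinduction then gives smoothness.\<close>

inductive_set bump_span :: "(real \<Rightarrow> real) set" where
  base: "(\<lambda>x. hexp p (1 + x) * hexp q (1 - x)) \<in> bump_span"
| add: "f \<in> bump_span \<Longrightarrow> g \<in> bump_span \<Longrightarrow> (\<lambda>x. f x + g x) \<in> bump_span"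

lemma bump_span_deriv:
  "g \<in> bump_span \<Longrightarrow> \<exists>g'\<in>bump_span. \<forall>x. (g has_real_derivative g' x) (at x)"
proof (induction rule: bump_span.induct)
  case (base p q)
  let ?d = "\<lambda>p. monom 1 2 * (p - pderiv p)"
  have "((\<lambda>x. hexp p (1 + x) * hexp q (1 - x)) has_real_derivative
      hexp (?d p) (1 + x) * hexp q (1 - x) + hexp p (1 + x) * hexp (?d (- q)) (1 - x)) (at x)" for x
  proof -
    have neg: "hexp (?d (- q)) y = - hexp (?d q) y" for y
      by (simp add: hexp_def pderiv_minus algebra_simps)
    have 1: "((\<lambda>x. hexp p (1 + x)) has_real_derivative hexp (?d p) (1 + x) * 1) (at x)"
      by (rule DERIV_chain2[OF hexp_deriv]) (auto intro!: derivative_eq_intros)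
    have 2: "((\<lambda>x. hexp q (1 - x)) has_real_derivative hexp (?d q) (1 - x) * (-1)) (at x)"
      by (rule DERIV_chain2[OF hexp_deriv]) (auto intro!: derivative_eq_intros)
    show ?thesis unfolding neg
      by (rule DERIV_cong[OF DERIV_mult[OF 1 2]]) (simp add: algebra_simps)
  qed
  then show ?case
    by (intro bexI[OF _ bump_span.add[OF bump_span.base[of "?d p" q] bump_span.base[of p "?d (- q)"]]]) blast
next
  case (add f g)
  then obtain f' g' where f': "f' \<in> bump_span" "\<forall>x. (f has_real_derivative f' x) (at x)"
    and g': "g' \<in> bump_span" "\<forall>x. (g has_real_derivative g' x) (at x)" by blast
  have "\<forall>x. ((\<lambda>x. f x + g x) has_real_derivative f' x + g' x) (at x)"
    using f' g' by (auto intro: DERIV_add)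
  moreover have "(\<lambda>x. f' x + g' x) \<in> bump_span" using f' g' by (intro bump_span.add)
  ultimately show ?case by (intro bexI[of _ "\<lambda>x. f' x + g' x"]) auto
qed

lemma bump_span_smooth1: "g \<in> bump_span \<Longrightarrow> smooth1 g"
  by (coinduction arbitrary: g) (use bump_span_deriv in blast)

definition bump :: "real \<Rightarrow> real" where
  "bump x = hexp 1 (1 + x) * hexp 1 (1 - x)"

lemma bump_smooth1: "smooth1 bump"
  using bump_span_smooth1[OF bump_span.base[of 1 1]] by (simp add: bump_def[abs_def])

lemma bump_nonneg: "bump x \<ge> 0"
  by (simp add: bump_def hexp_def)

lemma bump_pos_0: "bump 0 > 0"
  by (simp add: bump_def hexp_def)

lemma bump_eq_0: "\<bar>x\<bar> \<ge> 1 \<Longrightarrow> bump x = 0"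
  by (auto simp: bump_def hexp_def)

text \<open>A partial derivative of such a product replaces one factor by its derivative, so
  smoothness in several variables reduces to one variable.\<close>

definition tensor :: "('a::euclidean_space \<Rightarrow> real \<Rightarrow> real) \<Rightarrow> 'a \<Rightarrow> real" where
  "tensor g z = (\<Prod>b\<in>Basis. g b (z \<bullet> b))"

lemma tensor_has_derivative:
  assumes "\<And>b. b \<in> Basis \<Longrightarrow> smooth1 (g b)"
  shows "(tensor g has_derivative
    (\<lambda>y. \<Sum>b\<in>Basis. (deriv (g b) (z \<bullet> b) * (y \<bullet> b)) * (\<Prod>j\<in>Basis - {b}. g j (z \<bullet> j)))) (at z)"
  unfolding tensor_def[abs_def]
proof (rule has_derivative_prod)
  fix b :: 'a assume "b \<in> Basis"
  then have g: "(g b has_derivative (*) (deriv (g b) (z \<bullet> b))) (at (z \<bullet> b))"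
    using smooth1_deriv(1)[OF assms] by (simp add: has_field_derivative_def)
  have "((\<lambda>x. x \<bullet> b) has_derivative (\<lambda>y. y \<bullet> b)) (at z)"
    by (rule bounded_linear_imp_has_derivative[OF bounded_linear_inner_left])
  from has_derivative_compose[OF this g]
  show "((\<lambda>x. g b (x \<bullet> b)) has_derivative (\<lambda>y. deriv (g b) (z \<bullet> b) * (y \<bullet> b))) (at z)" .
qed

lemma tensor_partial_deriv:
  assumes "\<And>b. b \<in> Basis \<Longrightarrow> smooth1 (g b)" and c: "c \<in> Basis"
  shows "partial_deriv c (tensor g) = tensor (g(c := deriv (g c)))"
proof
  fix z
  have "partial_deriv c (tensor g) z
      = (\<Sum>b\<in>Basis. (deriv (g b) (z \<bullet> b) * (c \<bullet> b)) * (\<Prod>j\<in>Basis - {b}. g j (z \<bullet> j)))"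
    unfolding partial_deriv_def
    by (subst frechet_derivative_at[OF tensor_has_derivative[OF assms(1)], symmetric]) auto
  also have "\<dots> = (\<Sum>b\<in>Basis. if b = c then deriv (g c) (z \<bullet> c) * (\<Prod>j\<in>Basis - {c}. g j (z \<bullet> j)) else 0)"
    using c by (intro sum.cong) (auto simp: inner_Basis)
  also have "\<dots> = deriv (g c) (z \<bullet> c) * (\<Prod>j\<in>Basis - {c}. g j (z \<bullet> j))"
    using c by simp
  also have "\<dots> = tensor (g(c := deriv (g c))) z"
    unfolding tensor_def by (subst prod.remove[OF _ c]) auto
  finally show "partial_deriv c (tensor g) z = tensor (g(c := deriv (g c))) z" .
qed

lemma tensor_Ck:
  assumes "\<And>b. b \<in> Basis \<Longrightarrow> smooth1 (g b)"
  shows "Ck k (tensor g)"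
  using assms
proof (induction k arbitrary: g)
  case 0
  have "continuous_on UNIV (tensor g)"
    unfolding continuous_on_eq_continuous_at[OF open_UNIV]
    using has_derivative_continuous[OF tensor_has_derivative[of g]] 0 by simp
  then show ?case by simp
next
  case (Suc k)
  have "tensor g differentiable at z" for z
    using tensor_has_derivative[of g z] Suc.prems unfolding differentiable_def by auto
  then have "tensor g differentiable_on UNIV"
    by (simp add: differentiable_on_def)
  moreover have "Ck k (partial_deriv c (tensor g))" if "c \<in> Basis" for c
  proof -
    have "partial_deriv c (tensor g) = tensor (g(c := deriv (g c)))"
      by (rule tensor_partial_deriv) (use Suc.prems that in auto)
    moreover have "Ck k (tensor (g(c := deriv (g c))))"
      by (rule Suc.IH) (use Suc.prems that smooth1_deriv(2) in auto)
    ultimately show ?thesis by simp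
  qed
  ultimately show ?case by simp
qed

section \<open>Mollification and the weak heat equation\<close>

text \<open>The factors vanish on the open set \<open>r < \<bar>s\<bar>\<close>, so the condition
  passes to their derivatives.\<close>

definition kernel :: "real \<Rightarrow> ('a::euclidean_space \<Rightarrow> real \<Rightarrow> real) \<Rightarrow> bool" where
  "kernel r g \<longleftrightarrow> (\<forall>b\<in>Basis. smooth1 (g b) \<and> (\<forall>s. r < \<bar>s\<bar> \<longrightarrow> g b s = 0))"

definition mol :: "('a::euclidean_space \<Rightarrow> real \<Rightarrow> real) \<Rightarrow> ('a \<Rightarrow> real) \<Rightarrow> 'a \<Rightarrow> real" where
  "mol g q z = (LINT y|lborel. q y * tensor g (z - y))"

abbreviation kbox :: "real \<Rightarrow> 'a::euclidean_space \<Rightarrow> 'a set" where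
  "kbox r z \<equiv> cbox (z - r *\<^sub>R One) (z + r *\<^sub>R One)"

lemma mem_kbox: "y \<in> kbox r z \<longleftrightarrow> (\<forall>b\<in>Basis. \<bar>(z - y) \<bullet> b\<bar> \<le> r)"
  by (auto simp: mem_box inner_simps abs_le_iff algebra_simps)

lemma smooth1_deriv_eq_0:
  assumes "smooth1 g" "\<And>s. r < \<bar>s\<bar> \<Longrightarrow> g s = 0" "r < \<bar>s\<bar>"
  shows "deriv g s = 0"
proof -
  have "open {s::real. r < \<bar>s\<bar>}" by (intro open_Collect_less continuous_intros)
  then have "(g has_real_derivative 0) (at s)"
    by (rule has_field_derivative_transform_within_open[OF DERIV_const[of 0]]) (use assms in auto)
  then show ?thesis by (rule DERIV_imp_deriv)
qed

lemma kernel_deriv: "kernel r g \<Longrightarrow> kernel r (g(c := deriv (g c)))"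
  by (auto simp: kernel_def smooth1_deriv(2) intro: smooth1_deriv_eq_0)

lemma kernel_bump:
  assumes "r > 0"
  shows "kernel r (\<lambda>b s. bump (s / r))"
  using smooth1_affine[OF bump_smooth1, of 1 "1/r" 0] assms
  by (auto simp: kernel_def intro!: bump_eq_0)

lemma tensor_continuous: "kernel r g \<Longrightarrow> continuous_on A (tensor g)"
  using tensor_Ck[of g 0] by (auto simp: kernel_def intro: continuous_on_subset)

lemma tensor_eq_0:
  assumes "kernel r g" "y \<notin> kbox r z"
  shows "tensor g (z - y) = 0"
proof -
  from assms(2) obtain b where b: "b \<in> Basis" "r < \<bar>(z - y) \<bullet> b\<bar>"
    unfolding mem_kbox by (auto simp: not_le)
  then have "g b ((z - y) \<bullet> b) = 0" using assms(1) by (simp add: kernel_def)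
  then show ?thesis unfolding tensor_def using b(1) by (intro prod_zero) auto
qed

lemma tensor_DERIV:
  assumes "kernel r g" "c \<in> Basis"
  shows "((\<lambda>s. tensor g (z + s *\<^sub>R c)) has_real_derivative
    tensor (g(c := deriv (g c))) (z + s *\<^sub>R c)) (at s)"
proof -
  have g: "\<And>b. b \<in> Basis \<Longrightarrow> smooth1 (g b)" using assms by (auto simp: kernel_def)
  have fd: "(tensor g has_derivative frechet_derivative (tensor g) (at w)) (at w)" for w
    using differentiableI[OF tensor_has_derivative[of g w]] g frechet_derivative_works by blast
  have "((\<lambda>s. z + s *\<^sub>R c) has_derivative (\<lambda>h. h *\<^sub>R c)) (at s)"
    by (auto intro!: derivative_eq_intros)
  from has_derivative_compose[OF this fd]
  have "((\<lambda>s. tensor g (z + s *\<^sub>R c)) has_derivative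
      (\<lambda>h. frechet_derivative (tensor g) (at (z + s *\<^sub>R c)) (h *\<^sub>R c))) (at s)" .
  moreover have "frechet_derivative (tensor g) (at w) (h *\<^sub>R c) = tensor (g(c := deriv (g c))) w * h" for w h
    using tensor_partial_deriv[of g c] g assms(2)
    by (simp add: linear_cmul[OF has_derivative_linear[OF fd]] partial_deriv_def fun_eq_iff)
  ultimately show ?thesis
    by (simp add: has_field_derivative_def mult.commute[of _ "tensor (g(c := deriv (g c))) _"])
qed

text \<open>The box may be larger than the support of the kernel, so that one box serves all
  \<open>z\<close> in a neighbourhood, as theorems on parameter integrals require.\<close>

lemma mol_integrand_cbox:
  assumes q: "continuous_on UNIV q" and g: "kernel r g" and sub: "kbox r z \<subseteq> cbox a b"
  shows "integrable lborel (\<lambda>y. q y * tensor g (z - y))"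
    and "mol g q z = integral (cbox a b) (\<lambda>y. q y * tensor g (z - y))"
    and "(\<lambda>y. q y * tensor g (z - y)) integrable_on cbox a b"
proof -
  have c: "continuous_on (cbox a b) (\<lambda>y. q y * tensor g (z - y))"
    by (intro continuous_intros continuous_on_compose2[OF tensor_continuous[OF g, of UNIV]]
        continuous_on_subset[OF q]) auto
  have e: "(\<lambda>y. indicator (cbox a b) y *\<^sub>R (q y * tensor g (z - y))) = (\<lambda>y. q y * tensor g (z - y))"
    using sub tensor_eq_0[OF g] by (force simp: indicator_def)
  have i: "integrable lborel (\<lambda>y. indicator (cbox a b) y *\<^sub>R (q y * tensor g (z - y)))"
    by (rule borel_integrable_compact[OF compact_cbox c])
  then show "integrable lborel (\<lambda>y. q y * tensor g (z - y))" by (simp only: e)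
  have s: "set_integrable lborel (cbox a b) (\<lambda>y. q y * tensor g (z - y))"
    using i by (simp add: set_integrable_def)
  show "(\<lambda>y. q y * tensor g (z - y)) integrable_on cbox a b"
    by (rule set_borel_integral_eq_integral(1)[OF s])
  show "mol g q z = integral (cbox a b) (\<lambda>y. q y * tensor g (z - y))"
    using set_borel_integral_eq_integral(2)[OF s] by (simp add: mol_def set_lebesgue_integral_def e[simplified])
qed

lemmas mol_integrable = mol_integrand_cbox(1)[OF _ _ order_refl]

lemma mol_DERIV:
  assumes q: "continuous_on UNIV q" and g: "kernel r g" and c: "c \<in> Basis"
  shows "((\<lambda>s. mol g q (z + s *\<^sub>R c)) has_real_derivative
    mol (g(c := deriv (g c))) q (z + s *\<^sub>R c)) (at s)"
proof -
  let ?g' = "g(c := deriv (g c))"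
  let ?U = "{s - 1 .. s + 1}"
  \<comment> \<open>One extra unit on each side makes this box valid for all shifts within distance
    1 of \<open>s\<close>.\<close>
  let ?a = "z + s *\<^sub>R c - (\<bar>r\<bar> + 1) *\<^sub>R One" and ?b = "z + s *\<^sub>R c + (\<bar>r\<bar> + 1) *\<^sub>R One"
  have sub: "kbox r (z + s' *\<^sub>R c) \<subseteq> cbox ?a ?b" if s': "s' \<in> ?U" for s'
  proof
    fix y assume y: "y \<in> kbox r (z + s' *\<^sub>R c)"
    have "\<bar>(z + s *\<^sub>R c - y) \<bullet> b\<bar> \<le> \<bar>r\<bar> + 1" if b: "b \<in> Basis" for b
    proof -
      have "\<bar>(z + s' *\<^sub>R c - y) \<bullet> b\<bar> \<le> r" using y b unfolding mem_kbox by blast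
      moreover have "(z + s *\<^sub>R c - y) \<bullet> b = (z + s' *\<^sub>R c - y) \<bullet> b + (s - s') * (c \<bullet> b)"
        by (simp add: inner_simps algebra_simps)
      moreover have "\<bar>(s - s') * (c \<bullet> b)\<bar> \<le> 1 * 1"
        unfolding abs_mult using s' c b by (intro mult_mono) (auto simp: inner_Basis)
      ultimately show ?thesis by linarith
    qed
    then have "y \<in> kbox (\<bar>r\<bar> + 1) (z + s *\<^sub>R c)" unfolding mem_kbox by blast
    then show "y \<in> cbox ?a ?b" .
  qed
  have eq: "(z + x *\<^sub>R c - t) = (z - t + x *\<^sub>R c)" for x t by simp
  have "((\<lambda>x. integral (cbox ?a ?b) (\<lambda>t. q t * tensor g (z + x *\<^sub>R c - t))) has_real_derivative
      integral (cbox ?a ?b) (\<lambda>t. q t * tensor ?g' (z + s *\<^sub>R c - t))) (at s within ?U)"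
  proof (rule leibniz_rule_field_derivative[where U="?U"])
    fix x t
    have "((\<lambda>x. tensor g (z - t + x *\<^sub>R c)) has_real_derivative tensor ?g' (z - t + x *\<^sub>R c)) (at x within ?U)"
      by (rule has_field_derivative_at_within[OF tensor_DERIV[OF g c]])
    then show "((\<lambda>x. q t * tensor g (z + x *\<^sub>R c - t)) has_real_derivative
        q t * tensor ?g' (z + x *\<^sub>R c - t)) (at x within ?U)"
      unfolding eq by (rule DERIV_cmult)
  next
    fix x assume "x \<in> ?U"
    then show "(\<lambda>t. q t * tensor g (z + x *\<^sub>R c - t)) integrable_on cbox ?a ?b"
      by (rule mol_integrand_cbox(3)[OF q g sub])
  next
    show "continuous_on (?U \<times> cbox ?a ?b) (\<lambda>(x, t). q t * tensor ?g' (z + x *\<^sub>R c - t))"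
      unfolding split_beta
      by (intro continuous_intros continuous_on_compose2[OF tensor_continuous[OF kernel_deriv[OF g], of UNIV]]
          continuous_on_compose2[OF q]) auto
  qed auto
  then have "((\<lambda>x. integral (cbox ?a ?b) (\<lambda>t. q t * tensor g (z + x *\<^sub>R c - t))) has_real_derivative
      integral (cbox ?a ?b) (\<lambda>t. q t * tensor ?g' (z + s *\<^sub>R c - t))) (at s)"
    by (subst (asm) at_within_interior) auto
  also have "integral (cbox ?a ?b) (\<lambda>t. q t * tensor ?g' (z + s *\<^sub>R c - t)) = mol ?g' q (z + s *\<^sub>R c)"
    by (rule mol_integrand_cbox(2)[OF q kernel_deriv[OF g] sub, symmetric]) auto
  finally show ?thesis
    by (rule has_field_derivative_transform_within_open[of _ _ _ "{s - 1<..<s + 1}"])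
       (use mol_integrand_cbox(2)[OF q g sub] in auto)
qed

text \<open>The weak form of \<open>\<partial>\<^sub>t q - \<Delta> q = h\<close> on positive times, tested only against reflected tensor product
  kernels; in terms of \<open>z\<close> it is the pointwise equation for the mollified functions.\<close>

definition weak_heat :: "((real^'n) \<times> real \<Rightarrow> real) \<Rightarrow> ((real^'n) \<times> real \<Rightarrow> real) \<Rightarrow> bool" where
  "weak_heat q h \<longleftrightarrow> (\<forall>g r z. kernel r g \<longrightarrow> r < snd z \<longrightarrow>
     integrable lebesgue (\<lambda>y. h y * tensor g (z - y)) \<and>
     (LINT y|lebesgue. h y * tensor g (z - y)) =
       mol (g((0, 1) := deriv (g (0, 1)))) q z
       - (\<Sum>i\<in>UNIV. mol (g((axis i 1, 0) := deriv (deriv (g (axis i 1, 0))))) q z))"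

lemma weak_heat_uminus: "weak_heat q h \<Longrightarrow> weak_heat (\<lambda>z. - q z) (\<lambda>z. - h z)"
  unfolding weak_heat_def mol_def by (simp add: sum_negf)

lemma reflected_kernel:
  fixes z :: "'a::euclidean_space"
  assumes g: "kernel r g"
  defines "\<gamma> \<equiv> \<lambda>b s. g b (z \<bullet> b - s)"
  shows "\<And>b. b \<in> Basis \<Longrightarrow> smooth1 (\<gamma> b)" "tensor \<gamma> y = tensor g (z - y)"
    and "b \<in> Basis \<Longrightarrow> deriv (\<gamma> b) s = - deriv (g b) (z \<bullet> b - s)"
proof -
  show 1: "smooth1 (\<gamma> b)" if "b \<in> Basis" for b
    using smooth1_affine[of "g b" 1 "-1" "z \<bullet> b"] g that by (simp add: \<gamma>_def kernel_def)
  show "tensor \<gamma> y = tensor g (z - y)" by (simp add: \<gamma>_def tensor_def inner_diff_left)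
  show "deriv (\<gamma> b) s = - deriv (g b) (z \<bullet> b - s)" if "b \<in> Basis"
  proof (rule DERIV_imp_deriv)
    have "smooth1 (g b)" using g that by (simp add: kernel_def)
    then have "((\<lambda>s. g b (z \<bullet> b - s)) has_real_derivative deriv (g b) (z \<bullet> b - s) * (-1)) (at s)"
      by (intro DERIV_chain2[OF smooth1_deriv(1)]) (auto intro!: derivative_eq_intros)
    then show "(\<gamma> b has_real_derivative - deriv (g b) (z \<bullet> b - s)) (at s)" by (simp add: \<gamma>_def)
  qed
qed

text \<open>The sign stems from the reflection of \<open>y\<close> to \<open>z - y\<close>. It
  cancels the sign in the definition of weak derivatives, so each derivative moves onto the kernel
  without a sign.\<close>

lemma reflected_test_function:
  assumes g: "kernel r g" and sub: "kbox r z \<subseteq> Q"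
  shows "test_function Q (\<lambda>y. tensor g (z - y))"
    and "c \<in> Basis \<Longrightarrow> partial_deriv c (\<lambda>y. tensor g (z - y)) y = - tensor (g(c := deriv (g c))) (z - y)"
proof -
  let ?\<gamma> = "\<lambda>b s. g b (z \<bullet> b - s)"
  have eq: "(\<lambda>y. tensor g (z - y)) = tensor ?\<gamma>"
    using reflected_kernel(2)[OF g] by (auto simp: fun_eq_iff)
  have "closure {y. tensor g (z - y) \<noteq> 0} \<subseteq> kbox r z"
    using tensor_eq_0[OF g] by (intro closure_minimal) auto
  moreover from this have "compact (closure {y. tensor g (z - y) \<noteq> 0})"
    by (meson bounded_cbox bounded_subset closure_subset compact_closure order_trans)
  moreover have "Ck k (\<lambda>y. tensor g (z - y))" for k
    unfolding eq by (rule tensor_Ck) (rule reflected_kernel(1)[OF g])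
  ultimately show "test_function Q (\<lambda>y. tensor g (z - y))"
    using sub unfolding test_function_def by blast
  show "partial_deriv c (\<lambda>y. tensor g (z - y)) y = - tensor (g(c := deriv (g c))) (z - y)" if c: "c \<in> Basis"
  proof -
    have "partial_deriv c (tensor ?\<gamma>) y = tensor (?\<gamma>(c := deriv (?\<gamma> c))) y"
      using tensor_partial_deriv[of ?\<gamma> c] reflected_kernel(1)[OF g] c by simp
    also have "\<dots> = - tensor (g(c := deriv (g c))) (z - y)"
      unfolding tensor_def prod.remove[OF finite_Basis c]
      by (simp add: reflected_kernel(3)[OF g c] inner_diff_left)
    finally show ?thesis unfolding eq .
  qed
qed

lemma Lp_loc_test_integrable:
  assumes v: "Lp_loc 1 Q v" and g: "kernel r g" and sub: "kbox r z \<subseteq> Q"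
  shows "integrable lebesgue (\<lambda>y. v y * tensor g (z - y))"
    and "(LINT y:Q|lebesgue. v y * tensor g (z - y)) = (LINT y|lebesgue. v y * tensor g (z - y))"
proof -
  let ?K = "kbox r z"
  have K: "set_borel_measurable lebesgue ?K v" "set_integrable lebesgue ?K (\<lambda>y. \<bar>v y\<bar> powr 1)"
    using v sub by (auto simp: Lp_loc_def Lp_on_def)
  have int: "integrable lebesgue (\<lambda>y. indicator ?K y * v y)"
  proof (rule Bochner_Integration.integrable_bound[OF K(2)[unfolded set_integrable_def]])
    show "(\<lambda>y. indicator ?K y * v y) \<in> borel_measurable lebesgue"
      using K(1) by (simp add: set_borel_measurable_def)
    show "AE y in lebesgue. norm (indicator ?K y * v y) \<le> norm (indicator ?K y *\<^sub>R \<bar>v y\<bar> powr 1)"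
      by (intro AE_I2) (simp add: abs_mult)
  qed
  have c: "continuous_on UNIV (\<lambda>y. tensor g (z - y))"
    by (intro continuous_on_compose2[OF tensor_continuous[OF g, of UNIV]] continuous_intros) auto
  then have "compact ((\<lambda>y. tensor g (z - y)) ` ?K)"
    by (intro compact_continuous_image compact_cbox) (rule continuous_on_subset, auto)
  then obtain M where M: "\<And>y. y \<in> ?K \<Longrightarrow> \<bar>tensor g (z - y)\<bar> \<le> M"
    by (meson bounded_real compact_imp_bounded image_eqI)
  have m: "(\<lambda>y. tensor g (z - y)) \<in> borel_measurable lebesgue"
    by (rule measurable_completion) (simp add: borel_measurable_continuous_onI[OF c])
  have eq: "indicator ?K y * v y * tensor g (z - y) = v y * tensor g (z - y)" for y
    by (cases "y \<in> ?K") (simp_all add: tensor_eq_0[OF g])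
  have "integrable lebesgue (\<lambda>y. indicator ?K y * v y * tensor g (z - y))"
  proof (rule Bochner_Integration.integrable_bound[OF integrable_mult_right[OF int, of M]])
    show "(\<lambda>y. indicator ?K y * v y * tensor g (z - y)) \<in> borel_measurable lebesgue"
      using borel_measurable_times[OF borel_measurable_integrable[OF int] m] by simp
    show "AE y in lebesgue. norm (indicator ?K y * v y * tensor g (z - y)) \<le> norm (M * (indicator ?K y * v y))"
    proof (rule AE_I2)
      fix y
      show "norm (indicator ?K y * v y * tensor g (z - y)) \<le> norm (M * (indicator ?K y * v y))"
      proof (cases "y \<in> ?K")
        case True
        then have "\<bar>v y\<bar> * \<bar>tensor g (z - y)\<bar> \<le> \<bar>v y\<bar> * \<bar>M\<bar>"
          by (intro mult_left_mono order_trans[OF M abs_ge_self]) auto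
        then show ?thesis using True by (simp add: abs_mult mult.commute)
      qed simp
    qed
  qed
  then show "integrable lebesgue (\<lambda>y. v y * tensor g (z - y))" by (simp add: eq)
  have "indicator Q y *\<^sub>R (v y * tensor g (z - y)) = v y * tensor g (z - y)" for y
  proof (cases "y \<in> ?K")
    case True then show ?thesis using sub by auto
  qed (simp add: tensor_eq_0[OF g])
  then show "(LINT y:Q|lebesgue. v y * tensor g (z - y)) = (LINT y|lebesgue. v y * tensor g (z - y))"
    unfolding set_lebesgue_integral_def by (simp only:)
qed

text \<open>Reflected kernels are admissible test functions once their support lies at positive
  times; the definition of weak derivative is then used once in \<open>t\<close> and twice for each
  pure second space derivative.\<close>

lemma W21_weak_heat:
  fixes q u :: "(real^'n) \<times> real \<Rightarrow> real"
  assumes W: "W21_loc_derivs p (UNIV \<times> {0<..}) u Dx Dxx Dt"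
    and q: "continuous_on UNIV q" and qu: "\<And>x t. t > 0 \<Longrightarrow> q (x, t) = u (x, t)"
  shows "weak_heat q (\<lambda>z. Dt z - (\<Sum>i\<in>UNIV. Dxx i i z))"
  unfolding weak_heat_def
proof (intro allI impI)
  fix g :: "(real^'n) \<times> real \<Rightarrow> real \<Rightarrow> real" and r and z :: "(real^'n) \<times> real"
  assume g: "kernel r g" and r: "r < snd z"
  let ?Q = "UNIV \<times> {0<..} :: ((real^'n) \<times> real) set"
  let ?t = "(0, 1) :: (real^'n) \<times> real" and ?e = "\<lambda>i. (axis i 1, 0) :: (real^'n) \<times> real"
  have B: "?t \<in> Basis" "?e i \<in> Basis" for i by (auto simp: Basis_prod_def)
  \<comment> \<open>The condition \<open>r < snd z\<close> keeps the support at positive times,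
    where \<open>q\<close> and \<open>u\<close> agree.\<close>
  have sub: "kbox r z \<subseteq> ?Q"
  proof
    fix y assume "y \<in> kbox r z"
    then have "\<bar>(z - y) \<bullet> ?t\<bar> \<le> r" using B unfolding mem_kbox by blast
    then show "y \<in> ?Q" using r by (cases y; cases z) auto
  qed
  have wt: "weak_deriv ?Q ?t u Dt" and wx: "weak_deriv ?Q (?e i) u (Dx i)"
    and wxx: "weak_deriv ?Q (?e i) (Dx i) (Dxx i i)" for i
    using W by (auto simp: W21_loc_derivs_def)
  have LDt: "Lp_loc 1 ?Q Dt" and LDx: "Lp_loc 1 ?Q (Dx i)" and LDxx: "Lp_loc 1 ?Q (Dxx i i)" for i
    using wt wx wxx by (auto simp: weak_deriv_def)
  have weak: "(LINT y:?Q|lebesgue. v y * tensor (k(c := deriv (k c))) (z - y)) = (LINT y:?Q|lebesgue. w y * tensor k (z - y))"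
    if "weak_deriv ?Q c v w" "kernel r k" "c \<in> Basis" for c v w k
  proof -
    have "(LINT y:?Q|lebesgue. v y * partial_deriv c (\<lambda>y. tensor k (z - y)) y) = - (LINT y:?Q|lebesgue. w y * tensor k (z - y))"
      using that reflected_test_function(1)[OF that(2) sub] unfolding weak_deriv_def by blast
    then show ?thesis
      unfolding reflected_test_function(2)[OF that(2) sub that(3)]
      by (simp add: set_lebesgue_integral_def)
  qed
  have um: "(LINT y:?Q|lebesgue. u y * tensor k (z - y)) = mol k q z" if k: "kernel r k" for k
  proof -
    have "indicator ?Q y *\<^sub>R (u y * tensor k (z - y)) = q y * tensor k (z - y)" for y
    proof (cases "y \<in> ?Q")
      case True then show ?thesis using qu[of "snd y" "fst y"] by (auto simp: indicator_def)
    next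
      case False
      then have "tensor k (z - y) = 0" using tensor_eq_0[OF k] sub by blast
      then show ?thesis by simp
    qed
    then show ?thesis unfolding set_lebesgue_integral_def mol_def
      by (simp only: integral_completion[OF borel_measurable_integrable[OF mol_integrable[OF q k]]])
  qed
  have t: "(LINT y|lebesgue. Dt y * tensor g (z - y)) = mol (g(?t := deriv (g ?t))) q z"
    using weak[OF wt g B(1)] um[OF kernel_deriv[OF g]] Lp_loc_test_integrable(2)[OF LDt g sub] by simp
  have x: "(LINT y|lebesgue. Dxx i i y * tensor g (z - y)) = mol (g(?e i := deriv (deriv (g (?e i))))) q z" for i
  proof -
    let ?g' = "g(?e i := deriv (g (?e i)))"
    have k': "kernel r ?g'" by (rule kernel_deriv[OF g])
    have "(LINT y:?Q|lebesgue. Dx i y * tensor ?g' (z - y)) = (LINT y:?Q|lebesgue. Dxx i i y * tensor g (z - y))"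
      by (rule weak[OF wxx g B(2)])
    moreover have "(LINT y:?Q|lebesgue. u y * tensor (?g'(?e i := deriv (?g' (?e i)))) (z - y))
        = (LINT y:?Q|lebesgue. Dx i y * tensor ?g' (z - y))"
      by (rule weak[OF wx k' B(2)])
    ultimately show ?thesis
      using um[OF kernel_deriv[OF k', of "?e i"]] Lp_loc_test_integrable(2)[OF LDxx g sub] by simp
  qed
  have it: "integrable lebesgue (\<lambda>y. Dt y * tensor g (z - y))"
    and ix: "integrable lebesgue (\<lambda>y. Dxx i i y * tensor g (z - y))" for i
    using Lp_loc_test_integrable(1)[OF _ g sub] LDt LDxx by auto
  have "integrable lebesgue (\<lambda>y. (Dt y - (\<Sum>i\<in>UNIV. Dxx i i y)) * tensor g (z - y))"
    unfolding left_diff_distrib sum_distrib_right using it ix by auto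
  moreover have "(LINT y|lebesgue. (Dt y - (\<Sum>i\<in>UNIV. Dxx i i y)) * tensor g (z - y)) =
      mol (g(?t := deriv (g ?t))) q z - (\<Sum>i\<in>UNIV. mol (g(?e i := deriv (deriv (g (?e i))))) q z)"
    unfolding left_diff_distrib sum_distrib_right
    using it ix by (simp add: t x)
  ultimately show "integrable lebesgue (\<lambda>y. (Dt y - (\<Sum>i\<in>UNIV. Dxx i i y)) * tensor g (z - y)) \<and>
     (LINT y|lebesgue. (Dt y - (\<Sum>i\<in>UNIV. Dxx i i y)) * tensor g (z - y)) =
      mol (g(?t := deriv (g ?t))) q z - (\<Sum>i\<in>UNIV. mol (g(?e i := deriv (deriv (g (?e i))))) q z)" by blast
qed

section \<open>Mollified primitives\<close>

lemma bounded_set_integrable: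
  fixes a :: "'a::euclidean_space \<Rightarrow> real"
  assumes [measurable]: "a \<in> borel_measurable borel" and "\<And>s. \<bar>a s\<bar> \<le> L"
    and S: "S \<in> sets borel" "emeasure lborel S < \<infinity>"
  shows "set_integrable lborel S a"
proof -
  have "set_integrable lborel S (\<lambda>_. L)"
    using S by (simp add: set_integrable_def)
  then show ?thesis
    by (rule set_integrable_bound)
      (use S(1) in \<open>auto simp: set_borel_measurable_def intro!: AE_I2 order_trans[OF assms(2) abs_ge_self]\<close>)
qed

definition prim :: "(real \<Rightarrow> real) \<Rightarrow> real \<Rightarrow> real" where
  "prim a t = (LINT s:{0..t}|lborel. a s)"

lemma prim_diff:
  assumes a: "a \<in> borel_measurable borel" "\<And>s. \<bar>a s\<bar> \<le> L" and st: "0 \<le> s" "s \<le> t"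
  shows "prim a t - prim a s = (LINT y:{s<..t}|lborel. a y)"
proof -
  have "{0..t} = {0..s} \<union> {s<..t}" using st by auto
  then have "prim a t = prim a s + (LINT y:{s<..t}|lborel. a y)"
    unfolding prim_def using st
    by (simp only:) (rule set_integral_Un, auto intro!: bounded_set_integrable[OF a])
  then show ?thesis by simp
qed

lemma prim_0: "prim a 0 = 0"
  unfolding prim_def set_lebesgue_integral_def
  by (rule integral_eq_zero_AE) (use AE_lborel_singleton[of "0::real"] in eventually_elim, simp)

lemma prim_lipschitz:
  assumes a: "a \<in> borel_measurable borel" "\<And>s. \<bar>a s\<bar> \<le> L"
  shows "\<bar>prim a t - prim a s\<bar> \<le> L * \<bar>t - s\<bar>"
proof -
  have L: "0 \<le> L" using a(2)[of 0] by simp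
  have *: "\<bar>prim a t - prim a s\<bar> \<le> L * (t - s)" if st: "0 \<le> s" "s \<le> t" for s t
  proof -
    have i: "set_integrable lborel {s<..t} a" "set_integrable lborel {s<..t} (\<lambda>_. L)"
      using st by (auto intro!: bounded_set_integrable[OF a] bounded_set_integrable[of "\<lambda>_. L" "\<bar>L\<bar>"])
    have "\<bar>LINT y:{s<..t}|lborel. a y\<bar> \<le> (LINT y:{s<..t}|lborel. \<bar>a y\<bar>)"
      using set_integral_norm_bound[OF i(1)] by simp
    also have "\<dots> \<le> (LINT y:{s<..t}|lborel. L)"
      by (rule set_integral_mono) (use i a in \<open>auto intro: set_integrable_abs\<close>)
    also have "\<dots> = L * (t - s)" using st by (simp add: set_lebesgue_integral_def)
    finally show ?thesis using prim_diff[OF a st] by simp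
  qed
  have nn: "\<bar>prim a t - prim a s\<bar> \<le> L * \<bar>t - s\<bar>" if "0 \<le> s" "0 \<le> t" for s t
  proof (cases "s \<le> t")
    case True
    then show ?thesis using *[of s t] that by simp
  next
    case False
    then show ?thesis using *[of t s] that by (simp add: abs_minus_commute)
  qed
  have neg: "prim a s = prim a 0" if "s \<le> 0" for s
  proof (cases "s = 0")
    case False
    then have "prim a s = 0" using that by (simp add: prim_def set_lebesgue_integral_def)
    then show ?thesis by (simp add: prim_0)
  qed simp
  \<comment> \<open>For negative times the interval of integration is empty, so
    \<open>prim a\<close> is 0 there and a time may be replaced by its positive part, which is a
    1-Lipschitz operation.\<close>
  have max: "prim a s = prim a (max s 0)" for s using neg[of s] by (auto simp: max_def)
  have "\<bar>prim a t - prim a s\<bar> \<le> L * \<bar>max t 0 - max s 0\<bar>"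
    unfolding max[of t] max[of s]
    by (rule nn) auto
  also have "\<dots> \<le> L * \<bar>t - s\<bar>" using L by (intro mult_left_mono) auto
  finally show ?thesis .
qed

lemma prim_continuous:
  assumes a: "a \<in> borel_measurable borel" "\<And>s. \<bar>a s\<bar> \<le> L"
  shows "continuous_on A (prim a)"
proof -
  have "L-lipschitz_on A (prim a)"
    using prim_lipschitz[OF a] a(2)[of 0] by (auto simp: lipschitz_on_def dist_real_def)
  then show ?thesis by (rule lipschitz_on_continuous_on)
qed

lemma bounded_compact_integrable:
  fixes F :: "'a::euclidean_space \<Rightarrow> real"
  assumes m: "F \<in> borel_measurable borel" and F: "\<And>y. \<bar>F y\<bar> \<le> K" "\<And>y. y \<notin> cbox a b \<Longrightarrow> F y = 0"
  shows "integrable lborel F"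
proof -
  have "integrable lborel (\<lambda>y. indicator (cbox a b) y *\<^sub>R F y)"
    unfolding set_integrable_def[symmetric]
    by (rule bounded_set_integrable[OF m F(1)]) (simp, rule emeasure_lborel_cbox_finite)
  moreover have "indicator (cbox a b) y *\<^sub>R F y = F y" for y
    using F(2) by (auto simp: indicator_def)
  ultimately show ?thesis by (simp only:)
qed

lemma tensor_bounded:
  assumes "kernel r g"
  obtains K where "\<And>y. \<bar>tensor g y\<bar> \<le> K"
proof -
  have "compact (tensor g ` kbox r 0)"
    by (intro compact_continuous_image compact_cbox tensor_continuous[OF assms])
  then obtain K where K: "\<And>y. y \<in> kbox r 0 \<Longrightarrow> \<bar>tensor g y\<bar> \<le> K"
    by (meson bounded_real compact_imp_bounded image_eqI)
  have "\<bar>tensor g y\<bar> \<le> max K 0" for y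
  proof (cases "y \<in> kbox r 0")
    case False
    then have "- y \<notin> kbox r 0" unfolding mem_kbox by simp
    then show ?thesis using tensor_eq_0[OF assms, of "- y" 0] by simp
  qed (use K in force)
  then show ?thesis using that by blast
qed

lemma bounded_times_tensor_integrable:
  fixes a :: "'a::euclidean_space \<Rightarrow> real"
  assumes a: "a \<in> borel_measurable borel" "\<And>s. \<bar>a s\<bar> \<le> L" and g: "kernel r g"
  shows "integrable lborel (\<lambda>y. a y * tensor g (z - y))"
proof -
  obtain K where K: "\<And>y. \<bar>tensor g y\<bar> \<le> K" using tensor_bounded[OF g] by blast
  have "continuous_on UNIV (\<lambda>y. tensor g (z - y))"
    by (intro continuous_on_compose2[OF tensor_continuous[OF g, of UNIV]] continuous_intros) auto
  then have "(\<lambda>y. a y * tensor g (z - y)) \<in> borel_measurable borel"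
    by (intro borel_measurable_times a borel_measurable_continuous_onI)
  moreover have "\<bar>a y * tensor g (z - y)\<bar> \<le> L * K" for y
    unfolding abs_mult using a(2)[of y] K by (intro mult_mono) auto
  ultimately show ?thesis
    by (rule bounded_compact_integrable[where a = "z - r *\<^sub>R One" and b = "z + r *\<^sub>R One"])
       (simp add: tensor_eq_0[OF g])
qed

lemma real_tensor: "tensor g (x::real) = g 1 x"
  by (simp add: tensor_def)

text \<open>Integration by parts without regularity of \<open>a\<close>: Fubini on the region
  \<open>0 \<le> y \<le> s\<close> leaves the integral of \<open>deriv \<kappa> (t - s)\<close> over
  \<open>s \<ge> y\<close>, which is \<open>\<kappa> (t - y)\<close>. For \<open>y < 0\<close> both
  integrands vanish because \<open>r < t\<close>.\<close>

lemma mol_deriv_prim: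
  fixes \<kappa> :: "real \<Rightarrow> real"
  assumes a: "a \<in> borel_measurable borel" "\<And>s. \<bar>a s\<bar> \<le> L"
    and \<kappa>: "smooth1 \<kappa>" "\<And>s. r < \<bar>s\<bar> \<Longrightarrow> \<kappa> s = 0" and r: "0 < r" "r < t"
  shows "(LINT s|lborel. prim a s * deriv \<kappa> (t - s)) = (LINT y|lborel. a y * \<kappa> (t - y))"
proof -
  note [measurable] = a(1)
  have L: "0 \<le> L" using a(2)[of 0] by simp
  define F where "F s y = indicator {0..s} y * a y * deriv \<kappa> (t - s)" for s y
  have k': "kernel r (\<lambda>b::real. deriv \<kappa>)"
    using \<kappa> by (auto simp: kernel_def smooth1_deriv(2) intro!: smooth1_deriv_eq_0)
  have dz: "deriv \<kappa> s = 0" if "r < \<bar>s\<bar>" for s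
    using smooth1_deriv_eq_0[of \<kappa> r s] \<kappa> that by blast
  obtain K where K: "\<And>s. \<bar>deriv \<kappa> s\<bar> \<le> K"
    using tensor_bounded[OF k'] by (auto simp: real_tensor)
  have [measurable]: "deriv \<kappa> \<in> borel_measurable borel"
    using smooth1_continuous[OF smooth1_deriv(2)[OF \<kappa>(1)]] by (rule borel_measurable_continuous_onI)
  have "integrable lborel (case_prod F)"
  proof (rule bounded_compact_integrable)
    have "case_prod F = (\<lambda>p. (if 0 \<le> snd p \<and> snd p \<le> fst p then 1 else 0) * a (snd p) * deriv \<kappa> (t - fst p))"
      by (auto simp: F_def indicator_def fun_eq_iff)
    also have "\<dots> \<in> borel_measurable (borel \<Otimes>\<^sub>M borel)" by measurable
    finally show "case_prod F \<in> borel_measurable borel" by (simp add: borel_prod)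
    show "\<bar>case_prod F p\<bar> \<le> 1 * L * K" for p
      unfolding F_def split_beta abs_mult using L K a(2) 
      by (intro mult_mono) (auto simp: indicator_def)
    fix p assume p: "p \<notin> cbox (t - r, 0) (t + r, t + r)"
    show "case_prod F p = 0"
    proof (rule ccontr)
      assume "case_prod F p \<noteq> 0"
      then have d: "deriv \<kappa> (t - fst p) \<noteq> 0" and "snd p \<in> {0..fst p}"
        unfolding F_def split_beta by (cases "snd p \<in> {0..fst p}"; simp)+
      moreover have "\<bar>t - fst p\<bar> \<le> r"
        by (rule ccontr) (use d dz[of "t - fst p"] in simp)
      ultimately show False using p by (cases p) auto
    qed
  qed
  then have int: "integrable (lborel \<Otimes>\<^sub>M lborel) (case_prod F)" by (simp add: lborel_prod)
  have 1: "(LINT y|lborel. F s y) = prim a s * deriv \<kappa> (t - s)" for s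
    by (simp add: F_def prim_def set_lebesgue_integral_def)
  have 2: "(LINT s|lborel. F s y) = a y * \<kappa> (t - y)" for y
  proof (cases "0 \<le> y \<and> y \<le> t + r")
    case True
    have "F s y = a y * (deriv \<kappa> (t - s) * indicator {y..t + r} s)" for s
    proof (cases "s \<le> t + r")
      case True then show ?thesis using \<open>0 \<le> y \<and> _\<close> by (auto simp: F_def indicator_def)
    next
      case False
      then have "deriv \<kappa> (t - s) = 0" using dz[of "t - s"] by simp
      then show ?thesis by (simp add: F_def)
    qed
    moreover have "(LINT s|lborel. deriv \<kappa> (t - s) * indicator {y..t + r} s) = - \<kappa> (t - (t + r)) - - \<kappa> (t - y)"
    proof (rule integral_FTC_Icc_real)
      show "((\<lambda>s. - \<kappa> (t - s)) has_real_derivative deriv \<kappa> (t - s)) (at s)" for s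
      proof -
        have "((\<lambda>s. t - s) has_real_derivative - 1) (at s)" by (auto intro!: derivative_eq_intros)
        from DERIV_minus[OF DERIV_chain2[OF smooth1_deriv(1)[OF \<kappa>(1)] this]] show ?thesis by simp
      qed
      show "isCont (\<lambda>s. deriv \<kappa> (t - s)) s" for s
      proof -
        have "continuous_on UNIV (\<lambda>s. deriv \<kappa> (t - s))"
          by (rule continuous_on_compose2[OF smooth1_continuous[OF smooth1_deriv(2)[OF \<kappa>(1)], of UNIV]])
             (auto intro!: continuous_intros)
        then show ?thesis by (simp add: continuous_on_eq_continuous_at)
      qed
    qed (use True in auto)
    \<comment> \<open>The upper limit \<open>t + r\<close> hits the edge of the support, where
      vanishing is not assumed but follows from continuity.\<close>
    moreover have "\<kappa> (- r) = 0"
    proof (rule ccontr)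
      assume "\<kappa> (- r) \<noteq> 0"
      have "isCont \<kappa> (- r)"
        using smooth1_continuous[OF \<kappa>(1), of UNIV] by (auto simp: continuous_on_eq_continuous_at)
      then have "eventually (\<lambda>s. \<kappa> s \<noteq> 0) (at (- r))"
        using \<open>\<kappa> (- r) \<noteq> 0\<close> by (intro tendsto_imp_eventually_ne) (auto simp: isCont_def)
      then have "eventually (\<lambda>s. \<kappa> s \<noteq> 0) (at_left (- r))" by (auto simp: eventually_at_split)
      moreover have "eventually (\<lambda>s. \<kappa> s = 0) (at_left (- r))"
        unfolding eventually_at_left_field using r by (intro exI[of _ "- r - 1"]) (auto intro!: \<kappa>(2))
      ultimately have "eventually (\<lambda>s. False) (at_left (- r))" by eventually_elim auto
      then show False by simp
    qed
    ultimately show ?thesis by simp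
  next
    case False
    then have "r < \<bar>t - y\<bar>" using r by auto
    moreover have "F s y = 0" for s
    proof (cases "0 \<le> y \<and> y \<le> s")
      case True
      then have "r < \<bar>t - s\<bar>" using False by auto
      then show ?thesis using dz[of "t - s"] by (simp add: F_def)
    qed (auto simp: F_def)
    ultimately show ?thesis using \<kappa>(2) by simp
  qed
  show ?thesis using lborel_pair.Fubini_integral[OF int] by (simp add: 1 2)
qed

lemma tensor_Pair:
  fixes x :: "'a::euclidean_space" and t :: real
  shows "tensor g (x, t) = tensor (\<lambda>b. g (b, 0)) x * g (0, 1) t"
proof -
  have "(\<Prod>b\<in>Basis. g b ((x, t) \<bullet> b)) =
      (\<Prod>b\<in>(\<lambda>u. (u, 0)) ` Basis. g b ((x, t) \<bullet> b)) * (\<Prod>b\<in>(\<lambda>u. (0, u)) ` Basis. g b ((x, t) \<bullet> b))"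
    unfolding Basis_prod_def by (rule prod.union_disjoint) (auto simp: Basis_prod_def)
  also have "(\<Prod>b\<in>(\<lambda>u. (u, 0::real)) ` Basis. g b ((x, t) \<bullet> b)) = tensor (\<lambda>b. g (b, 0)) x"
    unfolding tensor_def by (subst prod.reindex) (auto simp: inj_on_def)
  finally show ?thesis by (simp add: tensor_def)
qed

lemma integral_time_tensor:
  fixes z :: "'a::euclidean_space \<times> real"
  assumes a: "a \<in> borel_measurable borel" "\<And>s. \<bar>a s\<bar> \<le> L" and g: "kernel r g"
  shows "(LINT y|lborel. a (snd y) * tensor g (z - y)) =
    (LINT x|lborel. tensor (\<lambda>b. g (b, 0)) (fst z - x)) * (LINT s|lborel. a s * g (0, 1) (snd z - s))"
proof -
  let ?F = "\<lambda>x s. tensor (\<lambda>b. g (b, 0)) (fst z - x) * (a s * g (0, 1) (snd z - s))"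
  have eq: "a (snd y) * tensor g (z - y) = case_prod ?F y" for y
    by (cases y; cases z) (simp add: tensor_Pair)
  have m: "(\<lambda>y::'a \<times> real. a (snd y)) \<in> borel_measurable borel"
    using measurable_compose[OF measurable_snd, of a borel borel "borel :: 'a measure"] a(1)
    by (simp add: borel_prod)
  have "integrable lborel (case_prod ?F)"
    using bounded_times_tensor_integrable[OF m _ g, of L z] a(2) by (simp add: eq)
  then have int: "integrable (lborel \<Otimes>\<^sub>M lborel) (case_prod ?F)" by (simp add: lborel_prod)
  have "(LINT y|lborel. a (snd y) * tensor g (z - y)) = integral\<^sup>L (lborel \<Otimes>\<^sub>M lborel) (case_prod ?F)"
    by (simp add: eq lborel_prod)
  also have "\<dots> = (LINT x|lborel. LINT s|lborel. ?F x s)"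
    using lborel_pair.integral_fst[OF int] by simp
  finally show ?thesis by simp
qed

section \<open>The normalised bump mollifier\<close>

definition bump_kernel :: "real \<Rightarrow> 'a::euclidean_space \<Rightarrow> real \<Rightarrow> real" where
  "bump_kernel r = (\<lambda>b s. bump (s / r))"

definition mass :: "real \<Rightarrow> 'a::euclidean_space itself \<Rightarrow> real" where
  "mass r _ = mol (bump_kernel r) (\<lambda>_. 1) (0::'a)"

lemma kernel_bump_kernel: "r > 0 \<Longrightarrow> kernel r (bump_kernel r)"
  unfolding bump_kernel_def by (rule kernel_bump)

lemma tensor_bump_nonneg: "tensor (bump_kernel r) z \<ge> 0"
  by (auto simp: tensor_def bump_kernel_def bump_nonneg intro!: prod_nonneg)

lemma bump_minus: "bump (- x) = bump x"
  by (simp add: bump_def mult.commute)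

lemma tensor_bump_even: "tensor (bump_kernel r) (- z) = tensor (bump_kernel r) z"
  by (simp add: tensor_def bump_kernel_def bump_minus)

text \<open>The kernel is even, so its reflected translate is a translate, and Lebesgue measure is
  translation invariant.\<close>

lemma mol_one:
  assumes "r > 0"
  shows "mol (bump_kernel r) (\<lambda>_. 1) (z::'a::euclidean_space) = mass r TYPE('a)"
proof -
  have m: "tensor (bump_kernel r :: 'a \<Rightarrow> _) \<in> borel_measurable borel"
    by (rule borel_measurable_continuous_onI[OF tensor_continuous[OF kernel_bump_kernel[OF assms]]])
  have "tensor (bump_kernel r) (z - y) = tensor (bump_kernel r) (- z + y)" for y
    using tensor_bump_even[of r "z - y"] by simp
  then have "mol (bump_kernel r) (\<lambda>_. 1) z = (LINT y|distr lborel borel ((+) (- z)). tensor (bump_kernel r) y)"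
    by (subst integral_distr) (auto simp: mol_def m)
  also have "\<dots> = mass r TYPE('a)"
    by (simp add: lborel_distr_plus mass_def mol_def tensor_bump_even)
  finally show ?thesis .
qed

lemma mass_pos:
  assumes "r > 0"
  shows "mass r TYPE('a::euclidean_space) > 0"
proof -
  let ?f = "\<lambda>y::'a. 1 * tensor (bump_kernel r) (0 - y)"
  note k = kernel_bump_kernel[OF assms]
  have c: "continuous_on UNIV (\<lambda>_::'a. 1::real)" by simp
  have m: "mass r TYPE('a) = integral (kbox r (0::'a)) ?f"
    unfolding mass_def by (rule mol_integrand_cbox(2)[OF c k order_refl])
  have "mass r TYPE('a) \<ge> 0"
    unfolding mass_def mol_def by (simp add: tensor_bump_nonneg)
  moreover have "mass r TYPE('a) \<noteq> 0"
  proof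
    assume 0: "mass r TYPE('a) = 0"
    have "(?f has_integral 0) (kbox r 0)"
      using m 0 integrable_integral[OF mol_integrand_cbox(3)[OF c k order_refl, of "0::'a"]] by simp
    then have "?f 0 = 0"
    proof (rule has_integral_0_cbox_imp_0[rotated 2])
      show "continuous_on (kbox r 0) ?f"
        by (intro continuous_intros continuous_on_compose2[OF tensor_continuous[OF k, of UNIV]]) auto
    qed (use assms in \<open>auto simp: tensor_bump_nonneg box_ne_empty mem_box inner_simps\<close>)
    moreover have "tensor (bump_kernel r) (0::'a) > 0"
      by (auto simp: tensor_def bump_kernel_def bump_pos_0 intro!: prod_pos)
    ultimately show False by simp
  qed
  ultimately show ?thesis by simp
qed

definition moll :: "real \<Rightarrow> ('a::euclidean_space \<Rightarrow> real) \<Rightarrow> 'a \<Rightarrow> real" where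
  "moll r q z = mol (bump_kernel r) q z / mass r TYPE('a)"

text \<open>\<open>moll r q z\<close> is a weighted mean of the values of \<open>q\<close> on the
  kernel box.\<close>

lemma moll_close:
  fixes q :: "'a::euclidean_space \<Rightarrow> real"
  assumes q: "continuous_on UNIV q" and r: "r > 0" and c: "\<And>y. y \<in> kbox r z \<Longrightarrow> \<bar>q y - c\<bar> \<le> \<sigma>"
  shows "\<bar>moll r q z - c\<bar> \<le> \<sigma>"
proof -
  let ?t = "\<lambda>y. tensor (bump_kernel r) (z - y)"
  note k = kernel_bump_kernel[OF r]
  have i1: "integrable lborel (\<lambda>y. 1 * ?t y)" by (rule mol_integrable[OF _ k]) simp
  have iq: "integrable lborel (\<lambda>y. q y * ?t y)" by (rule mol_integrable[OF q k])
  have m: "mass r TYPE('a) = (LINT y|lborel. ?t y)"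
    using mol_one[OF r, of z] by (simp add: mol_def)
  have "\<bar>mol (bump_kernel r) q z - c * mass r TYPE('a)\<bar> = \<bar>LINT y|lborel. (q y - c) * ?t y\<bar>"
    using i1 iq by (simp add: mol_def m left_diff_distrib)
  also have "\<dots> \<le> (LINT y|lborel. \<bar>(q y - c) * ?t y\<bar>)"
    by (rule integral_abs_bound)
  also have "\<dots> \<le> (LINT y|lborel. \<sigma> * ?t y)"
  proof (rule integral_mono)
    show "integrable lborel (\<lambda>y. \<bar>(q y - c) * ?t y\<bar>)"
      using i1 iq by (simp add: left_diff_distrib)
    show "integrable lborel (\<lambda>y. \<sigma> * ?t y)" using i1 by simp
    show "\<bar>(q y - c) * ?t y\<bar> \<le> \<sigma> * ?t y" for y
    proof (cases "y \<in> kbox r z")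
      case True
      then show ?thesis using c[OF True] by (simp add: abs_mult tensor_bump_nonneg mult_right_mono)
    qed (simp add: tensor_eq_0[OF k])
  qed
  also have "\<dots> = \<sigma> * mass r TYPE('a)" by (simp add: m)
  finally have "\<bar>mol (bump_kernel r) q z - c * mass r TYPE('a)\<bar> \<le> \<sigma> * mass r TYPE('a)" .
  then have "\<bar>mol (bump_kernel r) q z - c * mass r TYPE('a)\<bar> / mass r TYPE('a) \<le> \<sigma>"
    using mass_pos[OF r, where 'a='a] by (simp add: divide_le_eq)
  moreover have "moll r q z - c = (mol (bump_kernel r) q z - c * mass r TYPE('a)) / mass r TYPE('a)"
    using mass_pos[OF r, where 'a='a] by (simp add: moll_def diff_divide_distrib)
  ultimately show ?thesis using mass_pos[OF r, where 'a='a] by (simp add: abs_divide)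
qed

text \<open>The identity behind the cancellation of rough terms: for a function of time alone, the
  space factor of the kernel integrates to a constant that cancels against the mass. Hence
  mollifying \<open>prim a\<close> in one dimension and differentiating gives the very space-time
  average of \<open>a\<close> that mollifying the equation produces.\<close>

lemma moll_prim_DERIV:
  fixes z :: "'a::euclidean_space \<times> real"
  assumes a: "a \<in> borel_measurable borel" "\<And>s. \<bar>a s\<bar> \<le> L" and r: "0 < r" "r < snd z"
  shows "(moll r (prim a) has_real_derivative
    (LINT y|lborel. a (snd y) * tensor (bump_kernel r) (z - y)) / mass r TYPE('a \<times> real)) (at (snd z))"
proof -
  let ?\<kappa> = "\<lambda>s. bump (s / r)"
  let ?P = "LINT x|lborel. tensor (\<lambda>b. bump_kernel r (b, 0::real)) (fst z - x)"
  note k = kernel_bump_kernel[OF r(1)]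
  have kr: "smooth1 ?\<kappa>" "\<And>s. r < \<bar>s\<bar> \<Longrightarrow> ?\<kappa> s = 0"
    using kernel_bump[OF r(1), where 'a=real] by (auto simp: kernel_def)
  have t: "LINT y|lborel. a (snd y) * tensor (bump_kernel r) (z - y) = ?P * (LINT s|lborel. a s * ?\<kappa> (snd z - s))"
    using integral_time_tensor[OF a k, of z] by (simp add: bump_kernel_def)
  have one: "mass r TYPE('a \<times> real) = ?P * mass r TYPE(real)"
    using integral_time_tensor[of "\<lambda>_. 1" 1, OF _ _ k, of z] mol_one[OF r(1), of z] mol_one[OF r(1), of "snd z"]
    by (simp add: mol_def real_tensor bump_kernel_def)
  have "?P \<noteq> 0" using one mass_pos[OF r(1), where 'a="'a \<times> real"] by auto
  have "((\<lambda>s. mol (bump_kernel r) (prim a) (s + snd z)) has_real_derivative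
      mol ((bump_kernel r)(1 := deriv ?\<kappa>)) (prim a) (snd z)) (at 0)"
    using mol_DERIV[OF prim_continuous[OF a] k, of 1 "snd z" 0] by (simp add: bump_kernel_def add.commute)
  then have "(mol (bump_kernel r) (prim a) has_real_derivative
      mol ((bump_kernel r)(1 := deriv ?\<kappa>)) (prim a) (snd z)) (at (snd z))"
    using DERIV_shift[of "mol (bump_kernel r) (prim a)" _ 0 "snd z"] by simp
  also have "mol ((bump_kernel r)(1 := deriv ?\<kappa>)) (prim a) (snd z) = (LINT y|lborel. a y * ?\<kappa> (snd z - y))"
    using mol_deriv_prim[OF a kr r] by (simp add: mol_def real_tensor)
  finally have "((\<lambda>s. moll r (prim a) s) has_real_derivative
      (LINT y|lborel. a y * ?\<kappa> (snd z - y)) / mass r TYPE(real)) (at (snd z))"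
    unfolding moll_def by (rule DERIV_cdivide)
  then show ?thesis unfolding t one using \<open>?P \<noteq> 0\<close> by simp
qed

section \<open>The comparison principle\<close>

lemma second_derivative_at_max:
  fixes F F' :: "real \<Rightarrow> real"
  assumes F: "\<And>s. (F has_real_derivative F' s) (at s)" and F': "(F' has_real_derivative c) (at 0)"
    and \<delta>: "0 < \<delta>" "\<And>s. \<bar>s\<bar> < \<delta> \<Longrightarrow> F s \<le> F 0"
  shows "c \<le> 0"
proof (rule ccontr)
  assume "\<not> c \<le> 0"
  then have "0 < c" by simp
  have "F' 0 = 0" by (rule DERIV_local_max[OF F \<delta>(1)]) (use \<delta>(2) in auto)
  from DERIV_pos_inc_right[OF F' \<open>0 < c\<close>] obtain d where
    d: "0 < d" "\<And>h. 0 < h \<Longrightarrow> h < d \<Longrightarrow> 0 < F' h" using \<open>F' 0 = 0\<close> by auto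
  define s where "s = min d \<delta> / 2"
  have s: "0 < s" "s < d" "s < \<delta>" using d \<delta>(1) by (auto simp: s_def)
  obtain \<xi> where "0 < \<xi>" "\<xi> < s" "F s - F 0 = (s - 0) * F' \<xi>"
    using MVT2[OF s(1), of F F'] F by blast
  moreover have "F' \<xi> > 0" using d(2) calculation s by auto
  ultimately have "F s > F 0" using s by (simp add: algebra_simps)
  then show False using \<delta>(2)[of s] s by auto
qed

text \<open>Only times up to \<open>t\<close> compete, since a parabolic maximum may sit at the
  final time.\<close>

lemma left_derivative_at_max:
  fixes F :: "real \<Rightarrow> real"
  assumes F: "(F has_real_derivative c) (at t)" and \<delta>: "0 < \<delta>" "\<And>s. t - \<delta> < s \<Longrightarrow> s \<le> t \<Longrightarrow> F s \<le> F t"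
  shows "0 \<le> c"
proof (rule ccontr)
  assume "\<not> 0 \<le> c"
  from DERIV_neg_dec_left[OF F, of] this obtain d where
    d: "0 < d" "\<And>h. 0 < h \<Longrightarrow> h < d \<Longrightarrow> F t < F (t - h)" by auto
  define h where "h = min d \<delta> / 2"
  have "0 < h" "h < d" "h < \<delta>" using d(1) \<delta>(1) by (auto simp: h_def)
  then show False using d(2)[of h] \<delta>(2)[of "t - h"] by auto
qed

lemma kbox_dist:
  fixes y z :: "'a::euclidean_space"
  assumes "y \<in> kbox r z"
  shows "dist z y \<le> r * DIM('a)"
proof -
  have "norm (z - y) \<le> (\<Sum>b\<in>Basis. \<bar>(z - y) \<bullet> b\<bar>)" by (rule norm_le_l1)
  also have "\<dots> \<le> (\<Sum>b\<in>(Basis::'a set). r)" using assms unfolding mem_kbox by (intro sum_mono) blast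
  finally show ?thesis by (simp add: dist_norm mult.commute)
qed

lemma moll_prim_close:
  assumes a: "a \<in> borel_measurable borel" "\<And>s. \<bar>a s\<bar> \<le> L" and r: "r > 0"
  shows "\<bar>moll r (prim a) t - prim a t\<bar> \<le> L * r"
proof (rule moll_close[OF prim_continuous[OF a] r])
  fix y assume "y \<in> kbox r t"
  then have "\<bar>t - y\<bar> \<le> r" unfolding mem_kbox by simp
  then have "L * \<bar>y - t\<bar> \<le> L * r" using a(2)[of 0] by (intro mult_left_mono) auto
  then show "\<bar>prim a y - prim a t\<bar> \<le> L * r" using prim_lipschitz[OF a, of y t] by linarith
qed

text \<open>The radius has to be fixed before the maximum point of the mollified difference is
  known, so all estimates are made uniform on the compact set \<open>D\<close>.\<close>

lemma mollification_scale:
  fixes q \<psi> :: "'a::euclidean_space \<times> real \<Rightarrow> real"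
  assumes q: "continuous_on UNIV q" and a: "a \<in> borel_measurable borel" "\<And>s. \<bar>a s\<bar> \<le> L"
    and D: "compact D" "open N" "D \<subseteq> N" and \<psi>: "continuous_on D \<psi>" and pos: "0 < t0" "0 < \<sigma>"
  obtains r where "0 < r" "r < t0"
    and "\<And>z y. z \<in> D \<Longrightarrow> y \<in> kbox r z \<Longrightarrow> y \<in> N \<and> \<bar>q y - q z\<bar> \<le> \<sigma>"
    and "\<And>z. z \<in> D \<Longrightarrow> \<bar>exp (moll r (prim a) (snd z)) * \<psi> z - exp (prim a (snd z)) * \<psi> z\<bar> \<le> \<sigma>"
proof -
  have L: "0 \<le> L" using a(2)[of 0] by simp
  obtain e1 where e1: "0 < e1" "(\<Union>z\<in>D. ball z e1) \<subseteq> N"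
    using compact_subset_open_imp_ball_epsilon_subset[OF D] by blast
  obtain R where R: "D \<subseteq> cball 0 R" using compact_imp_bounded[OF D(1)] unfolding bounded_iff by force
  have "uniformly_continuous_on (cball 0 (R + 1)) q"
    by (intro compact_uniformly_continuous continuous_on_subset[OF q]) auto
  then obtain e2 where e2: "0 < e2"
    "\<And>z y. z \<in> cball 0 (R + 1) \<Longrightarrow> y \<in> cball 0 (R + 1) \<Longrightarrow> dist y z < e2 \<Longrightarrow> dist (q y) (q z) < \<sigma>"
    unfolding uniformly_continuous_on_def using pos(2) by metis
  have "bounded (\<psi> ` D)" by (intro compact_imp_bounded compact_continuous_image \<psi> D)
  then obtain \<Psi> where \<Psi>: "\<And>z. z \<in> D \<Longrightarrow> \<bar>\<psi> z\<bar> \<le> \<Psi>" by (auto simp: bounded_real)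
  have "bounded ((\<lambda>z. prim a (snd z)) ` D)"
    by (intro compact_imp_bounded compact_continuous_image D
        continuous_on_compose2[OF prim_continuous[OF a, of UNIV]] continuous_intros) auto
  then obtain \<beta> where \<beta>: "\<And>z. z \<in> D \<Longrightarrow> \<bar>prim a (snd z)\<bar> \<le> \<beta>" by (auto simp: bounded_real)
  have "uniformly_continuous_on {- \<beta> - 1 .. \<beta> + 1} (exp :: real \<Rightarrow> real)"
    by (intro compact_uniformly_continuous continuous_intros) auto
  moreover have "0 < \<sigma> / (\<bar>\<Psi>\<bar> + 1)" using pos(2) by (simp add: add_nonneg_pos)
  ultimately obtain d where d: "0 < d"
    "\<And>x y. x \<in> {- \<beta> - 1 .. \<beta> + 1} \<Longrightarrow> y \<in> {- \<beta> - 1 .. \<beta> + 1} \<Longrightarrow> \<bar>y - x\<bar> < d \<Longrightarrow> \<bar>exp y - exp x\<bar> < \<sigma> / (\<bar>\<Psi>\<bar> + 1)"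
    unfolding uniformly_continuous_on_def dist_real_def by metis
  define m where "m = Min {e1, e2, d, 1, t0}"
  have m: "0 < m" "m \<le> e1" "m \<le> e2" "m \<le> d" "m \<le> 1" "m \<le> t0"
    using e1(1) e2(1) d(1) pos(1) by (auto simp: m_def)
  \<comment> \<open>\<open>M\<close> dominates both the dimension factor of \<open>kbox_dist\<close>
    and the Lipschitz constant of \<open>prim a\<close>, so one radius serves both
    estimates.\<close>
  define M where "M = real DIM('a \<times> real) + L + 1"
  have M: "1 < M" "real DIM('a \<times> real) \<le> M" "L \<le> M" using L by (auto simp: M_def)
  define r where "r = m / (2 * M)"
  have r0: "0 < r" using m M by (simp add: r_def)
  have rM: "r * M < m" using m M by (simp add: r_def)
  have rD: "r * DIM('a \<times> real) < m"
    using mult_left_mono[OF M(2) less_imp_le[OF r0]] rM by (rule le_less_trans)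
  have rL: "L * r < m"
    using mult_left_mono[OF M(3) less_imp_le[OF r0]] rM unfolding mult.commute[of L r] by (rule le_less_trans)
  show ?thesis
  proof
    show "0 < r" by (rule r0)
    have "r < r * M" using r0 M by simp
    then show "r < t0" using rM m by linarith
  next
    fix z y assume z: "z \<in> D" and y: "y \<in> kbox r z"
    have dist: "dist z y < m" using kbox_dist[OF y] rD by linarith
    then have "y \<in> (\<Union>z\<in>D. ball z e1)" using z m(2) by (auto intro!: bexI[of _ z])
    then have "y \<in> N" using e1(2) by blast
    moreover have "norm z \<le> R" using R z by auto
    then have "z \<in> cball 0 (R + 1)" "y \<in> cball 0 (R + 1)"
      using dist m(5) norm_triangle_ineq3[of z y] unfolding mem_cball_0 dist_norm by linarith+
    then have "dist (q y) (q z) < \<sigma>" using e2(2) dist m(3) by (simp add: dist_commute)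
    ultimately show "y \<in> N \<and> \<bar>q y - q z\<bar> \<le> \<sigma>" by (simp add: dist_real_def)
  next
    fix z assume z: "z \<in> D"
    let ?x = "prim a (snd z)" and ?y = "moll r (prim a) (snd z)"
    have c: "\<bar>?y - ?x\<bar> < m" using moll_prim_close[OF a r0, of "snd z"] rL by linarith
    then have "\<bar>exp ?y - exp ?x\<bar> < \<sigma> / (\<bar>\<Psi>\<bar> + 1)"
      by (intro d(2)) (use \<beta>[OF z] m in auto)
    then have "\<bar>exp ?y - exp ?x\<bar> * \<bar>\<psi> z\<bar> \<le> \<sigma> / (\<bar>\<Psi>\<bar> + 1) * (\<bar>\<Psi>\<bar> + 1)"
      using \<Psi>[OF z] pos(2) by (intro mult_mono) auto
    then show "\<bar>exp ?y * \<psi> z - exp ?x * \<psi> z\<bar> \<le> \<sigma>"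
      by (simp add: abs_mult[symmetric] left_diff_distrib)
  qed
qed

text \<open>On the kernel box \<open>q\<close> is within \<sigma> of \<open>c\<close>, so replacing
  \<open>a q\<close> by \<open>a c\<close> costs at most \<open>L * \<sigma>\<close> per unit of
  mass; \<open>a\<close> itself is never approximated.\<close>

lemma weak_heat_moll_lower:
  fixes q h :: "(real^'n) \<times> real \<Rightarrow> real"
  assumes q: "continuous_on UNIV q" and wh: "weak_heat q h" and r: "0 < r" "r < snd z"
    and a: "a \<in> borel_measurable borel" "\<And>s. \<bar>a s\<bar> \<le> L" and \<sigma>: "\<And>y. y \<in> kbox r z \<Longrightarrow> \<bar>q y - c\<bar> \<le> \<sigma>"
    and h: "AE y in lebesgue. y \<in> kbox r z \<longrightarrow> a (snd y) * q y \<le> h y"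
  shows "c * (LINT y|lborel. a (snd y) * tensor (bump_kernel r) (z - y)) - L * \<sigma> * mass r TYPE((real^'n) \<times> real)
    \<le> (LINT y|lebesgue. h y * tensor (bump_kernel r) (z - y))"
proof -
  let ?t = "\<lambda>y. tensor (bump_kernel r) (z - y)"
  note k = kernel_bump_kernel[OF r(1)]
  have L: "0 \<le> L" using a(2)[of 0] by simp
  have m: "(\<lambda>y::(real^'n) \<times> real. a (snd y)) \<in> borel_measurable borel"
    using measurable_compose[OF measurable_snd, of a borel borel "borel :: (real^'n) measure"] a(1)
    by (simp add: borel_prod)
  have ia: "integrable lborel (\<lambda>y. a (snd y) * ?t y)"
    by (rule bounded_times_tensor_integrable[OF m _ k]) (rule a(2))
  have i1: "integrable lborel (\<lambda>y. 1 * ?t y)" by (rule mol_integrable[OF _ k]) simp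
  let ?f = "\<lambda>y. c * (a (snd y) * ?t y) - L * \<sigma> * (1 * ?t y)"
  have i: "integrable lborel ?f" using ia i1 by auto
  have "c * (LINT y|lborel. a (snd y) * ?t y) - L * \<sigma> * mass r TYPE((real^'n) \<times> real) = (LINT y|lborel. ?f y)"
    using ia i1 mol_one[OF r(1), of z] by (simp add: mol_def)
  also have "\<dots> = (LINT y|lebesgue. ?f y)"
    by (rule integral_completion[OF borel_measurable_integrable[OF i], symmetric])
  also have "\<dots> \<le> (LINT y|lebesgue. h y * ?t y)"
  proof (rule integral_mono_AE)
    show "integrable lebesgue ?f"
      using integrable_completion[OF borel_measurable_integrable[OF i]] i by blast
    show "integrable lebesgue (\<lambda>y. h y * ?t y)" using wh k r(2) unfolding weak_heat_def by blast
    show "AE y in lebesgue. ?f y \<le> h y * ?t y"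
      using h
    proof eventually_elim
      case (elim y)
      show ?case
      proof (cases "y \<in> kbox r z")
        case True
        have "\<bar>a (snd y) * (q y - c)\<bar> \<le> L * \<sigma>"
          unfolding abs_mult using a(2) \<sigma>[OF True] L by (intro mult_mono) auto
        then have "a (snd y) * c - L * \<sigma> \<le> a (snd y) * q y" by (simp add: right_diff_distrib abs_le_iff)
        also have "\<dots> \<le> h y" using elim True by simp
        finally have "(a (snd y) * c - L * \<sigma>) * ?t y \<le> h y * ?t y"
          by (intro mult_right_mono tensor_bump_nonneg)
        then show ?thesis by (simp add: algebra_simps)
      qed (simp add: tensor_eq_0[OF k])
    qed
  qed
  finally show ?thesis .
qed

text \<open>The proof evaluates the mollified equation at a maximum point of
  \<open>exp (- K t) (w - v)\<close>, where \<open>v\<close> and \<open>w\<close> are the mollified versions of \<open>q\<close> and of the barrier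
  \<open>exp (prim a t) \<psi>\<close> (only \<open>prim a\<close> is mollified in the latter). There the value of \<open>q\<close> is below the level
  \<open>s0\<close>, so that the differential inequality for \<open>h\<close> is available on the support of the kernel.\<close>

lemma comparison:
  fixes q h \<psi> \<psi>t :: "(real^'n) \<times> real \<Rightarrow> real" and \<psi>x \<psi>xx :: "'n \<Rightarrow> (real^'n) \<times> real \<Rightarrow> real"
  assumes q: "continuous_on UNIV q" and wh: "weak_heat q h"
    and a: "a \<in> borel_measurable borel" "\<And>s. \<bar>a s\<bar> \<le> L"
    and D: "compact D" "open N" "D \<subseteq> N" and t0: "0 < t0" "\<And>z. z \<in> D \<Longrightarrow> t0 \<le> snd z"
    and \<psi>: "continuous_on D \<psi>"
    and \<psi>t: "\<And>x t. (x, t) \<in> D \<Longrightarrow> ((\<lambda>s. \<psi> (x, s)) has_real_derivative \<psi>t (x, t)) (at t)"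
    and \<psi>x: "\<And>i x t s. ((\<lambda>s. \<psi> (x + s *\<^sub>R axis i 1, t)) has_real_derivative \<psi>x i (x + s *\<^sub>R axis i 1, t)) (at s)"
    and \<psi>xx: "\<And>i x t. ((\<lambda>s. \<psi>x i (x + s *\<^sub>R axis i 1, t)) has_real_derivative \<psi>xx i (x, t)) (at 0)"
    and sub: "\<And>z. z \<in> D \<Longrightarrow> \<psi>t z \<le> (\<Sum>i\<in>UNIV. \<psi>xx i z)"
    and level: "\<And>z. z \<in> D \<Longrightarrow> exp (prim a (snd z)) * \<psi> z \<le> s0"
    and h: "AE y in lebesgue. y \<in> N \<and> q y \<le> s0 \<longrightarrow> a (snd y) * q y \<le> h y"
    and init: "\<And>x. (x, t0) \<in> D \<Longrightarrow> exp (prim a t0) * \<psi> (x, t0) \<le> q (x, t0)"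
    and interior: "\<And>x t. (x, t) \<in> D \<Longrightarrow> t0 < t \<Longrightarrow> q (x, t) < exp (prim a t) * \<psi> (x, t) \<Longrightarrow>
      \<exists>\<delta>>0. \<forall>x' s. dist x' x < \<delta> \<and> t - \<delta> < s \<and> s \<le> t \<longrightarrow> (x', s) \<in> D"
    and z: "z \<in> D"
  shows "exp (prim a (snd z)) * \<psi> z \<le> q z"
proof (rule ccontr)
  assume neg: "\<not> ?thesis"
  have L: "0 \<le> L" using a(2)[of 0] by simp
  \<comment> \<open>One more than the bound \<open>L\<close> for the averaged coefficient: at the
    maximum the weight \<open>exp (- K t)\<close> then wins by the full amount
    \<open>W - v0\<close>.\<close>
  define K where "K = L + 1"
  define m0 where "m0 = exp (- K * snd z) * (exp (prim a (snd z)) * \<psi> z - q z)"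
  have m0: "0 < m0" using neg by (simp add: m0_def)
  \<comment> \<open>Tuned so that \<open>4 * L * \<sigma> + 8 * \<sigma> = m0\<close>: the two
    mollification errors together cost at most \<open>m0 / 4\<close>, and the final error
    \<open>2 * L * \<sigma>\<close> stays below \<open>m0 / 2\<close>.\<close>
  define \<sigma> where "\<sigma> = m0 / (4 * (L + 2))"
  have \<sigma>: "0 < \<sigma>" "4 * L * \<sigma> + 8 * \<sigma> = m0"
  proof -
    have "4 * (L + 2) * \<sigma> = m0" using L by (simp add: \<sigma>_def)
    then show "4 * L * \<sigma> + 8 * \<sigma> = m0" by (simp add: algebra_simps)
  qed (use m0 L in \<open>simp add: \<sigma>_def\<close>)
  have L\<sigma>: "0 \<le> L * \<sigma>" using L \<sigma>(1) by simp
  obtain r where r: "0 < r" "r < t0"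
    and rq: "\<And>z y. z \<in> D \<Longrightarrow> y \<in> kbox r z \<Longrightarrow> y \<in> N \<and> \<bar>q y - q z\<bar> \<le> \<sigma>"
    and rw: "\<And>z. z \<in> D \<Longrightarrow> \<bar>exp (moll r (prim a) (snd z)) * \<psi> z - exp (prim a (snd z)) * \<psi> z\<bar> \<le> \<sigma>"
    using mollification_scale[OF q a D \<psi> t0(1) \<sigma>(1)] by blast
  let ?A = "moll r (prim a)" and ?v = "moll r q"
  let ?\<rho> = "bump_kernel r :: (real^'n) \<times> real \<Rightarrow> real \<Rightarrow> real"
  let ?mass = "mass r TYPE((real^'n) \<times> real)"
  note k = kernel_bump_kernel[OF r(1)]
  have mass: "0 < ?mass" by (rule mass_pos[OF r(1)])
  have rv: "\<bar>?v z - q z\<bar> \<le> \<sigma>" if "z \<in> D" for z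
    by (rule moll_close[OF q r(1)]) (use rq[OF that] in blast)
  define G where "G z = exp (- K * snd z) * (exp (?A (snd z)) * \<psi> z - ?v z)" for z
  have At: "(?A has_real_derivative (LINT y|lborel. a (snd y) * tensor ?\<rho> (z - y)) / ?mass) (at (snd z))"
    if "r < snd z" for z :: "(real^'n) \<times> real"
    by (rule moll_prim_DERIV[OF a r(1) that])
  have vD: "((\<lambda>s. mol g q (y + s *\<^sub>R c) / ?mass) has_real_derivative mol (g(c := deriv (g c))) q (y + s *\<^sub>R c) / ?mass) (at s)"
    if "kernel r g" "c \<in> Basis" for g c y s
    by (rule DERIV_cdivide[OF mol_DERIV[OF q that]])
  have Gc: "continuous_on D G"
  proof -
    have "isCont ?A (snd z)" if "z \<in> D" for z
      using DERIV_isCont[OF At] t0(2)[OF that] r(2) by force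
    then have "continuous_on (snd ` D) ?A" by (auto intro: continuous_at_imp_continuous_on)
    then have "continuous_on D (\<lambda>z. ?A (snd z))"
      by (rule continuous_on_compose2) (auto intro: continuous_intros)
    moreover have "continuous_on D ?v"
    proof -
      have ck: "continuous_on UNIV (tensor ?\<rho>)" by (rule tensor_continuous[OF k])
      obtain R where R: "\<And>z y. z \<in> D \<Longrightarrow> y \<in> kbox r z \<Longrightarrow> y \<in> cball 0 R"
      proof -
        obtain R where R: "D \<subseteq> cball 0 R" using compact_imp_bounded[OF D(1)] unfolding bounded_iff by force
        have "y \<in> cball 0 (R + r * DIM((real^'n) \<times> real))" if "z \<in> D" "y \<in> kbox r z" for z y
        proof -
          have "norm z \<le> R" using R that(1) by auto
          moreover have "norm (z - y) \<le> r * DIM((real^'n) \<times> real)"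
            using kbox_dist[OF that(2)] by (simp only: dist_norm)
          ultimately have "norm y \<le> R + r * DIM((real^'n) \<times> real)"
            using norm_triangle_ineq3[of z y] by linarith
          then show ?thesis by (simp only: mem_cball_0)
        qed
        then show ?thesis using that by blast
      qed
      obtain b where b: "cball 0 R \<subseteq> cbox (- b) (b :: (real^'n) \<times> real)"
        using bounded_subset_cbox_symmetric[OF bounded_cball] by blast
      have "continuous_on D (\<lambda>z. integral (cbox (- b) b) (\<lambda>y. q y * tensor ?\<rho> (z - y)))"
        by (rule integral_continuous_on_param)
           (auto simp: split_beta intro!: continuous_intros continuous_on_compose2[OF ck] continuous_on_compose2[OF q])
      moreover have "mol ?\<rho> q z = integral (cbox (- b) b) (\<lambda>y. q y * tensor ?\<rho> (z - y))" if "z \<in> D" for z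
        by (rule mol_integrand_cbox(2)[OF q k]) (use R[OF that] b in blast)
      ultimately show ?thesis
        unfolding moll_def by (intro continuous_intros) (use mass in \<open>auto cong: continuous_on_cong\<close>)
    qed
    ultimately show ?thesis unfolding G_def by (intro continuous_intros \<psi>)
  qed
  obtain z0 where z0: "z0 \<in> D" and max: "\<And>z. z \<in> D \<Longrightarrow> G z \<le> G z0"
    using continuous_attains_sup[OF D(1) _ Gc] z by blast
  obtain x0 \<tau> where z0_eq: "z0 = (x0, \<tau>)" by (cases z0)
  have \<tau>: "t0 \<le> \<tau>" "0 < \<tau>" "r < \<tau>" using t0 z0 r z0_eq by fastforce+
  define W where "W = exp (?A \<tau>) * \<psi> z0"
  define v0 where "v0 = ?v z0"
  have Wv: "m0 / 2 \<le> W - v0"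
  proof -
    have "0 \<le> K * snd z" using t0(1) t0(2)[OF z] L by (simp add: K_def)
    then have "exp (- K * snd z) \<le> 1" by simp
    moreover have "\<bar>(exp (?A (snd z)) * \<psi> z - ?v z) - (exp (prim a (snd z)) * \<psi> z - q z)\<bar> \<le> 2 * \<sigma>"
      using rw[OF z] rv[OF z] by linarith
    ultimately have "exp (- K * snd z) * \<bar>(exp (?A (snd z)) * \<psi> z - ?v z) - (exp (prim a (snd z)) * \<psi> z - q z)\<bar> \<le> 1 * (2 * \<sigma>)"
      by (intro mult_mono) auto
    then have "\<bar>G z - m0\<bar> \<le> 2 * \<sigma>"
      by (simp add: G_def m0_def right_diff_distrib[symmetric] abs_mult)
    then have G: "m0 / 2 \<le> G z0" using max[OF z] \<sigma> L\<sigma> by linarith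
    have "G z0 = exp (- K * \<tau>) * (W - v0)" by (simp add: G_def W_def v0_def z0_eq)
    moreover from this have "0 < W - v0" using G m0 zero_less_mult_pos[of "exp (- K * \<tau>)" "W - v0"] by simp
    moreover have "exp (- K * \<tau>) \<le> 1"
    proof -
      have "0 \<le> K * \<tau>" using \<tau> L by (simp add: K_def)
      then show ?thesis by simp
    qed
    ultimately have "G z0 \<le> 1 * (W - v0)" by (simp only: ) (intro mult_right_mono, auto)
    then show ?thesis using G by simp
  qed
  \<comment> \<open>This gap of \<sigma> has two uses: it excludes the initial time, and, the
    barrier being at most \<open>s0\<close>, it keeps \<open>q \<le> s0\<close> on the whole kernel
    box, where the inequality for \<open>h\<close> is needed.\<close>
  have wq: "q z0 + \<sigma> \<le> exp (prim a \<tau>) * \<psi> z0"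
    using Wv rw[OF z0] rv[OF z0] \<sigma> L\<sigma> unfolding W_def v0_def z0_eq snd_conv by linarith
  have "t0 < \<tau>"
  proof (rule ccontr)
    assume "\<not> t0 < \<tau>"
    then have "\<tau> = t0" using \<tau> by simp
    then show False using init[of x0] wq \<sigma>(1) z0 z0_eq by auto
  qed
  then obtain \<delta> where \<delta>: "0 < \<delta>" "\<And>x' s. dist x' x0 < \<delta> \<Longrightarrow> \<tau> - \<delta> < s \<Longrightarrow> s \<le> \<tau> \<Longrightarrow> (x', s) \<in> D"
    using interior[of x0 \<tau>] z0 wq \<sigma>(1) unfolding z0_eq by auto
  define I where "I = LINT y|lborel. a (snd y) * tensor ?\<rho> (z0 - y)"
  define vt where "vt = mol (?\<rho>((0, 1) := deriv (?\<rho> (0, 1)))) q z0 / ?mass"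
  define vxx where "vxx i = mol (?\<rho>((axis i 1, 0) := deriv (deriv (?\<rho> (axis i 1, 0))))) q z0 / ?mass" for i
  have B: "((0, 1) :: (real^'n) \<times> real) \<in> Basis" "((axis i 1, 0) :: (real^'n) \<times> real) \<in> Basis" for i
    by (auto simp: Basis_prod_def)
  have time: "K * (W - v0) \<le> I / ?mass * W + exp (?A \<tau>) * \<psi>t z0 - vt"
  proof -
    have dv: "((\<lambda>s. ?v (x0, s)) has_real_derivative vt) (at \<tau>)"
      using vD[OF k B(1), of "(x0, 0)" \<tau>] by (simp add: moll_def vt_def z0_eq)
    have dA: "(?A has_real_derivative I / ?mass) (at \<tau>)"
      using At[of z0] \<tau> by (simp add: z0_eq I_def)
    have dE: "((\<lambda>s. exp (- K * s)) has_real_derivative exp (- K * \<tau>) * - K) (at \<tau>)"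
      by (auto intro!: derivative_eq_intros)
    have "((\<lambda>s. G (x0, s)) has_real_derivative
        exp (- K * \<tau>) * - K * (exp (?A \<tau>) * \<psi> (x0, \<tau>) - ?v (x0, \<tau>)) +
        (exp (?A \<tau>) * (I / ?mass) * \<psi> (x0, \<tau>) + \<psi>t (x0, \<tau>) * exp (?A \<tau>) - vt) * exp (- K * \<tau>)) (at \<tau>)"
      unfolding G_def snd_conv
      by (rule DERIV_mult[OF dE DERIV_diff[OF DERIV_mult[OF DERIV_chain2[OF DERIV_exp dA] \<psi>t[OF z0[unfolded z0_eq]]] dv]])
    then have "0 \<le> exp (- K * \<tau>) * - K * (exp (?A \<tau>) * \<psi> (x0, \<tau>) - ?v (x0, \<tau>)) +
        (exp (?A \<tau>) * (I / ?mass) * \<psi> (x0, \<tau>) + \<psi>t (x0, \<tau>) * exp (?A \<tau>) - vt) * exp (- K * \<tau>)"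
      by (rule left_derivative_at_max[OF _ \<delta>(1)]) (use max \<delta> z0_eq in auto)
    also have "\<dots> = exp (- K * \<tau>) * (I / ?mass * W + exp (?A \<tau>) * \<psi>t z0 - vt - K * (W - v0))"
      unfolding W_def v0_def z0_eq by (simp only: algebra_simps)
    finally show ?thesis by (simp add: zero_le_mult_iff)
  qed
  have space: "exp (?A \<tau>) * \<psi>xx i z0 \<le> vxx i" for i
  proof -
    let ?e = "(axis i 1, 0) :: (real^'n) \<times> real"
    let ?\<rho>' = "?\<rho>(?e := deriv (?\<rho> ?e))"
    have F: "((\<lambda>s. exp (?A \<tau>) * \<psi> (x0 + s *\<^sub>R axis i 1, \<tau>) - ?v (x0 + s *\<^sub>R axis i 1, \<tau>)) has_real_derivative
        exp (?A \<tau>) * \<psi>x i (x0 + s *\<^sub>R axis i 1, \<tau>) - mol ?\<rho>' q (x0 + s *\<^sub>R axis i 1, \<tau>) / ?mass) (at s)" for s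
      using DERIV_diff[OF DERIV_cmult[OF \<psi>x] vD[OF k B(2), of "(x0, \<tau>)" i s]] by (simp add: moll_def)
    have F': "((\<lambda>s. exp (?A \<tau>) * \<psi>x i (x0 + s *\<^sub>R axis i 1, \<tau>) - mol ?\<rho>' q (x0 + s *\<^sub>R axis i 1, \<tau>) / ?mass) has_real_derivative
        exp (?A \<tau>) * \<psi>xx i z0 - vxx i) (at 0)"
      using DERIV_diff[OF DERIV_cmult[OF \<psi>xx] vD[OF kernel_deriv[OF k] B(2), of ?e "(x0, \<tau>)" i 0]]
      by (simp add: vxx_def z0_eq)
    have "exp (?A \<tau>) * \<psi>xx i z0 - vxx i \<le> 0"
    proof (rule second_derivative_at_max[OF F F' \<delta>(1)])
      fix s :: real assume s: "\<bar>s\<bar> < \<delta>"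
      have "(x0 + s *\<^sub>R axis i 1, \<tau>) \<in> D" using s \<delta> by (intro \<delta>(2)) (auto simp: dist_norm)
      from max[OF this] show "exp (?A \<tau>) * \<psi> (x0 + s *\<^sub>R axis i 1, \<tau>) - ?v (x0 + s *\<^sub>R axis i 1, \<tau>)
          \<le> exp (?A \<tau>) * \<psi> (x0 + 0 *\<^sub>R axis i 1, \<tau>) - ?v (x0 + 0 *\<^sub>R axis i 1, \<tau>)"
        by (simp add: G_def z0_eq)
    qed
    then show ?thesis by simp
  qed
  have "exp (?A \<tau>) * \<psi>t z0 \<le> exp (?A \<tau>) * (\<Sum>i\<in>UNIV. \<psi>xx i z0)" using sub[OF z0] by simp
  also have "\<dots> \<le> (\<Sum>i\<in>UNIV. vxx i)" unfolding sum_distrib_left by (intro sum_mono space)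
  finally have lap: "exp (?A \<tau>) * \<psi>t z0 \<le> (\<Sum>i\<in>UNIV. vxx i)" .
  have eq: "(LINT y|lebesgue. h y * tensor ?\<rho> (z0 - y)) / ?mass = vt - (\<Sum>i\<in>UNIV. vxx i)"
  proof -
    have "r < snd z0" using \<tau> z0_eq by simp
    then have "(LINT y|lebesgue. h y * tensor ?\<rho> (z0 - y)) = mol (?\<rho>((0, 1) := deriv (?\<rho> (0, 1)))) q z0
       - (\<Sum>i\<in>UNIV. mol (?\<rho>((axis i 1, 0) := deriv (deriv (?\<rho> (axis i 1, 0))))) q z0)"
      using wh k unfolding weak_heat_def by blast
    then show ?thesis by (simp add: vt_def vxx_def diff_divide_distrib sum_divide_distrib)
  qed
  have low: "v0 * I - L * (2 * \<sigma>) * ?mass \<le> (LINT y|lebesgue. h y * tensor ?\<rho> (z0 - y))"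
    unfolding I_def
  proof (rule weak_heat_moll_lower[OF q wh r(1) _ a])
    show "r < snd z0" using \<tau> z0_eq by simp
    show "\<bar>q y - v0\<bar> \<le> 2 * \<sigma>" if "y \<in> kbox r z0" for y
      using rq[OF z0 that] rv[OF z0] unfolding v0_def by linarith
    show "AE y in lebesgue. y \<in> kbox r z0 \<longrightarrow> a (snd y) * q y \<le> h y"
      using h
    proof eventually_elim
      case (elim y)
      show ?case
      proof
        assume y: "y \<in> kbox r z0"
        have "q y \<le> s0" using rq[OF z0 y] wq level[OF z0] z0_eq by auto
        then show "a (snd y) * q y \<le> h y" using elim rq[OF z0 y] by blast
      qed
    qed
  qed
  have "I \<le> L * ?mass"
  proof -
    have m: "(\<lambda>y::(real^'n) \<times> real. a (snd y)) \<in> borel_measurable borel"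
      using measurable_compose[OF measurable_snd, of a borel borel "borel :: (real^'n) measure"] a(1)
      by (simp add: borel_prod)
    have "I \<le> (LINT y|lborel. L * (1 * tensor ?\<rho> (z0 - y)))"
      unfolding I_def
    proof (rule integral_mono)
      show "integrable lborel (\<lambda>y. a (snd y) * tensor ?\<rho> (z0 - y))"
        by (rule bounded_times_tensor_integrable[OF m _ k]) (rule a(2))
      show "integrable lborel (\<lambda>y. L * (1 * tensor ?\<rho> (z0 - y)))"
        by (intro integrable_mult_right mol_integrable[OF _ k]) simp
      show "a (snd y) * tensor ?\<rho> (z0 - y) \<le> L * (1 * tensor ?\<rho> (z0 - y))" for y
        using a(2)[of "snd y"] by (simp add: mult_right_mono tensor_bump_nonneg)
    qed
    then show ?thesis using mol_one[OF r(1), of z0] by (simp add: mol_def)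
  qed
  then have IL: "I / ?mass \<le> L" using mass by (simp add: divide_le_eq)
  \<comment> \<open>The average \<open>I / ?mass\<close> that multiplies \<open>W\<close> in
    \<open>time\<close> multiplies \<open>v0\<close> here. Subtracting leaves
    \<open>I / ?mass * (W - v0)\<close>, for which only the bound \<open>I / ?mass \<le> L\<close>
    matters.\<close>
  have "v0 * (I / ?mass) - L * (2 * \<sigma>) \<le> vt - (\<Sum>i\<in>UNIV. vxx i)"
    using divide_right_mono[OF low, of ?mass] mass unfolding eq by (simp add: diff_divide_distrib)
  moreover have "I / ?mass * (W - v0) = I / ?mass * W - v0 * (I / ?mass)"
    by (simp only: right_diff_distrib mult.commute[of v0])
  ultimately have "K * (W - v0) \<le> I / ?mass * (W - v0) + L * (2 * \<sigma>)"
    using time lap by linarith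
  also have "\<dots> \<le> L * (W - v0) + L * (2 * \<sigma>)"
    using IL Wv m0 by (intro add_right_mono mult_right_mono) auto
  finally have "W - v0 \<le> 2 * L * \<sigma>" by (simp add: K_def algebra_simps)
  then show False using Wv \<sigma> by linarith
qed

section \<open>Consequences of the hypotheses on the nonlinearity\<close>

text \<open>An exceptional set is enclosed in a Borel null set \<open>N\<close>; then
  \<open>UNIV \<times> N\<close> is a measurable rectangle of product measure zero.\<close>

lemma AE_lebesgue_snd:
  assumes "AE t in lebesgue. P t"
  shows "AE z in lebesgue. P (snd (z :: 'a::euclidean_space \<times> real))"
proof -
  have "AE t in (lborel :: real measure). P t" using assms by (simp add: AE_completion_iff)
  then obtain N where N: "{t. \<not> P t} \<subseteq> N" "N \<in> null_sets (lborel :: real measure)"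
    by (auto elim!: AE_E simp: null_sets_def)
  have "(UNIV :: 'a set) \<times> N \<in> null_sets (lborel \<Otimes>\<^sub>M lborel)"
    using N(2) by (auto simp: null_sets_def lborel.emeasure_pair_measure_Times intro!: pair_measureI)
  then have "(UNIV :: 'a set) \<times> N \<in> null_sets lborel" by (simp add: lborel_prod)
  then have "AE z in (lborel :: ('a \<times> real) measure). P (snd z)"
    by (rule AE_I') (use N(1) in auto)
  then show ?thesis by (simp add: AE_completion_iff)
qed

lemma AE_lebesgue_sections:
  assumes "AE (t, v) in (lebesgue :: (real \<times> real) measure). P t v"
  shows "AE t in lebesgue. AE v in lebesgue. P t v"
proof -
  have "AE x in lborel \<Otimes>\<^sub>M lborel. case x of (t, v) \<Rightarrow> P t v"
    unfolding lborel_prod using assms by (simp add: AE_completion_iff)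
  from lborel_pair.AE_pair[OF this] show ?thesis by (simp add: AE_completion_iff)
qed

text \<open>An open null set is empty. Hypotheses (ii) and (iii) hold for almost every pair, but
  they are evaluated at \<open>v = q y\<close>, so for almost every \<open>t\<close> they are needed
  at every \<open>v\<close>; continuity in \<open>v\<close> provides this.\<close>

lemma AE_nonneg_imp_nonneg:
  fixes g :: "real \<Rightarrow> real"
  assumes ae: "AE v in lebesgue. v \<in> {0..\<delta>} \<longrightarrow> 0 \<le> g v" and g: "continuous_on {0..\<delta>} g"
    and v: "v \<in> {0..\<delta>}" and \<delta>: "0 < \<delta>"
  shows "0 \<le> g v"
proof -
  let ?S = "{v \<in> {0<..<\<delta>}. g v < 0}"
  have "continuous_on {0<..<\<delta>} g"
    by (rule continuous_on_subset[OF g]) auto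
  then obtain A where "open A" "A \<inter> {0<..<\<delta>} = ?S"
    using open_Collect_less_Int[of "{0<..<\<delta>}" g "\<lambda>_. 0"] by auto
  then have "open ?S" by (metis open_Int open_greaterThanLessThan)
  moreover have "?S \<in> null_sets lebesgue"
  proof -
    have "AE v in lebesgue. v \<notin> ?S" using ae by eventually_elim auto
    moreover have "?S \<in> sets lebesgue" using \<open>open ?S\<close> by (simp add: borel_open sets_completionI_sets)
    ultimately show ?thesis by (simp only: AE_iff_null_sets)
  qed
  then have "negligible ?S" by (simp add: negligible_iff_null_sets)
  ultimately have "?S = {}" using open_not_negligible by blast
  then have "0 \<le> g w" if "w \<in> {0<..<\<delta>}" for w
    by (rule contrapos_pp) (use that in auto)
  then show ?thesis
    using continuous_ge_on_closure[of "{0<..<\<delta>}" g v 0] g v \<delta> by simp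
qed

lemma ess_inf_posD:
  assumes "ess_inf g > 0" shows "\<exists>c>0. AE t in lebesgue. c \<le> g t"
proof -
  let ?E = "esssup lebesgue (\<lambda>t. - ereal (g t))"
  have "0 < - ?E" using assms by (simp add: ess_inf_def)
  then obtain c where c: "0 < ereal c" "ereal c < - ?E" using ereal_dense2 by blast
  have "AE t in lebesgue. - ereal (g t) \<le> ?E" by (rule esssup_AE)
  then have "AE t in lebesgue. c \<le> g t"
  proof eventually_elim
    case (elim t)
    then have "- ?E \<le> ereal (g t)" by (simp add: ereal_uminus_le_reorder)
    then have "ereal c < ereal (g t)" using c(2) by (rule less_le_trans[rotated])
    then show ?case by simp
  qed
  then show ?thesis using c(1) by auto
qed

text \<open>The null set behind \<open>ess_inf > 0\<close> depends on \<open>v\<close>, so finitely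
  many centres are selected by compactness: within the radius \<open>c v / (2 * (L + 1))\<close> a
  function with Lipschitz constant \<open>L\<close> loses at most half of its bound
  \<open>c v\<close>.\<close>

lemma AE_pos_on_interval:
  fixes f :: "real \<Rightarrow> real \<Rightarrow> real"
  assumes lip: "\<And>t. L-lipschitz_on {0..1} (f t)" and pos: "\<And>v. v \<in> {0<..<1} \<Longrightarrow> ess_inf (\<lambda>t. f t v) > 0"
    and s: "0 < s1" "s0 < 1"
  shows "\<exists>k>0. AE t in lebesgue. \<forall>v\<in>{s1..s0}. k \<le> f t v"
proof -
  have "\<forall>v\<in>{s1..s0}. \<exists>c>0. AE t in lebesgue. c \<le> f t v"
    using ess_inf_posD pos s by force
  then obtain c where c: "\<And>v. v \<in> {s1..s0} \<Longrightarrow> 0 < c v" "\<And>v. v \<in> {s1..s0} \<Longrightarrow> AE t in lebesgue. c v \<le> f t v"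
    by metis
  have L: "0 \<le> L" using lipschitz_on_nonneg[OF lip] .
  define d where "d v = c v / (2 * (L + 1))" for v
  have "compact {s1..s0}" by simp
  moreover have "{s1..s0} \<subseteq> (\<Union>v\<in>{s1..s0}. ball v (d v))"
    using c(1) L by (force simp: d_def)
  ultimately obtain V where V: "V \<subseteq> {s1..s0}" "finite V" "{s1..s0} \<subseteq> (\<Union>v\<in>V. ball v (d v))"
    by (elim compactE_image[where C="{s1..s0}" and f="\<lambda>v. ball v (d v)"]) auto
  \<comment> \<open>The inserted 1 keeps the minimum over a nonempty set: \<open>V\<close> is empty
    when \<open>s0 < s1\<close>.\<close>
  define k where "k = Min (insert 1 ((\<lambda>v. c v / 2) ` V))"
  have "0 < k" using V c(1) by (auto simp: k_def)
  moreover have "k \<le> c v / 2" if "v \<in> V" for v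
    unfolding k_def using V(2) that by (intro Min_le) auto
  ultimately have k: "0 < k" "\<And>v. v \<in> V \<Longrightarrow> k \<le> c v / 2" by auto
  have "AE t in lebesgue. \<forall>v\<in>V. c v \<le> f t v"
    using V c(2) by (auto intro!: AE_finite_allI)
  then have "AE t in lebesgue. \<forall>v\<in>{s1..s0}. k \<le> f t v"
  proof eventually_elim
    case (elim t)
    show ?case
    proof
      fix v assume v: "v \<in> {s1..s0}"
      then obtain w where w: "w \<in> V" "dist w v < d w" using V(3) by auto
      have "\<bar>f t v - f t w\<bar> \<le> L * \<bar>v - w\<bar>"
        using lipschitz_onD[OF lip[of t], of v w] v w(1) V(1) s by (auto simp: dist_real_def subset_iff)
      also have "\<dots> \<le> (L + 1) * d w"
        using w(2) L by (intro mult_mono) (auto simp: dist_real_def)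
      also have "\<dots> = c w / 2"
      proof -
        have "d w * (2 * (L + 1)) = c w" using L by (simp add: d_def)
        then show ?thesis by (simp add: algebra_simps)
      qed
      finally have "\<bar>f t v - f t w\<bar> \<le> c w / 2" .
      moreover have "c w \<le> f t w" using elim w(1) by blast
      ultimately show "k \<le> f t v" using k(2)[OF w(1)] by linarith
    qed
  qed
  then show ?thesis using k(1) by blast
qed

text \<open>The derivative at 0 is the limit of the difference quotients at 1/(n+1), from which it
  inherits measurability in \<open>t\<close> and the Lipschitz bound.\<close>

lemma deriv_u_0:
  fixes f :: "real \<Rightarrow> real \<Rightarrow> real"
  assumes f_Linfty: "\<And>v. v \<in> {0..1} \<Longrightarrow> Linfty (\<lambda>t. f t v)"
    and lip: "\<And>t. L-lipschitz_on {0..1} (f t)" and f_C1: "C1_near_0_uniformly f"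
  shows "(\<lambda>t. deriv_u f t 0) \<in> borel_measurable lebesgue" "\<bar>deriv_u f t 0\<bar> \<le> L"
proof -
  let ?v = "\<lambda>n. 1 / real (Suc n)"
  let ?Q = "\<lambda>n t. (f t (?v n) - f t 0) / (?v n - 0)"
  have lim: "(\<lambda>n. ?Q n t) \<longlonglongrightarrow> deriv_u f t 0" for t
  proof -
    have "f t differentiable (at 0 within {0..1})"
      using f_C1 unfolding C1_near_0_uniformly_def by force
    then have "(f t has_real_derivative deriv_u f t 0) (at 0 within {0..1})"
      unfolding deriv_u_def has_real_derivative_iff_has_vector_derivative
      by (simp add: vector_derivative_works)
    then have "((\<lambda>y. (f t y - f t 0) / (y - 0)) \<longlongrightarrow> deriv_u f t 0) (at 0 within {0..1})"
      by (simp add: has_field_derivative_iff)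
    moreover have "filterlim ?v (at 0 within {0..1}) sequentially"
      unfolding filterlim_at using LIMSEQ_inverse_real_of_nat by (simp add: inverse_eq_divide)
    ultimately show ?thesis by (rule filterlim_compose)
  qed
  have v: "?v n \<in> {0..1}" for n by simp
  have "(\<lambda>t. f t 0) \<in> borel_measurable lebesgue" "(\<lambda>t. f t (?v n)) \<in> borel_measurable lebesgue" for n
    using f_Linfty[of 0] f_Linfty[OF v] by (auto simp: Linfty_def)
  then have "(\<lambda>t. ?Q n t) \<in> borel_measurable lebesgue" for n by (intro borel_measurable_divide borel_measurable_diff) auto
  then show "(\<lambda>t. deriv_u f t 0) \<in> borel_measurable lebesgue"
    by (rule borel_measurable_LIMSEQ_real[OF lim])
  show "\<bar>deriv_u f t 0\<bar> \<le> L"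
  proof (rule LIMSEQ_le_const2[OF tendsto_rabs[OF lim]], intro exI allI impI)
    fix n :: nat
    have "\<bar>f t (?v n) - f t 0\<bar> \<le> L * ?v n"
      using lipschitz_onD[OF lip[of t] v, of 0 n] by (simp add: dist_real_def)
    then have "\<bar>f t (?v n) - f t 0\<bar> / ?v n \<le> L" by (subst pos_divide_le_eq) auto
    moreover have "\<bar>?Q n t\<bar> = \<bar>f t (?v n) - f t 0\<bar> / ?v n"
      unfolding abs_divide by simp
    ultimately show "\<bar>?Q n t\<bar> \<le> L" by linarith
  qed
qed

text \<open>Countably many compact intervals exhaust (0,1); at the endpoints, which no such interval
  reaches, \<open>f\<close> vanishes.\<close>

lemma AE_nonneg_on_unit:
  fixes f :: "real \<Rightarrow> real \<Rightarrow> real"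
  assumes lip: "\<And>t. L-lipschitz_on {0..1} (f t)" and pos: "\<And>v. v \<in> {0<..<1} \<Longrightarrow> ess_inf (\<lambda>t. f t v) > 0"
    and zeros: "AE t in lebesgue. f t 0 = 0 \<and> f t 1 = 0"
  shows "AE t in lebesgue. \<forall>v\<in>{0..1}. 0 \<le> f t v"
proof -
  have "AE t in lebesgue. \<forall>v\<in>{1 / real (Suc (Suc n)) .. 1 - 1 / real (Suc (Suc n))}. 0 \<le> f t v" for n
  proof -
    have "1 - 1 / real (Suc (Suc n)) < 1" "0 < 1 / real (Suc (Suc n))" by auto
    from AE_pos_on_interval[of L f, OF lip _ this(2,1)] pos
    obtain k where k: "0 < k" "AE t in lebesgue. \<forall>v\<in>{1 / real (Suc (Suc n)) .. 1 - 1 / real (Suc (Suc n))}. k \<le> f t v"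
      by blast
    from k(2) show ?thesis
    proof eventually_elim
      case (elim t)
      then show ?case using k(1) by (meson less_imp_le order_trans)
    qed
  qed
  then have "AE t in lebesgue. \<forall>n. \<forall>v\<in>{1 / real (Suc (Suc n)) .. 1 - 1 / real (Suc (Suc n))}. 0 \<le> f t v"
    by (simp only: AE_all_countable) blast
  with zeros show ?thesis
  proof eventually_elim
    case (elim t)
    show ?case
    proof
      fix v :: real assume v: "v \<in> {0..1}"
      show "0 \<le> f t v"
      proof (cases "v = 0 \<or> v = 1")
        case False
        then have "0 < min v (1 - v)" using v by auto
        then obtain n where n: "1 / real (Suc n) < min v (1 - v)"
          using reals_Archimedean[of "min v (1 - v)"] by (auto simp: inverse_eq_divide)
        have "1 / real (Suc (Suc n)) \<le> 1 / real (Suc n)" by (intro divide_left_mono) auto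
        then have "v \<in> {1 / real (Suc (Suc n)) .. 1 - 1 / real (Suc (Suc n))}" using n by auto
        then show ?thesis using elim by blast
      qed (use elim in auto)
    qed
  qed
qed

text \<open>Collects what the barriers use. Since \<open>h\<close> is built from the weak
  derivatives, its integrability against kernels is automatic, and \<open>f\<close> survives only in
  one-sided linear bounds on \<open>h\<close>.\<close>

lemma kpp_setup:
  fixes f :: "real \<Rightarrow> real \<Rightarrow> real" and u0 :: "real ^ 'n \<Rightarrow> real" and u :: "(real ^ 'n) \<times> real \<Rightarrow> real"
  assumes f_Linfty: "\<And>v. v \<in> {0..1} \<Longrightarrow> Linfty (\<lambda>t. f t v)"
    and f_Lipschitz: "\<exists>L. \<forall>t. L-lipschitz_on {0..1} (f t)"
    and f_C1: "C1_near_0_uniformly f"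
    and mu: "\<And>t. \<mu> t = deriv_u f t 0"
    and f_zeros: "AE t in lebesgue. f t 0 = 0 \<and> f t 1 = 0"
    and f_pos: "\<And>v. v \<in> {0<..<1} \<Longrightarrow> ess_inf (\<lambda>t. f t v) > 0"
    and f_KPP: "AE (t, v) in lebesgue. v \<in> {0..1} \<longrightarrow> f t v \<le> \<mu> t * v"
    and f_lower: "\<exists>C>0. \<exists>\<nu>\<in>{0<..1}. \<exists>\<delta>\<in>{0<..1}.
          AE (t, v) in lebesgue. v \<in> {0..\<delta>} \<longrightarrow> f t v \<ge> \<mu> t * v - C * v powr (1 + \<nu>)"
    and u_solution: "strong_solution f u0 u"
  obtains q h \<mu>' L where
    "continuous_on UNIV q" "weak_heat q h" "\<And>x t. 0 \<le> t \<Longrightarrow> q (x, t) = u (x, t)" "\<And>z. 0 \<le> q z \<and> q z \<le> 1"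
    "\<mu>' \<in> borel_measurable borel" "\<And>s. \<bar>\<mu>' s\<bar> \<le> L" "\<mu> \<in> borel_measurable lebesgue" "AE t in lebesgue. \<mu>' t = \<mu> t"
    "AE y in lebesgue. 0 < snd y \<longrightarrow> h y \<le> \<mu>' (snd y) * q y"
    "AE y in lebesgue. 0 < snd y \<longrightarrow> 0 \<le> h y"
    "\<And>\<zeta>. 0 < \<zeta> \<Longrightarrow> \<exists>s0>0. AE y in lebesgue. 0 < snd y \<and> q y \<le> s0 \<longrightarrow> (\<mu>' (snd y) - \<zeta>) * q y \<le> h y"
    "\<And>s1 s0. 0 < s1 \<Longrightarrow> s0 < 1 \<Longrightarrow>
      \<exists>k>0. AE y in lebesgue. 0 < snd y \<and> s1 \<le> q y \<and> q y \<le> s0 \<longrightarrow> k * q y \<le> h y"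
    "\<exists>c>0. AE t in lebesgue. c \<le> \<mu>' t"
proof -
  obtain L where lip: "\<And>t. L-lipschitz_on {0..1} (f t)" using f_Lipschitz by blast
  have L: "0 \<le> L" using lipschitz_on_nonneg[OF lip] .
  have cont: "continuous_on {0..1} (f t)" for t by (rule lipschitz_on_continuous_on[OF lip])
  have \<mu>m: "\<mu> \<in> borel_measurable lebesgue" and \<mu>b: "\<bar>\<mu> t\<bar> \<le> L" for t
    using deriv_u_0[OF f_Linfty lip f_C1] by (simp_all add: mu[abs_def] mu)
  obtain \<mu>0 where \<mu>0: "\<mu>0 \<in> borel_measurable (lborel :: real measure)" "AE t in lborel. \<mu> t = \<mu>0 t"
    using completion_ex_borel_measurable_real[OF \<mu>m] by blast
  \<comment> \<open>Truncating a Borel version at the bound of \<mu> turns an almost everywhere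
    bound into an everywhere one and changes the function on a null set only.\<close>
  define \<mu>' where "\<mu>' t = max (- L) (min L (\<mu>0 t))" for t
  have m': "\<mu>' \<in> borel_measurable borel" using \<mu>0(1) unfolding \<mu>'_def by simp
  have b': "\<bar>\<mu>' t\<bar> \<le> L" for t using L by (auto simp: \<mu>'_def)
  have e': "AE t in lebesgue. \<mu>' t = \<mu> t"
    unfolding AE_completion_iff using \<mu>0(2)
  proof eventually_elim
    case (elim t)
    then show ?case using \<mu>b[of t] by (auto simp: \<mu>'_def)
  qed
  have kpp: "AE t in lebesgue. \<forall>v\<in>{0..1}. f t v \<le> \<mu> t * v"
    using AE_lebesgue_sections[OF f_KPP]
  proof eventually_elim
    case (elim t)
    have "0 \<le> \<mu> t * v - f t v" if "v \<in> {0..1}" for v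
      by (rule AE_nonneg_imp_nonneg[OF _ _ that]) (use elim in \<open>auto intro!: continuous_intros cont\<close>)
    then show ?case by force
  qed
  obtain C \<nu> \<delta> where C: "0 < C" "\<nu> \<in> {0<..1}" "\<delta> \<in> {0<..1}"
    and low: "AE (t, v) in lebesgue. v \<in> {0..\<delta>} \<longrightarrow> f t v \<ge> \<mu> t * v - C * v powr (1 + \<nu>)"
    using f_lower by blast
  have low: "AE t in lebesgue. \<forall>v\<in>{0..\<delta>}. f t v \<ge> \<mu> t * v - C * v powr (1 + \<nu>)"
    using AE_lebesgue_sections[OF low]
  proof eventually_elim
    case (elim t)
    have "0 \<le> f t v - (\<mu> t * v - C * v powr (1 + \<nu>))" if "v \<in> {0..\<delta>}" for v
    proof (rule AE_nonneg_imp_nonneg[OF _ _ that])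
      show "continuous_on {0..\<delta>} (\<lambda>v. f t v - (\<mu> t * v - C * v powr (1 + \<nu>)))"
        using C by (intro continuous_intros continuous_on_subset[OF cont] continuous_on_powr') auto
      show "AE v in lebesgue. v \<in> {0..\<delta>} \<longrightarrow> 0 \<le> f t v - (\<mu> t * v - C * v powr (1 + \<nu>))"
        using elim by eventually_elim auto
    qed (use C in auto)
    then show ?case by force
  qed
  \<comment> \<open>Extension to negative times by the initial value, so that convolution over the
    whole space has a continuous integrand.\<close>
  define q where "q z = u (fst z, max (snd z) 0)" for z
  have uc: "continuous_on (UNIV \<times> {0..}) u" and ur: "\<And>x t. 0 \<le> t \<Longrightarrow> u (x, t) \<in> {0..1}"
    using u_solution by (auto simp: strong_solution_def)
  have qc: "continuous_on UNIV q"
    unfolding q_def by (rule continuous_on_compose2[OF uc]) (auto intro!: continuous_intros)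
  have qu: "q (x, t) = u (x, t)" if "0 \<le> t" for x t using that by (simp add: q_def)
  have qr: "0 \<le> q z \<and> q z \<le> 1" for z using ur[of "max (snd z) 0" "fst z"] by (simp add: q_def)
  obtain Dx Dxx Dt where W: "W21_loc_derivs (real CARD('n) + 1) (UNIV \<times> {0<..}) u Dx Dxx Dt"
    and eq: "AE z in lebesgue. snd z > 0 \<longrightarrow> Dt z - (\<Sum>i\<in>UNIV. Dxx i i z) = f (snd z) (u z)"
    using u_solution by (auto simp: strong_solution_def)
  define h where "h z = Dt z - (\<Sum>i\<in>UNIV. Dxx i i z)" for z
  have wh: "weak_heat q h" unfolding h_def by (rule W21_weak_heat[OF W qc]) (simp add: qu)
  have h: "AE z in lebesgue. snd z > 0 \<longrightarrow> h z = f (snd z) (q z)"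
    using eq by eventually_elim (auto simp: h_def q_def)
  show ?thesis
  proof
    show "continuous_on UNIV q" "weak_heat q h" "\<And>x t. 0 \<le> t \<Longrightarrow> q (x, t) = u (x, t)"
      "\<And>z. 0 \<le> q z \<and> q z \<le> 1" "\<mu>' \<in> borel_measurable borel" "\<And>s. \<bar>\<mu>' s\<bar> \<le> L"
      "\<mu> \<in> borel_measurable lebesgue" "AE t in lebesgue. \<mu>' t = \<mu> t"
      by fact+
  next
    show "AE y in lebesgue. 0 < snd y \<longrightarrow> h y \<le> \<mu>' (snd y) * q y"
      using h AE_lebesgue_snd[OF kpp] AE_lebesgue_snd[OF e'] by eventually_elim (use qr in auto)
  next
    have "AE t in lebesgue. \<forall>v\<in>{0..1}. 0 \<le> f t v"
      by (rule AE_nonneg_on_unit[OF lip _ f_zeros]) (rule f_pos)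
    from h AE_lebesgue_snd[OF this] show "AE y in lebesgue. 0 < snd y \<longrightarrow> 0 \<le> h y"
      by eventually_elim (use qr in auto)
  next
    fix \<zeta> :: real assume \<zeta>: "0 < \<zeta>"
    \<comment> \<open>The second entry solves \<open>C * v powr \<nu> = \<zeta>\<close> for
      \<open>v\<close>; \<delta> is the range of hypothesis (iii).\<close>
    define s0 where "s0 = min \<delta> ((\<zeta> / C) powr (1 / \<nu>))"
    have s0: "0 < s0" "s0 \<le> \<delta>" using C \<zeta> by (auto simp: s0_def)
    have small: "C * v powr (1 + \<nu>) \<le> \<zeta> * v" if v: "0 \<le> v" "v \<le> s0" for v
    proof (cases "v = 0")
      case False
      have "v powr \<nu> \<le> ((\<zeta> / C) powr (1 / \<nu>)) powr \<nu>"
        using v C by (intro powr_mono2) (auto simp: s0_def)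
      also have "\<dots> = \<zeta> / C" using C \<zeta> by (simp add: powr_powr)
      finally have "C * v powr \<nu> \<le> \<zeta>" using C by (simp add: field_simps)
      then have "v * (C * v powr \<nu>) \<le> v * \<zeta>" using v by (intro mult_left_mono) auto
      then show ?thesis using False v by (simp add: powr_add mult_ac)
    qed simp
    have "AE y in lebesgue. 0 < snd y \<and> q y \<le> s0 \<longrightarrow> (\<mu>' (snd y) - \<zeta>) * q y \<le> h y"
      using h AE_lebesgue_snd[OF low] AE_lebesgue_snd[OF e']
    proof eventually_elim
      case (elim y)
      show ?case
      proof
        assume y: "0 < snd y \<and> q y \<le> s0"
        then have "\<mu> (snd y) * q y - C * q y powr (1 + \<nu>) \<le> f (snd y) (q y)"
          using elim qr[of y] s0(2) by auto
        then show "(\<mu>' (snd y) - \<zeta>) * q y \<le> h y"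
          using elim y small[of "q y"] qr[of y] by (simp add: left_diff_distrib)
      qed
    qed
    then show "\<exists>s0>0. AE y in lebesgue. 0 < snd y \<and> q y \<le> s0 \<longrightarrow> (\<mu>' (snd y) - \<zeta>) * q y \<le> h y"
      using s0(1) by blast
  next
    fix s1 s0 :: real assume s: "0 < s1" "s0 < 1"
    obtain k where k: "0 < k" "AE t in lebesgue. \<forall>v\<in>{s1..s0}. k \<le> f t v"
      using AE_pos_on_interval[of L f, OF lip _ s] f_pos by blast
    have "AE y in lebesgue. 0 < snd y \<and> s1 \<le> q y \<and> q y \<le> s0 \<longrightarrow> k * q y \<le> h y"
      using h AE_lebesgue_snd[OF k(2)]
    proof eventually_elim
      case (elim y)
      show ?case
      proof
        assume y: "0 < snd y \<and> s1 \<le> q y \<and> q y \<le> s0"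
        \<comment> \<open>As \<open>q \<le> 1\<close>, the positive lower bound for \<open>f\<close>
          implies one that is linear in \<open>q\<close>, the form that the comparison
          requires.\<close>
        have "k * q y \<le> k * 1" using k(1) qr[of y] by (intro mult_left_mono) auto
        also have "\<dots> \<le> h y" using elim y by auto
        finally show "k * q y \<le> h y" .
      qed
    qed
    then show "\<exists>k>0. AE y in lebesgue. 0 < snd y \<and> s1 \<le> q y \<and> q y \<le> s0 \<longrightarrow> k * q y \<le> h y"
      using k(1) by blast
  next
    \<comment> \<open>By the KPP bound, f(t,1/2) is at most \<mu>(t)/2, so \<mu> inherits a positive
      essential lower bound.\<close>
    have "ess_inf (\<lambda>t. f t (1/2)) > 0" by (rule f_pos) simp
    then obtain c where c: "0 < c" "AE t in lebesgue. c \<le> f t (1/2)" using ess_inf_posD by blast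
    from c(2) kpp e' have "AE t in lebesgue. 2 * c \<le> \<mu>' t"
    proof eventually_elim
      case (elim t)
      have "f t (1/2) \<le> \<mu> t * (1/2)" using elim(2) by (rule bspec) simp
      then show ?case using elim by simp
    qed
    then show "\<exists>c>0. AE t in lebesgue. c \<le> \<mu>' t" using c(1) by (intro exI[of _ "2 * c"]) auto
  qed
qed

section \<open>Barriers\<close>

lemma prim_const: "0 \<le> t \<Longrightarrow> prim (\<lambda>_. k) t = k * t"
  by (simp add: prim_def set_lebesgue_integral_def)

lemma prim_shift:
  assumes a: "a \<in> borel_measurable borel" "\<And>s. \<bar>a s\<bar> \<le> L" and t: "0 \<le> t"
  shows "prim (\<lambda>s. a s - \<zeta>) t = prim a t - \<zeta> * t"
proof -
  have "set_integrable lborel {0..t} a" "set_integrable lborel {0..t} (\<lambda>_. \<zeta>)"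
    by (rule bounded_set_integrable[OF a], simp, simp add: t)
       (rule bounded_set_integrable[of _ "\<bar>\<zeta>\<bar>"], auto simp: t)
  then show ?thesis using prim_const[OF t, of \<zeta>] by (simp add: prim_def set_integral_diff)
qed

lemma prim_ge:
  assumes a: "a \<in> borel_measurable borel" "\<And>s. \<bar>a s\<bar> \<le> L" and t: "0 \<le> t"
    and c: "AE s in lebesgue. c \<le> a s"
  shows "c * t \<le> prim a t"
proof -
  have "c * t = (LINT s:{0..t}|lborel. c)" using prim_const[OF t, of c] by (simp add: prim_def)
  also have "\<dots> \<le> prim a t"
    unfolding prim_def set_lebesgue_integral_def
  proof (rule integral_mono_AE)
    show "integrable lborel (\<lambda>s. indicator {0..t} s *\<^sub>R c)"
      using bounded_set_integrable[of "\<lambda>_. c" "\<bar>c\<bar>" "{0..t}"] t by (simp add: set_integrable_def)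
    show "integrable lborel (\<lambda>s. indicator {0..t} s *\<^sub>R a s)"
      using bounded_set_integrable[OF a, of "{0..t}"] t by (simp add: set_integrable_def)
    show "AE s in lborel. indicator {0..t} s *\<^sub>R c \<le> indicator {0..t} s *\<^sub>R a s"
      using c unfolding AE_completion_iff by eventually_elim (auto simp: indicator_def)
  qed
  finally show ?thesis .
qed

lemma norm_vec_sq: "(\<Sum>i\<in>UNIV. (x $ i)\<^sup>2) = (norm (x :: real^'n))\<^sup>2"
  by (simp add: norm_vec_def L2_set_def sum_nonneg)

text \<open>The plane wave solves the equation linearised at 0 and is at least 1 on the ball of
  radius \<open>R\<close> at time 0. The correction \<open>\<eta> * Q\<close>, with \<open>Q\<close>
  a positive caloric function of quadratic growth, confines the comparison to a bounded cylinder and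
  disappears as \<eta> tends to 0.\<close>

lemma upper_barrier:
  fixes q h :: "(real^'n) \<times> real \<Rightarrow> real"
  assumes q: "continuous_on UNIV q" and wh: "weak_heat q h" and qr: "\<And>z. 0 \<le> q z \<and> q z \<le> 1"
    and a: "a \<in> borel_measurable borel" "\<And>s. \<bar>a s\<bar> \<le> L"
    and h: "AE y in lebesgue. 0 < snd y \<longrightarrow> h y \<le> a (snd y) * q y"
    and supp: "\<And>x. R < norm x \<Longrightarrow> q (x, 0) = 0" and e: "norm e = 1" and l: "0 \<le> l" and t1: "0 < t1"
  shows "q (x1, t1) \<le> exp (prim a t1) * exp (l\<^sup>2 * t1 - l * (e \<bullet> x1) + l * R)"
proof -
  have L: "0 \<le> L" using a(2)[of 0] by simp
  define E where "E x t = exp (l\<^sup>2 * t - l * (e \<bullet> x) + l * R)" for x :: "real^'n" and t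
  define Q where "Q x t = 1 + x \<bullet> x + 2 * real CARD('n) * t" for x :: "real^'n" and t
  have main: "q (x1, t1) \<le> exp (prim a t1) * (E x1 t1 + \<eta> * Q x1 t1)" if \<eta>: "0 < \<eta>" for \<eta>
  proof -
    define \<psi> where "\<psi> z = - (E (fst z) (snd z) + \<eta> * Q (fst z) (snd z))" for z :: "(real^'n) \<times> real"
    define \<psi>t where "\<psi>t z = - (l\<^sup>2 * E (fst z) (snd z) + \<eta> * (2 * real CARD('n)))" for z :: "(real^'n) \<times> real"
    define \<psi>x where "\<psi>x i z = - (- l * e $ i * E (fst z) (snd z) + \<eta> * (2 * fst z $ i))" for i and z :: "(real^'n) \<times> real"
    define \<psi>xx where "\<psi>xx i z = - (l\<^sup>2 * (e $ i)\<^sup>2 * E (fst z) (snd z) + \<eta> * 2)" for i and z :: "(real^'n) \<times> real"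
    have Ec: "continuous_on S (\<lambda>z. E (fst z) (snd z))" and Qc: "continuous_on S (\<lambda>z. Q (fst z) (snd z))" for S
      unfolding E_def Q_def by (intro continuous_intros)+
    \<comment> \<open>For \<open>norm x = \<rho>\<close> the term \<open>\<eta> * Q\<close> exceeds
      \<open>exp (L * t1)\<close>, which compensates
      \<open>exp (prim a t) \<ge> exp (- (L * t1))\<close>: the barrier is at least 1 there, hence
      above \<open>q\<close>.\<close>
    define \<rho> where "\<rho> = norm x1 + 1 + exp (L * t1) / \<eta>"
    have \<rho>: "norm x1 < \<rho>" "1 \<le> \<rho>" "exp (L * t1) < \<eta> * (1 + \<rho>\<^sup>2)"
    proof -
      have "0 < exp (L * t1) / \<eta>" using \<eta> by simp
      then show "norm x1 < \<rho>" and 1: "1 \<le> \<rho>" unfolding \<rho>_def using norm_ge_zero[of x1] by linarith+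
      have "exp (L * t1) / \<eta> \<le> \<rho>" using norm_ge_zero[of x1] unfolding \<rho>_def by linarith
      also have "\<rho> \<le> \<rho>\<^sup>2" using 1 by (simp add: power2_eq_square)
      also have "\<dots> < 1 + \<rho>\<^sup>2" by simp
      finally show "exp (L * t1) < \<eta> * (1 + \<rho>\<^sup>2)" using \<eta> by (simp add: divide_less_eq mult.commute)
    qed
    have primb: "\<bar>prim a t\<bar> \<le> L * t1" if "0 \<le> t" "t \<le> t1" for t
      using prim_lipschitz[OF a, of t 0] mult_left_mono[OF that(2) L] that by (simp add: prim_0)
    define \<Delta> where "\<Delta> z = exp (prim a (snd z)) * - \<psi> z - q z" for z
    have "uniformly_continuous_on (cball 0 \<rho> \<times> {0..1}) \<Delta>"
      unfolding \<Delta>_def \<psi>_def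
      by (intro compact_uniformly_continuous compact_Times continuous_intros Ec Qc
          continuous_on_compose2[OF prim_continuous[OF a, of UNIV]] continuous_on_subset[OF q]) auto
    then obtain d where d: "0 < d" "\<And>z z'. z \<in> cball 0 \<rho> \<times> {0..1} \<Longrightarrow> z' \<in> cball 0 \<rho> \<times> {0..1} \<Longrightarrow> dist z' z < d \<Longrightarrow> dist (\<Delta> z') (\<Delta> z) < \<eta>"
      unfolding uniformly_continuous_on_def using \<eta> by metis
    \<comment> \<open>The comparison cannot start at time 0. There the barrier exceeds
      \<open>q\<close> by at least \<eta>, and uniform continuity keeps it above \<open>q\<close> at
      time \<tau>.\<close>
    define \<tau> where "\<tau> = min (min (d / 2) 1) t1"
    have \<tau>: "0 < \<tau>" "\<tau> < d" "\<tau> \<le> 1" "\<tau> \<le> t1" using d(1) t1 by (auto simp: \<tau>_def)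
    have init0: "\<eta> \<le> \<Delta> (x, 0)" for x
    proof -
      have "q (x, 0) \<le> E x 0"
      proof (cases "R < norm x")
        case True then show ?thesis using supp by (simp add: E_def)
      next
        case False
        have "e \<bullet> x \<le> norm e * norm x" by (rule norm_cauchy_schwarz)
        then have "l * (e \<bullet> x) \<le> l * R" using False e l by (intro mult_left_mono) auto
        then have "1 \<le> E x 0" by (simp add: E_def)
        then show ?thesis using qr[of "(x, 0)"] by linarith
      qed
      moreover have "\<eta> * 1 \<le> \<eta> * Q x 0" using \<eta> by (intro mult_left_mono) (auto simp: Q_def)
      ultimately show ?thesis by (simp add: \<Delta>_def \<psi>_def prim_0)
    qed
    have init: "0 \<le> \<Delta> (x, \<tau>)" if "norm x \<le> \<rho>" for x
    proof -
      have "dist (\<Delta> (x, \<tau>)) (\<Delta> (x, 0)) < \<eta>"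
        by (rule d(2)) (use that \<tau> in \<open>auto simp: dist_Pair_Pair\<close>)
      then show ?thesis using init0[of x] by (simp add: dist_real_def)
    qed
    define D where "D = cball (0::real^'n) \<rho> \<times> {\<tau>..t1}"
    \<comment> \<open>The comparison is formulated for barriers from below, so it is applied to
      \<open>- q\<close> and the negated barrier; both lie below the level 0.\<close>
    have "exp (prim a (snd (x1, t1))) * \<psi> (x1, t1) \<le> - q (x1, t1)"
    proof (rule comparison[where q="\<lambda>z. - q z" and h="\<lambda>z. - h z" and D=D and N="UNIV \<times> {0<..}" and \<psi>=\<psi> and ?s0.0=0
            and \<psi>x=\<psi>x and \<psi>xx=\<psi>xx and \<psi>t=\<psi>t, OF _ weak_heat_uminus[OF wh] a])
      show "continuous_on UNIV (\<lambda>z. - q z)" by (intro continuous_intros q)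
      show "compact D" unfolding D_def by (intro compact_Times) auto
      show "open (UNIV \<times> {0<..} :: ((real^'n) \<times> real) set)" by (intro open_Times) auto
      show "D \<subseteq> UNIV \<times> {0<..}" using \<tau> by (auto simp: D_def)
      show "0 < \<tau>" by fact
      show "\<tau> \<le> snd z" if "z \<in> D" for z using that by (auto simp: D_def)
      show "continuous_on D \<psi>" unfolding \<psi>_def by (intro continuous_intros Ec Qc)
      show "((\<lambda>s. \<psi> (x, s)) has_real_derivative \<psi>t (x, t)) (at t)" for x t
        unfolding \<psi>_def \<psi>t_def E_def Q_def fst_conv snd_conv
        by (auto intro!: derivative_eq_intros)
      show "((\<lambda>s. \<psi> (x + s *\<^sub>R axis i 1, t)) has_real_derivative \<psi>x i (x + s *\<^sub>R axis i 1, t)) (at s)" for i x t s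
        unfolding \<psi>_def \<psi>x_def E_def Q_def fst_conv snd_conv
        by (auto intro!: derivative_eq_intros simp: inner_simps inner_axis inner_axis' algebra_simps)
      show "((\<lambda>s. \<psi>x i (x + s *\<^sub>R axis i 1, t)) has_real_derivative \<psi>xx i (x, t)) (at 0)" for i x t
        unfolding \<psi>xx_def \<psi>x_def E_def Q_def fst_conv snd_conv
        by (auto intro!: derivative_eq_intros simp: inner_simps inner_axis inner_axis' algebra_simps power2_eq_square)
      show "\<psi>t z \<le> (\<Sum>i\<in>UNIV. \<psi>xx i z)" for z
      proof -
        have "(\<Sum>i\<in>UNIV. l\<^sup>2 * (e $ i)\<^sup>2 * E (fst z) (snd z)) = l\<^sup>2 * E (fst z) (snd z) * (\<Sum>i\<in>UNIV. (e $ i)\<^sup>2)"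
          by (simp add: sum_distrib_left mult_ac)
        then show ?thesis using norm_vec_sq[of e] e
          by (simp add: \<psi>t_def \<psi>xx_def sum_negf sum.distrib sum_subtractf algebra_simps)
      qed
      show "exp (prim a (snd z)) * \<psi> z \<le> 0" if "z \<in> D" for z
      proof -
        have "0 \<le> \<eta> * Q (fst z) (snd z)" using \<eta> \<tau> that by (auto simp: Q_def D_def)
        moreover have "0 < E (fst z) (snd z)" by (simp add: E_def)
        ultimately have "\<psi> z \<le> 0" by (simp add: \<psi>_def)
        then show ?thesis by (simp add: mult_le_0_iff)
      qed
      show "AE y in lebesgue. y \<in> UNIV \<times> {0<..} \<and> - q y \<le> 0 \<longrightarrow> a (snd y) * - q y \<le> - h y"
        using h by eventually_elim auto
      show "exp (prim a \<tau>) * \<psi> (x, \<tau>) \<le> - q (x, \<tau>)" if "(x, \<tau>) \<in> D" for x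
        using init[of x] that by (simp add: \<Delta>_def D_def)
      show "\<exists>\<delta>>0. \<forall>x' s. dist x' x < \<delta> \<and> t - \<delta> < s \<and> s \<le> t \<longrightarrow> (x', s) \<in> D"
        if xt: "(x, t) \<in> D" "\<tau> < t" "- q (x, t) < exp (prim a t) * \<psi> (x, t)" for x t
      proof -
        have t: "0 \<le> t" "t \<le> t1" using xt \<tau> by (auto simp: D_def)
        have "norm x < \<rho>"
        proof (rule ccontr)
          assume "\<not> norm x < \<rho>"
          then have "\<rho>\<^sup>2 \<le> (norm x)\<^sup>2" using \<rho> by (intro power_mono) auto
          moreover have "0 \<le> 2 * real CARD('n) * t" using t by simp
          ultimately have "1 + \<rho>\<^sup>2 \<le> Q x t" unfolding Q_def power2_norm_eq_inner by linarith
          then have "\<eta> * (1 + \<rho>\<^sup>2) \<le> \<eta> * Q x t" using \<eta> by (intro mult_left_mono) auto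
          then have "exp (L * t1) \<le> E x t + \<eta> * Q x t" using \<rho>(3) by (simp add: E_def add_increasing)
          then have "exp (- (L * t1)) * exp (L * t1) \<le> exp (prim a t) * (E x t + \<eta> * Q x t)"
            using primb[OF t] by (intro mult_mono) (auto simp: abs_le_iff)
          then have "1 \<le> exp (prim a t) * (E x t + \<eta> * Q x t)" by (simp add: exp_add[symmetric])
          moreover have "exp (prim a t) * \<psi> (x, t) = - (exp (prim a t) * (E x t + \<eta> * Q x t))"
            by (simp only: \<psi>_def fst_conv snd_conv mult_minus_right)
          ultimately show False using xt(3) qr[of "(x, t)"] by linarith
        qed
        moreover have "(x', s) \<in> D" if "dist x' x < \<rho> - norm x" "t - (t - \<tau>) < s" "s \<le> t" for x' s
          using that xt(1) norm_triangle_ineq2[of x' x] by (auto simp: D_def dist_norm)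
        ultimately show ?thesis using xt(2)
          by (intro exI[of _ "min (\<rho> - norm x) (t - \<tau>)"]) auto
      qed
      show "(x1, t1) \<in> D" using \<rho> \<tau> by (auto simp: D_def)
    qed
    then show ?thesis unfolding \<psi>_def fst_conv snd_conv mult_minus_right by linarith
  qed
  show ?thesis
  proof (rule field_le_epsilon)
    fix \<epsilon> :: real assume \<epsilon>: "0 < \<epsilon>"
    have Q: "0 < Q x1 t1" using t1 by (auto simp: Q_def intro!: add_pos_nonneg)
    then have "q (x1, t1) \<le> exp (prim a t1) * (E x1 t1 + \<epsilon> / (exp (prim a t1) * Q x1 t1) * Q x1 t1)"
      by (intro main) (use \<epsilon> in simp)
    also have "\<dots> = exp (prim a t1) * E x1 t1 + \<epsilon>" using Q by (simp add: field_simps)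
    finally show "q (x1, t1) \<le> exp (prim a t1) * exp (l\<^sup>2 * t1 - l * (e \<bullet> x1) + l * R) + \<epsilon>" by (simp add: E_def)
  qed
qed

text \<open>By \<open>gid\<close> the heat operator in the moving frame multiplies \<open>H\<close>
  by \<open>\<bar>c\<bar>\<^sup>2 / 4 + N \<beta>\<^sup>2\<close>, so an amplitude exponent
  \<open>P\<close> that decreases at least at this rate gives a subsolution. \<open>G\<close> bounds
  \<open>H\<close> on the cube, whereas \<open>H = 1\<close> at its centre: hence \<open>G\<close>
  occurs in the hypotheses but not in the conclusion.\<close>

lemma moving_cube:
  fixes q h :: "(real^'n) \<times> real \<Rightarrow> real" and c x0 :: "real^'n"
  assumes q: "continuous_on UNIV q" and wh: "weak_heat q h" and qr: "\<And>z. 0 \<le> q z"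
    and a: "a \<in> borel_measurable borel" "\<And>s. \<bar>a s\<bar> \<le> L"
    and t: "0 < t0" "t0 \<le> t1" and \<beta>: "0 < \<beta>" and \<kappa>: "0 < \<kappa>" and c: "norm c \<le> \<gamma>"
    and P: "\<And>t. t0 \<le> t \<Longrightarrow> t \<le> t1 \<Longrightarrow> (P has_real_derivative P' t) (at t)"
    and P': "\<And>t. t0 \<le> t \<Longrightarrow> t \<le> t1 \<Longrightarrow> P' t + (norm c)\<^sup>2 / 4 + real CARD('n) * \<beta>\<^sup>2 \<le> 0"
    and G: "G = exp (\<gamma> * pi / (4 * \<beta>)) ^ CARD('n)"
    and level: "\<And>t. t0 \<le> t \<Longrightarrow> t \<le> t1 \<Longrightarrow> exp (prim a t + P t) * \<kappa> * G \<le> s0"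
    and h: "AE y in lebesgue. 0 < snd y \<and> q y \<le> s0 \<longrightarrow> a (snd y) * q y \<le> h y"
    and init: "\<And>x. \<forall>i. \<bar>x $ i - x0 $ i\<bar> \<le> pi / (2 * \<beta>) \<Longrightarrow> exp (prim a t0 + P t0) * \<kappa> * G \<le> q (x, t0)"
  shows "exp (prim a t1 + P t1) * \<kappa> \<le> q (x0 + (t1 - t0) *\<^sub>R c, t1)"
proof -
  \<comment> \<open>The first zero of \<open>cos (\<beta> * y)\<close>: the barrier vanishes on the
    sides of the cube of this half-width.\<close>
  define \<rho> where "\<rho> = pi / (2 * \<beta>)"
  have \<rho>: "0 < \<rho>" "\<beta> * \<rho> = pi / 2" using \<beta> by (simp_all add: \<rho>_def)
  define g where "g i y = exp (- (c $ i / 2) * y) * cos (\<beta> * y)" for i y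
  define g1 where "g1 i y = exp (- (c $ i / 2) * y) * (- (c $ i / 2) * cos (\<beta> * y) - \<beta> * sin (\<beta> * y))" for i y
  define g2 where "g2 i y = exp (- (c $ i / 2) * y) * (((c $ i)\<^sup>2 / 4 - \<beta>\<^sup>2) * cos (\<beta> * y) + c $ i * \<beta> * sin (\<beta> * y))" for i y
  have dg: "(g i has_real_derivative g1 i y) (at y)" for i y
    unfolding g_def g1_def by (auto intro!: derivative_eq_intros simp: algebra_simps)
  have dg1: "(g1 i has_real_derivative g2 i y) (at y)" for i y
    unfolding g1_def g2_def by (auto intro!: derivative_eq_intros simp: field_simps power2_eq_square)
  have gid: "- (c $ i) * g1 i y - g2 i y = ((c $ i)\<^sup>2 / 4 + \<beta>\<^sup>2) * g i y" for i y
    unfolding g_def g1_def g2_def by (simp add: field_simps power2_eq_square)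
  define Y where "Y i z = fst z $ i - x0 $ i - (snd z - t0) * c $ i" for i and z :: "(real^'n) \<times> real"
  define R where "R i z = (\<Prod>j\<in>UNIV - {i}. g j (Y j z))" for i z
  define H where "H z = (\<Prod>j\<in>UNIV. g j (Y j z))" for z
  have HR: "H z = g i (Y i z) * R i z" for i z
    unfolding H_def R_def by (rule prod.remove) auto
  define \<psi> where "\<psi> z = \<kappa> * exp (P (snd z)) * H z" for z
  define \<psi>x where "\<psi>x i z = \<kappa> * exp (P (snd z)) * (g1 i (Y i z) * R i z)" for i z
  define \<psi>xx where "\<psi>xx i z = \<kappa> * exp (P (snd z)) * (g2 i (Y i z) * R i z)" for i z
  define \<psi>t where "\<psi>t z = \<kappa> * exp (P (snd z)) * (P' (snd z) * H z + (\<Sum>i\<in>UNIV. g1 i (Y i z) * - (c $ i) * R i z))" for z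
  \<comment> \<open>Written as a continuous image of a product of compact sets to make compactness
    immediate; \<open>memD\<close> gives the working description.\<close>
  define D where "D = (\<lambda>(y, t). (x0 + y + (t - t0) *\<^sub>R c, t)) ` (cbox (\<chi> i. - \<rho>) (\<chi> i. \<rho>) \<times> {t0..t1})"
  have ab: "\<bar>y\<bar> \<le> \<rho> \<longleftrightarrow> - \<rho> \<le> y \<and> y \<le> \<rho>" for y by auto
  have memD: "z \<in> D \<longleftrightarrow> t0 \<le> snd z \<and> snd z \<le> t1 \<and> (\<forall>i. \<bar>Y i z\<bar> \<le> \<rho>)" for z
  proof
    assume "z \<in> D"
    then show "t0 \<le> snd z \<and> snd z \<le> t1 \<and> (\<forall>i. \<bar>Y i z\<bar> \<le> \<rho>)"
      by (auto simp: D_def Y_def mem_box_cart ab)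
  next
    assume z: "t0 \<le> snd z \<and> snd z \<le> t1 \<and> (\<forall>i. \<bar>Y i z\<bar> \<le> \<rho>)"
    have "z = (\<lambda>(y, t). (x0 + y + (t - t0) *\<^sub>R c, t)) (fst z - x0 - (snd z - t0) *\<^sub>R c, snd z)" by simp
    moreover have "(fst z - x0 - (snd z - t0) *\<^sub>R c, snd z) \<in> cbox (\<chi> i. - \<rho>) (\<chi> i. \<rho>) \<times> {t0..t1}"
      using z by (auto simp: Y_def mem_box_cart ab)
    ultimately show "z \<in> D" unfolding D_def by (rule image_eqI)
  qed
  have g0: "0 \<le> g i (Y i z)" "g i (Y i z) \<le> exp (\<gamma> * pi / (4 * \<beta>))" if "z \<in> D" for i z
  proof -
    have Y: "\<bar>Y i z\<bar> \<le> \<rho>" using that memD by blast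
    have "\<bar>\<beta> * Y i z\<bar> \<le> pi / 2"
      using mult_left_mono[OF Y, of \<beta>] \<beta> \<rho>(2) by (simp add: abs_mult)
    then have cos: "0 \<le> cos (\<beta> * Y i z)" by (intro cos_ge_zero) (auto simp: abs_le_iff)
    then show "0 \<le> g i (Y i z)" by (simp add: g_def)
    have "- (c $ i / 2) * Y i z \<le> \<bar>c $ i\<bar> / 2 * \<bar>Y i z\<bar>"
      using abs_ge_self[of "- (c $ i / 2) * Y i z"] by (simp add: abs_mult)
    also have "\<dots> \<le> \<gamma> / 2 * \<rho>"
      using Y c component_le_norm_cart[of c i] by (intro mult_mono) auto
    finally have "- (c $ i / 2) * Y i z \<le> \<gamma> * pi / (4 * \<beta>)" by (simp add: \<rho>_def)
    then have "g i (Y i z) \<le> exp (\<gamma> * pi / (4 * \<beta>)) * 1"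
      unfolding g_def using cos by (intro mult_mono) auto
    then show "g i (Y i z) \<le> exp (\<gamma> * pi / (4 * \<beta>))" by simp
  qed
  have H: "0 \<le> H z" "H z \<le> G" if "z \<in> D" for z
  proof -
    show "0 \<le> H z" unfolding H_def by (intro prod_nonneg) (use g0[OF that] in auto)
    have "H z \<le> (\<Prod>j\<in>(UNIV::'n set). exp (\<gamma> * pi / (4 * \<beta>)))"
      unfolding H_def by (intro prod_mono) (use g0[OF that] in auto)
    then show "H z \<le> G" by (simp add: G)
  qed
  have Yc: "continuous_on S (Y i)" for S i
    unfolding Y_def by (intro continuous_intros)
  have bound: "exp (prim a (snd z)) * \<psi> z \<le> exp (prim a (snd z) + P (snd z)) * \<kappa> * G" if "z \<in> D" for z
  proof -
    have "exp (prim a (snd z)) * \<psi> z = exp (prim a (snd z) + P (snd z)) * \<kappa> * H z"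
      by (simp add: \<psi>_def exp_add)
    also have "\<dots> \<le> exp (prim a (snd z) + P (snd z)) * \<kappa> * G"
      using H[OF that] \<kappa> by (intro mult_left_mono) auto
    finally show ?thesis .
  qed
  let ?z1 = "(x0 + (t1 - t0) *\<^sub>R c, t1)"
  have "exp (prim a (snd ?z1)) * \<psi> ?z1 \<le> q ?z1"
  proof (rule comparison[where D=D and N="UNIV \<times> {0<..}" and \<psi>=\<psi> and ?s0.0=s0 and ?t0.0=t0
            and \<psi>x=\<psi>x and \<psi>xx=\<psi>xx and \<psi>t=\<psi>t, OF q wh a])
    show "compact D" unfolding D_def split_beta
      by (intro compact_continuous_image compact_Times compact_cbox continuous_intros) auto
    show "open (UNIV \<times> {0<..} :: ((real^'n) \<times> real) set)" by (intro open_Times) auto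
    show "D \<subseteq> UNIV \<times> {0<..}"
    proof
      fix z assume "z \<in> D"
      then show "z \<in> UNIV \<times> {0<..}" using memD t(1) by (cases z) auto
    qed
    show "0 < t0" by fact
    show "t0 \<le> snd z" if "z \<in> D" for z using that memD by blast
    show "continuous_on D \<psi>"
    proof -
      have "isCont P t" if "t \<in> {t0..t1}" for t using DERIV_isCont[OF P] that by auto
      then have "continuous_on {t0..t1} P" by (auto intro: continuous_at_imp_continuous_on)
      then have "continuous_on D (\<lambda>z. P (snd z))"
        by (rule continuous_on_compose2) (use memD in \<open>auto intro!: continuous_intros\<close>)
      then show ?thesis unfolding \<psi>_def H_def g_def by (intro continuous_intros Yc)
    qed
    show "((\<lambda>s. \<psi> (x, s)) has_real_derivative \<psi>t (x, t)) (at t)" if xt: "(x, t) \<in> D" for x t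
    proof -
      have dP: "(P has_real_derivative P' t) (at t)" using P xt memD by auto
      have "((\<lambda>s. g j (Y j (x, s))) has_real_derivative g1 j (Y j (x, t)) * - (c $ j)) (at t)" for j
        by (rule DERIV_chain2[OF dg]) (auto simp: Y_def intro!: derivative_eq_intros)
      then have "((\<lambda>s. \<Prod>j\<in>UNIV. g j (Y j (x, s))) has_real_derivative
          (\<Sum>i\<in>UNIV. g1 i (Y i (x, t)) * - (c $ i) * (\<Prod>j\<in>UNIV - {i}. g j (Y j (x, t))))) (at t)"
        by (intro has_field_derivative_prod)
      then have dH: "((\<lambda>s. H (x, s)) has_real_derivative (\<Sum>i\<in>UNIV. g1 i (Y i (x, t)) * - (c $ i) * R i (x, t))) (at t)"
        by (simp only: H_def R_def)
      show ?thesis unfolding \<psi>_def \<psi>t_def snd_conv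
        by (rule DERIV_cong[OF DERIV_mult[OF DERIV_cmult[OF DERIV_chain2[OF DERIV_exp dP]] dH]])
           (simp add: algebra_simps)
    qed
    have Rs: "R i (x + s *\<^sub>R axis i 1, t) = R i (x, t)" for i x s t
      unfolding R_def by (intro prod.cong) (auto simp: Y_def axis_def)
    have Ys: "((\<lambda>s. Y i (x + s *\<^sub>R axis i 1, t)) has_real_derivative 1) (at s)" for i x s t
      unfolding Y_def by (auto intro!: derivative_eq_intros)
    show "((\<lambda>s. \<psi> (x + s *\<^sub>R axis i 1, t)) has_real_derivative \<psi>x i (x + s *\<^sub>R axis i 1, t)) (at s)" for i x t s
      unfolding \<psi>_def \<psi>x_def HR[of _ i] Rs snd_conv
      by (rule DERIV_cong[OF DERIV_cmult[OF DERIV_cmult_right[OF DERIV_chain2[OF dg Ys]]]]) simp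
    show "((\<lambda>s. \<psi>x i (x + s *\<^sub>R axis i 1, t)) has_real_derivative \<psi>xx i (x, t)) (at 0)" for i x t
      unfolding \<psi>xx_def \<psi>x_def Rs snd_conv
      by (rule DERIV_cong[OF DERIV_cmult[OF DERIV_cmult_right[OF DERIV_chain2[OF dg1 Ys]]]]) simp
    show "\<psi>t z \<le> (\<Sum>i\<in>UNIV. \<psi>xx i z)" if z: "z \<in> D" for z
    proof -
      have "\<psi>t z - (\<Sum>i\<in>UNIV. \<psi>xx i z) = \<kappa> * exp (P (snd z)) *
          (P' (snd z) * H z + (\<Sum>i\<in>UNIV. (- (c $ i) * g1 i (Y i z) - g2 i (Y i z)) * R i z))"
      proof -
        have "(\<Sum>i\<in>UNIV. (- (c $ i) * g1 i (Y i z) - g2 i (Y i z)) * R i z) =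
            (\<Sum>i\<in>UNIV. g1 i (Y i z) * - (c $ i) * R i z) - (\<Sum>i\<in>UNIV. g2 i (Y i z) * R i z)"
          unfolding sum_subtractf[symmetric] by (intro sum.cong refl) (simp add: algebra_simps)
        then show ?thesis
          unfolding \<psi>t_def \<psi>xx_def sum_distrib_left[symmetric]
          by (simp only: right_diff_distrib[symmetric]) (simp only: add_diff_eq)
      qed
      also have "(\<Sum>i\<in>UNIV. (- (c $ i) * g1 i (Y i z) - g2 i (Y i z)) * R i z) = (\<Sum>i\<in>UNIV. ((c $ i)\<^sup>2 / 4 + \<beta>\<^sup>2) * H z)"
        unfolding gid by (intro sum.cong refl) (simp only: HR[symmetric] mult.assoc)
      also have "\<dots> = ((norm c)\<^sup>2 / 4 + real CARD('n) * \<beta>\<^sup>2) * H z"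
        unfolding norm_vec_sq[of c, symmetric]
        by (simp add: sum_distrib_right[symmetric] sum.distrib sum_divide_distrib)
      finally have "\<psi>t z - (\<Sum>i\<in>UNIV. \<psi>xx i z) =
          \<kappa> * exp (P (snd z)) * (H z * (P' (snd z) + (norm c)\<^sup>2 / 4 + real CARD('n) * \<beta>\<^sup>2))"
        by (simp add: algebra_simps)
      moreover have "H z * (P' (snd z) + (norm c)\<^sup>2 / 4 + real CARD('n) * \<beta>\<^sup>2) \<le> 0"
        using H(1)[OF z] P'[of "snd z"] z memD by (intro mult_nonneg_nonpos) auto
      then have "\<kappa> * exp (P (snd z)) * (H z * (P' (snd z) + (norm c)\<^sup>2 / 4 + real CARD('n) * \<beta>\<^sup>2)) \<le> 0"
        using \<kappa> by (intro mult_nonneg_nonpos[of "\<kappa> * exp (P (snd z))"]) auto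
      ultimately show ?thesis by linarith
    qed
    show "exp (prim a (snd z)) * \<psi> z \<le> s0" if "z \<in> D" for z
      by (rule order_trans[OF bound[OF that] level]) (use that memD in auto)
    show "AE y in lebesgue. y \<in> UNIV \<times> {0<..} \<and> q y \<le> s0 \<longrightarrow> a (snd y) * q y \<le> h y"
      using h by eventually_elim auto
    show "exp (prim a t0) * \<psi> (x, t0) \<le> q (x, t0)" if "(x, t0) \<in> D" for x
    proof -
      have "\<forall>i. \<bar>x $ i - x0 $ i\<bar> \<le> pi / (2 * \<beta>)" using that memD by (auto simp: Y_def \<rho>_def)
      from init[OF this] show ?thesis using bound[OF that] by simp
    qed
    show "\<exists>\<delta>>0. \<forall>x' s. dist x' x < \<delta> \<and> t - \<delta> < s \<and> s \<le> t \<longrightarrow> (x', s) \<in> D"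
      if xt: "(x, t) \<in> D" "t0 < t" "q (x, t) < exp (prim a t) * \<psi> (x, t)" for x t
    proof -
      \<comment> \<open>As \<open>q \<ge> 0\<close>, a point where the barrier exceeds
        \<open>q\<close> has no vanishing cosine factor, so it is off the sides of the cube.\<close>
      have "0 < exp (prim a t) * \<psi> (x, t)" using xt(3) qr[of "(x, t)"] by linarith
      then have "\<psi> (x, t) \<noteq> 0" by auto
      then have "H (x, t) \<noteq> 0" by (auto simp: \<psi>_def)
      then have ne: "g i (Y i (x, t)) \<noteq> 0" for i by (auto simp: H_def)
      have lt: "\<bar>Y i (x, t)\<bar> < \<rho>" for i
      proof -
        have "\<bar>Y i (x, t)\<bar> \<le> \<rho>" using xt(1) memD by blast
        moreover have "\<bar>Y i (x, t)\<bar> \<noteq> \<rho>"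
        proof
          assume "\<bar>Y i (x, t)\<bar> = \<rho>"
          then have "\<beta> * Y i (x, t) = pi / 2 \<or> \<beta> * Y i (x, t) = - (pi / 2)"
            using \<rho>(2) by (auto simp: abs_if split: if_splits)
          then have "cos (\<beta> * Y i (x, t)) = 0"
            by (elim disjE) (simp_all only: cos_pi_half cos_minus)
          then show False using ne[of i] by (simp add: g_def)
        qed
        ultimately show ?thesis by simp
      qed
      have "open (\<Inter>i. {z. \<bar>Y i z\<bar> < \<rho>})"
        by (intro open_INT ballI open_Collect_less continuous_intros Yc) auto
      moreover have "(x, t) \<in> (\<Inter>i. {z. \<bar>Y i z\<bar> < \<rho>})" using lt by auto
      ultimately obtain e where e: "0 < e" "\<And>z. dist z (x, t) < e \<Longrightarrow> z \<in> (\<Inter>i. {z. \<bar>Y i z\<bar> < \<rho>})"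
        by (meson open_dist)
      have "(x', s) \<in> D" if s: "dist x' x < e / 2" "t - e / 2 < s" "t - (t - t0) < s" "s \<le> t" for x' s
      proof -
        have "dist (x', s) (x, t) \<le> dist x' x + dist s t"
          using norm_Pair_le[of "x' - x" "s - t"] by (simp add: dist_norm)
        also have "\<dots> < e" using s by (simp add: dist_real_def)
        finally have "\<forall>i. \<bar>Y i (x', s)\<bar> < \<rho>" using e(2) by blast
        then show ?thesis using memD s xt(1) by (force intro: less_imp_le)
      qed
      then show ?thesis using e(1) xt(2)
        by (intro exI[of _ "min (e / 2) (t - t0)"]) auto
    qed
    show "?z1 \<in> D" using memD t(2) \<rho>(1) by (simp add: Y_def)
  qed
  moreover have "H ?z1 = 1" by (simp add: H_def Y_def g_def)
  ultimately show ?thesis by (simp add: \<psi>_def exp_add mult_ac)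
qed

section \<open>Spreading\<close>

lemma cube_norm:
  fixes x :: "real^'n"
  assumes "\<forall>i. \<bar>x $ i\<bar> \<le> \<rho>"
  shows "norm x \<le> real CARD('n) * \<rho>"
proof -
  have "norm x \<le> (\<Sum>i\<in>UNIV. \<bar>x $ i\<bar>)" by (rule norm_le_l1_cart)
  also have "\<dots> \<le> (\<Sum>i\<in>(UNIV::'n set). \<rho>)" using assms by (intro sum_mono) auto
  finally show ?thesis by simp
qed

text \<open>The source is nonnegative, so the coefficient 0 is admissible. A cube started at
  \<open>x0\<close> with velocity \<open>x - x0\<close> has its centre at \<open>x\<close> after
  unit time, and its loss of height is uniform over \<open>norm x \<le> \<rho>\<close>. Adapting the
  velocity, not the duration, keeps \<open>t0\<close> independent of \<rho>.\<close>

lemma instantaneous_positivity: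
  fixes q h :: "(real^'n) \<times> real \<Rightarrow> real"
  assumes q: "continuous_on UNIV q" and wh: "weak_heat q h" and qr: "\<And>z. 0 \<le> q z"
    and h: "AE y in lebesgue. 0 < snd y \<longrightarrow> 0 \<le> h y" and x0: "q (x0, 0) \<noteq> 0"
  shows "\<exists>t0>0. \<forall>\<rho>. \<exists>\<kappa>>0. \<forall>x. norm x \<le> \<rho> \<longrightarrow> \<kappa> \<le> q (x, t0)"
proof -
  define \<delta> where "\<delta> = q (x0, 0) / 2"
  have \<delta>: "0 < \<delta>" "q (x0, 0) = 2 * \<delta>" using qr[of "(x0, 0)"] x0 by (auto simp: \<delta>_def)
  have "isCont q (x0, 0)" using q by (simp add: continuous_on_eq_continuous_at)
  then obtain d where d: "0 < d" "\<And>z. dist z (x0, 0) < d \<Longrightarrow> dist (q z) (q (x0, 0)) < \<delta>"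
    unfolding continuous_at_eps_delta using \<delta>(1) by (auto simp: dist_norm)
  define \<tau> where "\<tau> = d / 4"
  define N where "N = real CARD('n)"
  have N: "0 < N" by (simp add: N_def)
  \<comment> \<open>The cube lies within \<open>d / 4\<close> of \<open>x0\<close>; with
    \<open>\<tau> = d / 4\<close> in time this stays in the ball of radius \<open>d\<close> where
    \<open>q\<close> is close to \<open>q (x0, 0)\<close>.\<close>
  define \<beta> where "\<beta> = 2 * N * pi / d"
  have \<tau>: "0 < \<tau>" and \<beta>: "0 < \<beta>" and cube: "N * (pi / (2 * \<beta>)) = d / 4"
    using d N by (simp_all add: \<tau>_def \<beta>_def)
  have near: "\<delta> \<le> q (x, \<tau>)" if "\<forall>i. \<bar>x $ i - x0 $ i\<bar> \<le> pi / (2 * \<beta>)" for x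
  proof -
    have "\<forall>i. \<bar>(x - x0) $ i\<bar> \<le> pi / (2 * \<beta>)" using that by simp
    from cube_norm[OF this] have "norm (x - x0) \<le> d / 4" by (simp only: cube[unfolded N_def])
    moreover have "dist (x, \<tau>) (x0, 0) \<le> norm (x - x0) + norm \<tau>"
      using norm_Pair_le[of "x - x0" \<tau>] by (simp add: dist_norm)
    ultimately have "dist (x, \<tau>) (x0, 0) < d" using d(1) by (simp add: \<tau>_def)
    from d(2)[OF this] show ?thesis using \<delta>(2) by (simp add: dist_real_def)
  qed
  have "\<exists>\<kappa>>0. \<forall>x. norm x \<le> \<rho> \<longrightarrow> \<kappa> \<le> q (x, \<tau> + 1)" for \<rho>
  proof -
    define \<gamma> where "\<gamma> = \<bar>\<rho>\<bar> + norm x0"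
    define G where "G = exp (\<gamma> * pi / (4 * \<beta>)) ^ CARD('n)"
    have G: "0 < G" by (simp add: G_def)
    define K where "K = \<gamma>\<^sup>2 / 4 + N * \<beta>\<^sup>2"
    have K: "0 \<le> K" using N by (simp add: K_def)
    have "exp (- K) * (\<delta> / G) \<le> q (x, \<tau> + 1)" if x: "norm x \<le> \<rho>" for x
    proof -
      have c: "norm (x - x0) \<le> \<gamma>" using norm_triangle_ineq4[of x x0] x by (simp add: \<gamma>_def)
      have "exp (prim (\<lambda>_. 0) (\<tau> + 1) + - K * (\<tau> + 1 - \<tau>)) * (\<delta> / G) \<le> q (x0 + (\<tau> + 1 - \<tau>) *\<^sub>R (x - x0), \<tau> + 1)"
      proof (rule moving_cube[where a="\<lambda>_. 0" and P="\<lambda>t. - K * (t - \<tau>)" and P'="\<lambda>_. - K" and L=0 and ?s0.0=\<delta>,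
            OF q wh qr _ _ \<tau> _ \<beta> _ c _ _ G_def])
        show "((\<lambda>t. - K * (t - \<tau>)) has_real_derivative - K) (at t)" for t
          by (auto intro!: derivative_eq_intros)
        have "(norm (x - x0))\<^sup>2 \<le> \<gamma>\<^sup>2" using c by (intro power_mono) auto
        then show "- K + (norm (x - x0))\<^sup>2 / 4 + real CARD('n) * \<beta>\<^sup>2 \<le> 0" by (simp add: K_def N_def)
        show "exp (prim (\<lambda>_. 0) t + - K * (t - \<tau>)) * (\<delta> / G) * G \<le> \<delta>" if "\<tau> \<le> t" for t
        proof -
          have "exp (prim (\<lambda>_. 0) t + - K * (t - \<tau>)) \<le> 1"
            using K that \<tau> by (simp add: prim_const)
          then have "exp (prim (\<lambda>_. 0) t + - K * (t - \<tau>)) * \<delta> \<le> 1 * \<delta>"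
            using \<delta>(1) by (intro mult_right_mono) auto
          then show ?thesis using G by simp
        qed
        show "AE y in lebesgue. 0 < snd y \<and> q y \<le> \<delta> \<longrightarrow> 0 * q y \<le> h y"
          using h by eventually_elim auto
        show "exp (prim (\<lambda>_. 0) \<tau> + - K * (\<tau> - \<tau>)) * (\<delta> / G) * G \<le> q (x, \<tau>)"
          if "\<forall>i. \<bar>x $ i - x0 $ i\<bar> \<le> pi / (2 * \<beta>)" for x
          using near[OF that] G \<tau> by (simp add: prim_const)
      qed (use \<delta>(1) G in auto)
      then show ?thesis using \<tau> by (simp add: prim_const)
    qed
    moreover have "0 < exp (- K) * (\<delta> / G)" using \<delta>(1) G by simp
    ultimately show ?thesis by blast
  qed
  then show ?thesis using \<tau> by (intro exI[of _ "\<tau> + 1"]) auto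
qed

text \<open>The coefficient \<open>a\<close> may oscillate: subtracting its sliding average over a period \<open>T\<close>
  leaves a function with bounded primitive, so that the amplitude of the cube stays bounded.\<close>

lemma cone_lower_bound:
  fixes q h :: "(real^'n) \<times> real \<Rightarrow> real"
  assumes q: "continuous_on UNIV q" and wh: "weak_heat q h" and qr: "\<And>z. 0 \<le> q z"
    and a: "a \<in> borel_measurable borel" "\<And>s. \<bar>a s\<bar> \<le> L"
    and h: "\<And>\<zeta>. 0 < \<zeta> \<Longrightarrow> \<exists>s0>0. AE y in lebesgue. 0 < snd y \<and> q y \<le> s0 \<longrightarrow> (a (snd y) - \<zeta>) * q y \<le> h y"
    and t0: "0 < t0" and pos: "\<And>\<rho>. \<exists>\<kappa>>0. \<forall>x. norm x \<le> \<rho> \<longrightarrow> \<kappa> \<le> q (x, t0)"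
    and T: "0 < T" and avg: "\<And>t. 0 < t \<Longrightarrow> m * T \<le> prim a (t + T) - prim a t"
    and \<gamma>: "0 \<le> \<gamma>" "\<gamma>\<^sup>2 / 4 < m"
  shows "\<exists>\<kappa>>0. \<forall>t\<ge>t0. \<forall>x. norm x \<le> \<gamma> * (t - t0) \<longrightarrow> \<kappa> \<le> q (x, t)"
proof -
  have L: "0 \<le> L" using a(2)[of 0] by simp
  define N where "N = real CARD('n)"
  have N: "0 < N" by (simp add: N_def)
  \<comment> \<open>Half of the available gap: one \<zeta> pays for linearising \<open>f\<close>,
    the other for the finite width of the cube,
    \<open>N * \<beta>\<^sup>2 = \<zeta>\<close>.\<close>
  define \<zeta> where "\<zeta> = (m - \<gamma>\<^sup>2 / 4) / 2"
  have \<zeta>: "0 < \<zeta>" using \<gamma> by (simp add: \<zeta>_def)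
  define \<beta> where "\<beta> = sqrt (\<zeta> / N)"
  have \<beta>: "0 < \<beta>" "N * \<beta>\<^sup>2 = \<zeta>" using \<zeta> N by (simp_all add: \<beta>_def)
  define F where "F t = integral {0..t} (prim a)" for t
  have F: "(F has_real_derivative prim a t) (at t)" if "0 < t" for t
  proof -
    have "((\<lambda>x. integral {0..x} (prim a)) has_real_derivative prim a t) (at t within {0..t + 1})"
      by (rule integral_has_real_derivative[OF prim_continuous[OF a]]) (use that in auto)
    moreover have "at t within {0..t + 1} = at t" by (rule at_within_interior) (use that in auto)
    ultimately show ?thesis by (simp add: F_def[abs_def])
  qed
  \<comment> \<open>A primitive of the sliding average of \<open>a\<close>. Its derivative is at
    least \<open>m\<close> by \<open>avg\<close>, while as a mean of \<open>prim a\<close> over a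
    window of length \<open>T\<close> it stays within \<open>L * T\<close> of
    \<open>prim a\<close>.\<close>
  define A where "A t = (F (t + T) - F t) / T" for t
  have dA: "(A has_real_derivative (prim a (t + T) - prim a t) / T) (at t)" if "0 < t" for t
  proof -
    have "((\<lambda>t. F (t + T)) has_real_derivative prim a (t + T)) (at t)"
      using F[of "t + T"] that T DERIV_shift[of F _ t T] by simp
    then show ?thesis unfolding A_def using F[OF that] by (intro DERIV_cdivide DERIV_diff)
  qed
  have Ab: "\<bar>prim a t - A t\<bar> \<le> L * T" if "0 < t" for t
  proof -
    obtain \<xi> where \<xi>: "t < \<xi>" "\<xi> < t + T" "F (t + T) - F t = (t + T - t) * prim a \<xi>"
    proof -
      have "t < t + T" using T by simp
      moreover have "\<And>x. t \<le> x \<Longrightarrow> x \<le> t + T \<Longrightarrow> (F has_real_derivative prim a x) (at x)"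
        using F \<open>0 < t\<close> by simp
      ultimately show ?thesis using MVT2[of t "t + T" F "prim a"] that by blast
    qed
    then have "A t = prim a \<xi>" using T by (simp add: A_def)
    moreover have "\<bar>prim a t - prim a \<xi>\<bar> \<le> L * \<bar>t - \<xi>\<bar>" by (rule prim_lipschitz[OF a])
    moreover have "L * \<bar>t - \<xi>\<bar> \<le> L * T" using \<xi> L by (intro mult_left_mono) auto
    ultimately show ?thesis by simp
  qed
  obtain s0 where s0: "0 < s0" and hs: "AE y in lebesgue. 0 < snd y \<and> q y \<le> s0 \<longrightarrow> (a (snd y) - \<zeta>) * q y \<le> h y"
    using h[OF \<zeta>] by blast
  obtain \<kappa>1 where \<kappa>1: "0 < \<kappa>1" "\<And>x. norm x \<le> N * (pi / (2 * \<beta>)) \<Longrightarrow> \<kappa>1 \<le> q (x, t0)"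
    using pos by blast
  define G where "G = exp (\<gamma> * pi / (4 * \<beta>)) ^ CARD('n)"
  have G: "0 < G" by (simp add: G_def)
  \<comment> \<open>Normalised so that the largest possible amplitude meets both the level
    \<open>s0\<close> and the initial bound \<open>\<kappa>1\<close>.\<close>
  define \<kappa> where "\<kappa> = min s0 \<kappa>1 / (exp (L * T) * G)"
  have \<kappa>: "0 < \<kappa>" "exp (L * T) * \<kappa> * G = min s0 \<kappa>1" using s0 \<kappa>1 G by (simp_all add: \<kappa>_def)
  \<comment> \<open>The term \<open>\<zeta> * t\<close> undoes the shift of the coefficient to
    \<open>a - \<zeta>\<close>, so that the total exponent is the bounded function
    \<open>prim a - A\<close>.\<close>
  define P where "P t = - A t + \<zeta> * t" for t
  have sum: "prim (\<lambda>s. a s - \<zeta>) t + P t = prim a t - A t" if "0 < t" for t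
    using prim_shift[OF a, of t \<zeta>] that by (simp add: P_def)
  have amp: "exp (prim (\<lambda>s. a s - \<zeta>) t + P t) * \<kappa> * G \<le> min s0 \<kappa>1" if "0 < t" for t
  proof -
    have "exp (prim (\<lambda>s. a s - \<zeta>) t + P t) \<le> exp (L * T)"
      unfolding sum[OF that] using Ab[OF that] by simp
    then have "exp (prim (\<lambda>s. a s - \<zeta>) t + P t) * \<kappa> * G \<le> exp (L * T) * \<kappa> * G"
      using \<kappa>(1) G by (intro mult_right_mono) auto
    then show ?thesis by (simp add: \<kappa>(2))
  qed
  have "exp (- (L * T)) * \<kappa> \<le> q (x, t)" if t: "t0 \<le> t" and x: "norm x \<le> \<gamma> * (t - t0)" for x t
  proof -
    \<comment> \<open>The constant velocity leading from 0 to \<open>x\<close>. For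
      \<open>t = t0\<close> division by zero gives \<open>c = 0\<close>, which is right because then
      \<open>norm x \<le> 0\<close>.\<close>
    define c where "c = (1 / (t - t0)) *\<^sub>R x"
    have xc: "(t - t0) *\<^sub>R c = x" using x by (auto simp: c_def)
    have c: "norm c \<le> \<gamma>"
    proof (cases "t = t0")
      case False
      then show ?thesis using x t by (simp add: c_def divide_le_eq)
    qed (use \<gamma> in \<open>simp add: c_def\<close>)
    have "exp (prim (\<lambda>s. a s - \<zeta>) t + P t) * \<kappa> \<le> q (0 + (t - t0) *\<^sub>R c, t)"
    proof (rule moving_cube[where a="\<lambda>s. a s - \<zeta>" and P=P and P'="\<lambda>t. - ((prim a (t + T) - prim a t) / T) + \<zeta>"
          and L="L + \<zeta>" and ?s0.0=s0, OF q wh qr _ _ t0 t \<beta>(1) \<kappa>(1) c _ _ G_def])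
      show "(\<lambda>s. a s - \<zeta>) \<in> borel_measurable borel" using a(1) by simp
      show "\<bar>a s - \<zeta>\<bar> \<le> L + \<zeta>" for s using a(2)[of s] \<zeta> by linarith
      show "(P has_real_derivative - ((prim a (t + T) - prim a t) / T) + \<zeta>) (at t)" if "t0 \<le> t" for t
        unfolding P_def using that t0 by (auto intro!: derivative_eq_intros dA)
      show "- ((prim a (t + T) - prim a t) / T) + \<zeta> + (norm c)\<^sup>2 / 4 + real CARD('n) * \<beta>\<^sup>2 \<le> 0" if "t0 \<le> t" for t
      proof -
        have "m \<le> (prim a (t + T) - prim a t) / T" using avg[of t] that t0 T by (simp add: le_divide_eq)
        moreover have "(norm c)\<^sup>2 \<le> \<gamma>\<^sup>2" using c by (intro power_mono) auto
        moreover have "real CARD('n) * \<beta>\<^sup>2 = \<zeta>" using \<beta>(2) by (simp add: N_def)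
        moreover have "2 * \<zeta> = m - \<gamma>\<^sup>2 / 4" by (simp add: \<zeta>_def)
        ultimately show ?thesis by linarith
      qed
      show "exp (prim (\<lambda>s. a s - \<zeta>) t + P t) * \<kappa> * G \<le> s0" if "t0 \<le> t" for t
        using amp[of t] that t0 by simp
      show "exp (prim (\<lambda>s. a s - \<zeta>) t0 + P t0) * \<kappa> * G \<le> q (x, t0)"
        if "\<forall>i. \<bar>x $ i - 0 $ i\<bar> \<le> pi / (2 * \<beta>)" for x
      proof -
        have "\<forall>i. \<bar>x $ i\<bar> \<le> pi / (2 * \<beta>)" using that by simp
        from cube_norm[OF this] have "norm x \<le> N * (pi / (2 * \<beta>))" by (simp only: N_def)
        from \<kappa>1(2)[OF this] show ?thesis using amp[OF t0] by simp
      qed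
    qed (use hs in simp)
    moreover have "exp (- (L * T)) * \<kappa> \<le> exp (prim (\<lambda>s. a s - \<zeta>) t + P t) * \<kappa>"
      using sum[of t] Ab[of t] t t0 \<kappa>(1) by (intro mult_right_mono) (auto simp: abs_le_iff)
    ultimately show ?thesis by (simp add: xc)
  qed
  moreover have "0 < exp (- (L * T)) * \<kappa>" using \<kappa>(1) by simp
  ultimately show ?thesis by blast
qed

text \<open>On the range from \<open>s1\<close> to \<open>1 - \<eta>\<close> the source is at least
  \<open>k q\<close>. A concave paraboloid of height \<open>s1\<close> is started a fixed time
  \<open>S\<close> before \<open>t\<close> and grows at rate \<open>k\<close>; its spreading loss is
  made small by taking it flat. All constants are independent of the centre \<open>x0\<close> and of
  \<open>t\<close>, which makes the convergence uniform.\<close>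

lemma convergence_to_one:
  fixes q h :: "(real^'n) \<times> real \<Rightarrow> real"
  assumes q: "continuous_on UNIV q" and wh: "weak_heat q h"
    and h: "\<And>s1 s0. 0 < s1 \<Longrightarrow> s0 < 1 \<Longrightarrow>
      \<exists>k>0. AE y in lebesgue. 0 < snd y \<and> s1 \<le> q y \<and> q y \<le> s0 \<longrightarrow> k * q y \<le> h y"
    and t0: "0 < t0" and \<kappa>: "0 < \<kappa>" and cone: "\<And>t x. t0 \<le> t \<Longrightarrow> norm x \<le> \<gamma>' * (t - t0) \<Longrightarrow> \<kappa> \<le> q (x, t)"
    and \<gamma>: "0 \<le> \<gamma>" "\<gamma> < \<gamma>'" and \<epsilon>: "0 < \<epsilon>"
  shows "\<exists>t2>0. \<forall>t\<ge>t2. \<forall>x. norm x \<le> \<gamma> * t \<longrightarrow> 1 - \<epsilon> \<le> q (x, t)"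
proof -
  define \<eta> where "\<eta> = min (\<epsilon> / 2) (1 / 2)"
  have \<eta>: "0 < \<eta>" "\<eta> < 1" "2 * \<eta> \<le> \<epsilon>" using \<epsilon> by (auto simp: \<eta>_def)
  define s1 where "s1 = min \<kappa> (1 - \<eta>)"
  have s1: "0 < s1" "s1 \<le> \<kappa>" "s1 \<le> 1 - \<eta>" using \<kappa> \<eta> by (auto simp: s1_def)
  obtain k where k: "0 < k" and hk: "AE y in lebesgue. 0 < snd y \<and> s1 \<le> q y \<and> q y \<le> 1 - \<eta> \<longrightarrow> k * q y \<le> h y"
    using h[of s1 "1 - \<eta>"] s1 \<eta> by auto
  \<comment> \<open>The time in which growth at rate \<open>k\<close> raises the height
    \<open>s1\<close> to \<open>1 - \<eta>\<close>.\<close>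
  define S where "S = ln ((1 - \<eta>) / s1) / k"
  have S: "0 \<le> S" "exp (k * S) * s1 = 1 - \<eta>" using s1 k \<eta> by (simp_all add: S_def)
  define N where "N = real CARD('n)"
  have N: "0 < N" by (simp add: N_def)
  \<comment> \<open>So flat that the loss \<open>b * (2 * N * S)\<close> at the centre, amplified by
    \<open>exp (k * S)\<close>, is at most \<eta>; the price is a large radius \<rho>.\<close>
  define b where "b = \<eta> / (2 * N * (S + 1) * exp (k * S))"
  have b: "0 < b" "exp (k * S) * (b * (2 * N * S)) \<le> \<eta>"
  proof -
    show "0 < b" using \<eta> N S by (auto simp: b_def intro!: divide_pos_pos mult_pos_pos)
    have "exp (k * S) * (b * (2 * N * (S + 1))) = \<eta>" using N S by (simp add: b_def)
    moreover have "exp (k * S) * (b * (2 * N * S)) \<le> exp (k * S) * (b * (2 * N * (S + 1)))"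
      using \<open>0 < b\<close> N by (intro mult_left_mono) auto
    ultimately show "exp (k * S) * (b * (2 * N * S)) \<le> \<eta>" by simp
  qed
  define \<rho> where "\<rho> = sqrt (s1 / b)"
  have \<rho>: "0 < \<rho>" "b * \<rho>\<^sup>2 = s1" using s1 b by (simp_all add: \<rho>_def)
  \<comment> \<open>Solves
    \<open>\<gamma> * t + \<rho> + 1 \<le> \<gamma>' * (t - S - 1 - t0)\<close> for
    \<open>t\<close>, so that the paraboloid with unit margins in space and time lies in the cone
    where \<open>q \<ge> \<kappa>\<close>.\<close>
  define t2 where "t2 = t0 + S + 1 + (\<gamma>' * (S + 1 + t0) + \<rho> + 1) / (\<gamma>' - \<gamma>)"
  have t2: "t0 + S + 1 \<le> t2"
    using \<gamma> S \<rho> t0 by (auto simp: t2_def intro!: divide_nonneg_pos add_nonneg_nonneg mult_nonneg_nonneg)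
  have "1 - \<epsilon> \<le> q (x0, t)" if t: "t2 \<le> t" and x0: "norm x0 \<le> \<gamma> * t" for x0 t
  proof -
    have far: "\<gamma> * t + \<rho> + 1 \<le> \<gamma>' * (t - S - 1 - t0)"
    proof -
      have "(\<gamma>' * (S + 1 + t0) + \<rho> + 1) / (\<gamma>' - \<gamma>) \<le> t" using t S(1) t0 by (simp add: t2_def)
      then have "\<gamma>' * (S + 1 + t0) + \<rho> + 1 \<le> t * (\<gamma>' - \<gamma>)" using \<gamma> by (simp add: divide_le_eq)
      then show ?thesis by (simp add: algebra_simps)
    qed
    define t' where "t' = t - S"
    have t': "0 < t'" "t0 + 1 \<le> t'" "t' \<le> t" using t t2 t0 S(1) by (auto simp: t'_def)
    \<comment> \<open>The unit margins make \<open>U\<close> an open neighbourhood of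
      \<open>D\<close> with room for kernels. On it \<open>q \<ge> s1\<close>, so in the range of
      validity of \<open>k * q \<le> h\<close> only the upper end remains, and that is the level of
      the comparison.\<close>
    define U where "U = ball x0 (\<rho> + 1) \<times> {t' - 1<..}"
    have low: "s1 \<le> q y" if "y \<in> U" for y
    proof -
      have y: "dist x0 (fst y) < \<rho> + 1" "t' - 1 < snd y" using that by (auto simp: U_def)
      have "norm (fst y) \<le> norm x0 + dist x0 (fst y)"
        using norm_triangle_sub[of "fst y" x0] by (simp add: dist_norm norm_minus_commute)
      also have "\<dots> \<le> \<gamma>' * (t - S - 1 - t0)" using far x0 y by linarith
      also have "\<dots> \<le> \<gamma>' * (snd y - t0)" using y \<gamma> by (intro mult_left_mono) (auto simp: t'_def)
      finally have "\<kappa> \<le> q (fst y, snd y)" using y t' by (intro cone) auto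
      then show ?thesis using s1 by simp
    qed
    \<comment> \<open>The factor \<open>exp (- (k * t'))\<close> restarts the growth at time
      \<open>t'\<close>, since \<open>prim\<close> counts from 0.\<close>
    define \<psi> where "\<psi> z = exp (- (k * t')) * (s1 - b * ((fst z - x0) \<bullet> (fst z - x0) + 2 * N * (snd z - t')))"
      for z :: "(real^'n) \<times> real"
    define \<psi>t where "\<psi>t z = - (exp (- (k * t')) * (b * (2 * N)))" for z :: "(real^'n) \<times> real"
    define \<psi>x where "\<psi>x i z = - (exp (- (k * t')) * (b * (2 * (fst z - x0) $ i)))" for i and z :: "(real^'n) \<times> real"
    define \<psi>xx where "\<psi>xx i z = - (exp (- (k * t')) * (b * 2))" for i :: 'n and z :: "(real^'n) \<times> real"
    define D where "D = cball x0 \<rho> \<times> {t'..t}"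
    have val: "exp (prim (\<lambda>_. k) (snd z)) * \<psi> z =
        exp (k * (snd z - t')) * (s1 - b * ((fst z - x0) \<bullet> (fst z - x0) + 2 * N * (snd z - t')))" if "0 \<le> snd z" for z
    proof -
      have "exp (k * (snd z - t')) = exp (prim (\<lambda>_. k) (snd z)) * exp (- (k * t'))"
        using that by (simp add: prim_const exp_add[symmetric] algebra_simps)
      then show ?thesis by (simp only: \<psi>_def mult.assoc)
    qed
    have le: "exp (prim (\<lambda>_. k) (snd z)) * \<psi> z \<le> exp (k * (snd z - t')) * s1" if "t' \<le> snd z" for z
      using val[of z] that t' b(1) N by (auto intro!: mult_left_mono mult_nonneg_nonneg add_nonneg_nonneg)
    have "exp (prim (\<lambda>_. k) (snd (x0, t))) * \<psi> (x0, t) \<le> q (x0, t)"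
    proof (rule comparison[where D=D and N=U and \<psi>=\<psi> and ?s0.0="1 - \<eta>" and ?t0.0=t' and L=k
            and \<psi>x=\<psi>x and \<psi>xx=\<psi>xx and \<psi>t=\<psi>t and a="\<lambda>_. k", OF q wh])
      show "compact D" unfolding D_def by (intro compact_Times) auto
      show "open U" unfolding U_def by (intro open_Times) auto
      show "D \<subseteq> U" by (auto simp: D_def U_def)
      show "0 < t'" by fact
      show "t' \<le> snd z" if "z \<in> D" for z using that by (auto simp: D_def)
      show "continuous_on D \<psi>" unfolding \<psi>_def by (intro continuous_intros)
      show "((\<lambda>s. \<psi> (x, s)) has_real_derivative \<psi>t (x, s)) (at s)" for x s
        unfolding \<psi>_def \<psi>t_def fst_conv snd_conv by (auto intro!: derivative_eq_intros)
      show "((\<lambda>s. \<psi> (x + s *\<^sub>R axis i 1, r)) has_real_derivative \<psi>x i (x + s *\<^sub>R axis i 1, r)) (at s)" for i x r s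
        unfolding \<psi>_def \<psi>x_def fst_conv snd_conv
        by (auto intro!: derivative_eq_intros simp: inner_simps inner_axis inner_axis' algebra_simps)
      show "((\<lambda>s. \<psi>x i (x + s *\<^sub>R axis i 1, r)) has_real_derivative \<psi>xx i (x, r)) (at 0)" for i x r
        unfolding \<psi>xx_def \<psi>x_def fst_conv snd_conv by (auto intro!: derivative_eq_intros)
      show "\<psi>t z \<le> (\<Sum>i\<in>UNIV. \<psi>xx i z)" for z by (simp add: \<psi>t_def \<psi>xx_def N_def)
      show "exp (prim (\<lambda>_. k) (snd z)) * \<psi> z \<le> 1 - \<eta>" if "z \<in> D" for z
      proof -
        have z: "t' \<le> snd z" "snd z \<le> t" using that by (auto simp: D_def)
        have "exp (k * (snd z - t')) * s1 \<le> exp (k * S) * s1"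
          using z k s1 by (intro mult_right_mono) (auto simp: t'_def)
        then show ?thesis using le[OF z(1)] S(2) by simp
      qed
      show "AE y in lebesgue. y \<in> U \<and> q y \<le> 1 - \<eta> \<longrightarrow> k * q y \<le> h y"
        using hk
      proof eventually_elim
        case (elim y)
        have "0 < snd y" if "y \<in> U" using that t' t0 by (auto simp: U_def)
        then show ?case using elim low by blast
      qed
      show "exp (prim (\<lambda>_. k) t') * \<psi> (x, t') \<le> q (x, t')" if "(x, t') \<in> D" for x
      proof -
        have "(x, t') \<in> U" using that by (auto simp: D_def U_def)
        from low[OF this] show ?thesis using le[of "(x, t')"] by simp
      qed
      show "\<exists>\<delta>>0. \<forall>x' s'. dist x' x < \<delta> \<and> s - \<delta> < s' \<and> s' \<le> s \<longrightarrow> (x', s') \<in> D"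
        if xs: "(x, s) \<in> D" "t' < s" "q (x, s) < exp (prim (\<lambda>_. k) s) * \<psi> (x, s)" for x s
      proof -
        \<comment> \<open>Where the barrier exceeds \<open>q\<close> it is positive, and it is
          positive only for \<open>norm (x - x0) < \<rho>\<close>; this excludes the lateral
          boundary.\<close>
        have "(x, s) \<in> U" using xs(1) by (auto simp: D_def U_def)
        then have "0 < exp (prim (\<lambda>_. k) s) * \<psi> (x, s)" using low xs(3) s1(1) by fastforce
        then have "0 < s1 - b * ((x - x0) \<bullet> (x - x0) + 2 * N * (s - t'))"
        proof -
          have "0 \<le> s" using t' xs(2) by simp
          then have "0 < exp (k * (s - t')) * (s1 - b * ((x - x0) \<bullet> (x - x0) + 2 * N * (s - t')))"
            using val[of "(x, s)"] \<open>0 < exp (prim (\<lambda>_. k) s) * \<psi> (x, s)\<close> by (simp only: fst_conv snd_conv)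
          then show ?thesis by (rule zero_less_mult_pos) simp
        qed
        moreover have "0 \<le> b * (2 * N * (s - t'))" using b(1) N xs(2) by simp
        ultimately have "b * (norm (x - x0))\<^sup>2 < b * \<rho>\<^sup>2"
          unfolding \<rho>(2) power2_norm_eq_inner distrib_left by linarith
        then have "norm (x - x0) < \<rho>" using b(1) \<rho>(1) by (simp add: power_less_imp_less_base)
        then have "dist x0 x < \<rho>" by (simp add: dist_norm norm_minus_commute)
        moreover have "(x', s') \<in> D" if "dist x' x < \<rho> - dist x0 x" "s - (s - t') < s'" "s' \<le> s" for x' s'
          using that xs(1) dist_triangle[of x0 x' x] by (auto simp: D_def dist_commute)
        ultimately show ?thesis using xs(2)
          by (intro exI[of _ "min (\<rho> - dist x0 x) (s - t')"]) auto
      qed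
      show "(x0, t) \<in> D" using \<rho> t' by (simp add: D_def)
    qed (use k in auto)
    moreover have "exp (prim (\<lambda>_. k) (snd (x0, t))) * \<psi> (x0, t) = exp (k * S) * s1 - exp (k * S) * (b * (2 * N * S))"
      using val[of "(x0, t)"] t' by (simp add: t'_def right_diff_distrib)
    ultimately show ?thesis using S(2) b(2) \<eta>(3) by linarith
  qed
  moreover have "0 < t2" using t2 t0 S(1) by linarith
  ultimately show ?thesis by blast
qed

section \<open>Return to the original coefficient and the two limits\<close>

lemma prim_eq_lebesgue:
  assumes a: "a \<in> borel_measurable borel" "\<And>s. \<bar>a s\<bar> \<le> L"
    and \<mu>: "\<mu> \<in> borel_measurable lebesgue" "AE t in lebesgue. a t = \<mu> t" and st: "0 \<le> s" "s \<le> t"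
  shows "(LINT y:{s..t}|lebesgue. \<mu> y) = prim a t - prim a s"
proof -
  have i: "(\<lambda>y. indicator {s..t} y *\<^sub>R a y) \<in> borel_measurable lborel" using a(1) by simp
  have "(LINT y:{s..t}|lebesgue. \<mu> y) = (LINT y|lebesgue. indicator {s..t} y *\<^sub>R a y)"
    unfolding set_lebesgue_integral_def
  proof (rule integral_cong_AE)
    show "(\<lambda>y. indicator {s..t} y *\<^sub>R \<mu> y) \<in> borel_measurable lebesgue"
      by (intro borel_measurable_scaleR borel_measurable_indicator \<mu>(1)) simp
    show "(\<lambda>y. indicator {s..t} y *\<^sub>R a y) \<in> borel_measurable lebesgue" by (rule measurable_completion[OF i])
    show "AE y in lebesgue. indicator {s..t} y *\<^sub>R \<mu> y = indicator {s..t} y *\<^sub>R a y"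
      using \<mu>(2) by eventually_elim simp
  qed
  also have "\<dots> = (LINT y|lborel. indicator {s..t} y *\<^sub>R a y)" by (rule integral_completion[OF i])
  also have "\<dots> = (LINT y|lborel. indicator {s<..t} y *\<^sub>R a y)"
  proof (rule integral_cong_AE)
    show "AE y in lborel. indicator {s..t} y *\<^sub>R a y = indicator {s<..t} y *\<^sub>R a y"
      using AE_lborel_singleton[of s] by eventually_elim (auto simp: indicator_def)
  qed (use a(1) in auto)
  also have "\<dots> = prim a t - prim a s"
    using prim_diff[OF a st] by (simp add: set_lebesgue_integral_def)
  finally show ?thesis .
qed

lemma exp_linear_decay:
  fixes s \<sigma> R :: real
  assumes "0 < s" "0 < \<sigma>"
  shows "((\<lambda>t. exp (- (s * (\<sigma> * t - R)))) \<longlongrightarrow> 0) at_top"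
proof (rule filterlim_compose[OF exp_at_bot])
  show "filterlim (\<lambda>t. - (s * (\<sigma> * t - R))) at_bot at_top"
    unfolding filterlim_at_bot
  proof
    fix Z :: real
    show "eventually (\<lambda>t. - (s * (\<sigma> * t - R)) \<le> Z) at_top"
      unfolding eventually_at_top_linorder
    proof (intro exI allI impI)
      fix t assume "(R - Z / s) / \<sigma> \<le> t"
      then have "- Z / s \<le> \<sigma> * t - R" using assms by (simp add: divide_le_eq mult.commute)
      then have "s * (- Z / s) \<le> s * (\<sigma> * t - R)" using assms by (intro mult_left_mono) auto
      then have "- Z \<le> s * (\<sigma> * t - R)" using assms by simp
      then show "- (s * (\<sigma> * t - R)) \<le> Z" by simp
    qed
  qed
qed

theorem proposition2p6:
  fixes f :: "real \<Rightarrow> real \<Rightarrow> real"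
    and \<mu> :: "real \<Rightarrow> real"
    and u0 :: "real ^ 'n \<Rightarrow> real"
    and u :: "(real ^ 'n) \<times> real \<Rightarrow> real"
  assumes f_Linfty: "\<And>v. v \<in> {0..1} \<Longrightarrow> Linfty (\<lambda>t. f t v)"
    and f_Lipschitz: "\<exists>L. \<forall>t. L-lipschitz_on {0..1} (f t)"
    and f_C1: "C1_near_0_uniformly f"
    and mu: "\<And>t. \<mu> t = deriv_u f t 0"
    and f_zeros: "AE t in lebesgue. f t 0 = 0 \<and> f t 1 = 0"
    and f_pos: "\<And>v. v \<in> {0<..<1} \<Longrightarrow> ess_inf (\<lambda>t. f t v) > 0"
    and f_KPP: "AE (t, v) in lebesgue. v \<in> {0..1} \<longrightarrow> f t v \<le> \<mu> t * v"
    and f_lower: "\<exists>C>0. \<exists>\<nu>\<in>{0<..1}. \<exists>\<delta>\<in>{0<..1}.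
          AE (t, v) in lebesgue. v \<in> {0..\<delta>} \<longrightarrow> f t v \<ge> \<mu> t * v - C * v powr (1 + \<nu>)"
    and u0_cont: "continuous_on UNIV u0"
    and u0_range: "\<And>x. 0 \<le> u0 x \<and> u0 x \<le> 1"
    and u0_nontrivial: "\<exists>x. u0 x \<noteq> 0"
    and u_solution: "strong_solution f u0 u"
  shows "(\<forall>\<gamma>. 0 \<le> \<gamma> \<and> \<gamma> < 2 * sqrt (least_mean_plus \<mu>) \<longrightarrow>
            ((\<lambda>t. INF x\<in>{x. norm x \<le> \<gamma> * t}. u (x, t)) \<longlongrightarrow> 1) at_top) \<and>
         (compact (closure {x. u0 x \<noteq> 0}) \<longrightarrow>
            (\<forall>\<sigma>>0.
              ((\<lambda>t. SUP x\<in>{x. norm x \<ge> 2 * sqrt (t * (LINT s:{0..t}|lebesgue. \<mu> s)) + \<sigma> * t}. u (x, t))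
                 \<longlongrightarrow> 0) at_top))"
proof -
  obtain q h a L where q: "continuous_on UNIV q" and wh: "weak_heat q h"
    and qu: "\<And>x t. 0 \<le> t \<Longrightarrow> q (x, t) = u (x, t)" and qr: "\<And>z. 0 \<le> q z \<and> q z \<le> 1"
    and a: "a \<in> borel_measurable borel" "\<And>s. \<bar>a s\<bar> \<le> L"
    and \<mu>: "\<mu> \<in> borel_measurable lebesgue" "AE t in lebesgue. a t = \<mu> t"
    and up: "AE y in lebesgue. 0 < snd y \<longrightarrow> h y \<le> a (snd y) * q y"
    and nonneg: "AE y in lebesgue. 0 < snd y \<longrightarrow> 0 \<le> h y"
    and low: "\<And>\<zeta>. 0 < \<zeta> \<Longrightarrow> \<exists>s0>0. AE y in lebesgue. 0 < snd y \<and> q y \<le> s0 \<longrightarrow> (a (snd y) - \<zeta>) * q y \<le> h y"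
    and pos: "\<And>s1 s0. 0 < s1 \<Longrightarrow> s0 < 1 \<Longrightarrow>
      \<exists>k>0. AE y in lebesgue. 0 < snd y \<and> s1 \<le> q y \<and> q y \<le> s0 \<longrightarrow> k * q y \<le> h y"
    and a_pos: "\<exists>c>0. AE t in lebesgue. c \<le> a t"
    using kpp_setup[OF f_Linfty f_Lipschitz f_C1 mu f_zeros f_pos f_KPP f_lower u_solution] by blast
  have u0: "u (x, 0) = u0 x" for x using u_solution by (simp add: strong_solution_def)
  have ur: "0 \<le> u (x, t)" "u (x, t) \<le> 1" if "0 \<le> t" for x t using qr[of "(x, t)"] qu[OF that] by auto
  show ?thesis
  proof (intro conjI impI allI)
    fix \<gamma> assume \<gamma>: "0 \<le> \<gamma> \<and> \<gamma> < 2 * sqrt (least_mean_plus \<mu>)"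
    \<comment> \<open>The midpoint is still subcritical, as the cone estimate requires, and exceeds
      \<gamma>, as the push to 1 requires.\<close>
    define \<gamma>' where "\<gamma>' = (\<gamma> + 2 * sqrt (least_mean_plus \<mu>)) / 2"
    have \<gamma>': "\<gamma> < \<gamma>'" "\<gamma>' / 2 < sqrt (least_mean_plus \<mu>)" "0 \<le> \<gamma>'" using \<gamma> by (auto simp: \<gamma>'_def)
    then have "0 < least_mean_plus \<mu>" using real_sqrt_gt_0_iff[of "least_mean_plus \<mu>"] by linarith
    then have "\<gamma>'\<^sup>2 / 4 < least_mean_plus \<mu>"
      using power_strict_mono[OF \<gamma>'(2), of 2] \<gamma>'(3) by (simp add: power_divide)
    then obtain m where m: "\<gamma>'\<^sup>2 / 4 < m" "m < least_mean_plus \<mu>"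
      using dense by blast
    let ?avg = "\<lambda>T t. (1 / T) * (LINT s:{t..t + T}|lebesgue. \<mu> s)"
    have avg: "?avg T t = (prim a (t + T) - prim a t) / T" if "0 < T" "0 < t" for T t
      using prim_eq_lebesgue[OF a \<mu>, of t "t + T"] that by simp
    \<comment> \<open>\<open>least_mean_plus\<close> is built from suprema and infima of reals,
      which are informative for bounded sets only; the Lipschitz bound of \<open>prim a\<close>
      supplies boundedness.\<close>
    have "\<bar>?avg T t\<bar> \<le> L" if "0 < T" "0 < t" for T t
    proof -
      have "\<bar>prim a (t + T) - prim a t\<bar> \<le> L * T" using prim_lipschitz[OF a, of "t + T" t] that by simp
      then show ?thesis unfolding avg[OF that] using that by (simp add: abs_divide divide_le_eq)
    qed
    then have avgb: "- L \<le> ?avg T t" "?avg T t \<le> L" if "0 < T" "0 < t" for T t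
      using that unfolding abs_le_iff by (auto simp only: minus_le_iff)
    have bb: "bdd_below (?avg T ` {0<..})" if "0 < T" for T
      by (rule bdd_belowI2[of _ "- L"]) (use avgb(1)[OF that] in auto)
    have "bdd_above ((\<lambda>T. INF t\<in>{0<..}. ?avg T t) ` {0<..})"
    proof (rule bdd_aboveI2[of _ _ L])
      fix T :: real assume "T \<in> {0<..}"
      then have T: "0 < T" by simp
      show "(INF t\<in>{0<..}. ?avg T t) \<le> L"
        by (rule cINF_lower2[OF bb[OF T], of 1]) (use avgb(2)[OF T, of 1] in auto)
    qed
    then obtain T where T: "0 < T" "m < (INF t\<in>{0<..}. ?avg T t)"
      using m(2) unfolding least_mean_plus_def by (subst (asm) less_cSUP_iff) auto
    have mT: "m * T \<le> prim a (t + T) - prim a t" if "0 < t" for t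
    proof -
      have "m < ?avg T t"
        using T(2) cINF_lower[OF bb[OF T(1)], of t] that by simp
      then show ?thesis unfolding avg[OF T(1) that] using T(1) by (simp add: less_divide_eq)
    qed
    obtain x0 where "u0 x0 \<noteq> 0" using u0_nontrivial by blast
    then have x0: "q (x0, 0) \<noteq> 0" by (simp add: qu u0)
    have q0: "0 \<le> q z" for z using qr by blast
    obtain t0 where t0: "0 < t0" "\<And>\<rho>. \<exists>\<kappa>>0. \<forall>x. norm x \<le> \<rho> \<longrightarrow> \<kappa> \<le> q (x, t0)"
      using instantaneous_positivity[OF q wh q0 nonneg x0] by blast
    obtain \<kappa> where \<kappa>: "0 < \<kappa>" "\<And>t x. t0 \<le> t \<Longrightarrow> norm x \<le> \<gamma>' * (t - t0) \<Longrightarrow> \<kappa> \<le> q (x, t)"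
      using cone_lower_bound[OF q wh q0 a low t0 T(1) mT \<gamma>'(3) m(1)] by blast
    show "((\<lambda>t. INF x\<in>{x. norm x \<le> \<gamma> * t}. u (x, t)) \<longlongrightarrow> 1) at_top"
    proof (rule tendstoI)
      fix \<epsilon> :: real assume "0 < \<epsilon>"
      then have \<epsilon>: "0 < \<epsilon> / 2" by simp
      obtain t2 where t2: "0 < t2" "\<And>t x. t2 \<le> t \<Longrightarrow> norm x \<le> \<gamma> * t \<Longrightarrow> 1 - \<epsilon> / 2 \<le> q (x, t)"
        using convergence_to_one[OF q wh pos t0(1) \<kappa> _ \<gamma>'(1) \<epsilon>] \<gamma> by blast
      show "eventually (\<lambda>t. dist (INF x\<in>{x. norm x \<le> \<gamma> * t}. u (x, t)) 1 < \<epsilon>) at_top"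
        unfolding eventually_at_top_linorder
      proof (intro exI allI impI)
        fix t assume t: "t2 \<le> t"
        then have t': "0 \<le> t" using t2(1) by simp
        have ne: "0 \<in> {x::real^'n. norm x \<le> \<gamma> * t}" using \<gamma> t' by simp
        have "1 - \<epsilon> / 2 \<le> (INF x\<in>{x. norm x \<le> \<gamma> * t}. u (x, t))"
        proof (rule cINF_greatest)
          show "{x::real^'n. norm x \<le> \<gamma> * t} \<noteq> {}" using ne by blast
        qed (use t2(2)[OF t] qu[OF t'] in auto)
        moreover have "(INF x\<in>{x. norm x \<le> \<gamma> * t}. u (x, t)) \<le> 1"
          by (rule cINF_lower2[OF bdd_belowI2[of _ 0] ne]) (use ur[OF t'] in auto)
        ultimately show "dist (INF x\<in>{x. norm x \<le> \<gamma> * t}. u (x, t)) 1 < \<epsilon>"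
          using \<epsilon> by (simp add: dist_real_def)
      qed
    qed
  next
    fix \<sigma> :: real assume "compact (closure {x. u0 x \<noteq> 0})" and \<sigma>: "0 < \<sigma>"
    then have "bounded {x. u0 x \<noteq> 0}" by (meson bounded_closure_image bounded_subset closure_subset compact_imp_bounded)
    then obtain R where R: "0 < R" "\<And>x. u0 x \<noteq> 0 \<Longrightarrow> norm x \<le> R" by (auto simp: bounded_pos)
    then have supp: "q (x, 0) = 0" if "R < norm x" for x using that by (force simp: qu u0)
    obtain c where c: "0 < c" "AE t in lebesgue. c \<le> a t" using a_pos by blast
    let ?M = "\<lambda>t. LINT s:{0..t}|lebesgue. \<mu> s"
    let ?X = "\<lambda>t. {x::real^'n. norm x \<ge> 2 * sqrt (t * ?M t) + \<sigma> * t}"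
    \<comment> \<open>\<open>R \<le> \<sigma> * t\<close> makes the bound monotone in the slope
      \<open>l\<close>, so that \<open>l\<close> can be replaced by \<open>sqrt c\<close>, which
      does not depend on time.\<close>
    have bound: "u (x, t) \<le> exp (- (sqrt c * (\<sigma> * t - R)))" if t: "0 < t" "R \<le> \<sigma> * t" and x: "x \<in> ?X t" for x t
    proof -
      have M: "?M t = prim a t" using prim_eq_lebesgue[OF a \<mu>, of 0 t] t by (simp add: prim_0)
      have cM: "c * t \<le> prim a t" by (rule prim_ge[OF a _ c(2)]) (use t in simp)
      have M0: "0 < prim a t" using cM c(1) t by (meson less_le_trans mult_pos_pos)
      \<comment> \<open>The minimiser of \<open>l\<^sup>2 * t - l * norm x\<close> for
        \<open>norm x = 2 * sqrt (t * prim a t)\<close>. On that sphere the exponent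
        \<open>2 * prim a t - l * norm x\<close> is 0, and the excess \<open>\<sigma> * t\<close>
        produces the decay.\<close>
      define l where "l = sqrt (prim a t / t)"
      have l: "sqrt c \<le> l" "0 \<le> l" "l\<^sup>2 * t = prim a t" "l * sqrt (t * prim a t) = prim a t"
      proof -
        show "sqrt c \<le> l" unfolding l_def using cM t by (simp add: le_divide_eq)
        show "0 \<le> l" unfolding l_def using M0 t by simp
        show "l\<^sup>2 * t = prim a t" unfolding l_def using M0 t by simp
        have "l * sqrt (t * prim a t) = sqrt (prim a t / t * (t * prim a t))"
          unfolding l_def by (simp only: real_sqrt_mult)
        also have "\<dots> = sqrt ((prim a t)\<^sup>2)" using t by (simp add: power2_eq_square)
        finally show "l * sqrt (t * prim a t) = prim a t" using M0 by simp
      qed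
      have nx: "2 * sqrt (t * prim a t) + \<sigma> * t \<le> norm x" using x by (simp add: M)
      moreover have "0 < \<sigma> * t" "0 \<le> sqrt (t * prim a t)" using \<sigma> t M0 by auto
      ultimately have n0: "0 < norm x" by linarith
      define e where "e = (1 / norm x) *\<^sub>R x"
      have e: "norm e = 1" "e \<bullet> x = norm x"
        using n0 by (simp_all add: e_def power2_norm_eq_inner[symmetric] power2_eq_square)
      have "q (x, t) \<le> exp (prim a t) * exp (l\<^sup>2 * t - l * (e \<bullet> x) + l * R)"
        by (rule upper_barrier[OF q wh qr a up supp e(1) l(2) t(1)])
      also have "\<dots> = exp (2 * prim a t - l * norm x + l * R)"
        by (simp add: exp_add[symmetric] e(2) l(3))
      also have "\<dots> \<le> exp (- (sqrt c * (\<sigma> * t - R)))"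
      proof -
        have "l * (2 * sqrt (t * prim a t) + \<sigma> * t) \<le> l * norm x" using nx l(2) by (rule mult_left_mono)
        then have "2 * prim a t + l * (\<sigma> * t) \<le> l * norm x"
          using l(4) by (simp add: distrib_left)
        moreover have "sqrt c * (\<sigma> * t - R) \<le> l * (\<sigma> * t - R)" using l(1) t by (intro mult_right_mono) auto
        ultimately show ?thesis by (simp add: right_diff_distrib)
      qed
      finally show ?thesis using qu t by simp
    qed
    show "((\<lambda>t. SUP x\<in>?X t. u (x, t)) \<longlongrightarrow> 0) at_top"
    proof (rule tendsto_sandwich[OF _ _ tendsto_const exp_linear_decay[OF _ \<sigma>]])
      \<comment> \<open>The supremum of an empty set of reals would be unspecified; vectors of every
        nonnegative norm exist.\<close>
      have ne: "?X t \<noteq> {}" for t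
        using vector_choose_size[of "\<bar>2 * sqrt (t * ?M t) + \<sigma> * t\<bar>"] by (metis (mono_tags, lifting) abs_ge_self abs_ge_zero empty_iff mem_Collect_eq)
      show "eventually (\<lambda>t. 0 \<le> (SUP x\<in>?X t. u (x, t))) at_top"
        unfolding eventually_at_top_linorder
      proof (intro exI allI impI)
        fix t :: real assume t: "0 \<le> t"
        obtain x where x: "x \<in> ?X t" using ne by blast
        show "0 \<le> (SUP x\<in>?X t. u (x, t))"
          by (rule cSUP_upper2[OF bdd_aboveI2[of _ _ 1] x]) (use ur[OF t] in auto)
      qed
      show "eventually (\<lambda>t. (SUP x\<in>?X t. u (x, t)) \<le> exp (- (sqrt c * (\<sigma> * t - R)))) at_top"
        unfolding eventually_at_top_linorder
      proof (intro exI allI impI)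
        fix t assume t: "max 1 (R / \<sigma>) \<le> t"
        then have "0 < t" "R \<le> \<sigma> * t" using \<sigma> by (auto simp: divide_le_eq mult.commute)
        then show "(SUP x\<in>?X t. u (x, t)) \<le> exp (- (sqrt c * (\<sigma> * t - R)))"
          by (intro cSUP_least ne bound)
      qed
      show "0 < sqrt c" using c(1) by simp
    qed
  qed
qed

end
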